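(* Let $\mathcal{E}$ be a regular ($\mathsf{Pos}$-enriched) category and let $F\colon\mathcal{E}\to\mathcal{F}$ be a regular functor with $\mathcal{F}$ an exact ($\mathsf{Pos}$-enriched) category. Let $\overline{F}\colon\mathcal{E}_{ex/reg}\to\mathcal{F}$ be the (unique up to isomorphism) regular functor with $\overline{F}\circ\Gamma\cong F$. Then $\overline{F}$ is an equivalence if and only if $F$ is fully order-faithful and covering.
   Context: All categories and functors are enriched over the cartesian closed category $\mathsf{Pos}$ of posets and monotone maps: each hom-set is partially ordered, composition is monotone in each variable, functors preserve the order on morphisms. Limits are weighted ($\mathsf{Pos}$-enriched); in particular the projections of products and pullbacks are jointly order-monomorphic, where a family $(p_i)$ with common domain is jointly order-monomorphic if $p_iu\le p_iv$ for all $i$ implies $u\le v$. A morphism $m\colon X\to Y$ is an $\mathsf{ff}$-morphism if $mf\le mg$ implies $f\le g$ for all $f,g\colon Z\to X$. A morphism $e\colon A\to B$ of a category $\mathcal{C}$ is an $\mathsf{so}$-morphism if for every $\mathsf{ff}$-morphism $m\colon X\to Y$ the canonical square from $\mathcal{C}(B,X)$ to $\mathcal{C}(A,X)$, $\mathcal{C}(B,Y)$ over $\mathcal{C}(A,Y)$ (composing with $e$ and $m$) is a pullback in $\mathsf{Pos}$. The coinserter of $f_0,f_1\colon C\to A$ is a morphism $e\colon A\to B$ with $ef_0\le ef_1$ through which every $g\colon A\to Z$ with $gf_0\le gf_1$ factors, and such that $ue\le ve$ implies $u\le v$; a morphism is an effective epimorphism if it is the coinserter of some parallel pair (in a regular category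 these are exactly the $\mathsf{so}$-morphisms). The comma object $f/g$ of $f\colon X\to Z$, $g\colon Y\to Z$ is given by jointly order-monomorphic $c_0\colon f/g\to X$, $c_1\colon f/g\to Y$ with $fc_0\le gc_1$, such that any $u_0,u_1$ with $fu_0\le gu_1$ factor as $u_0=c_0u$, $u_1=c_1u$. A category is regular if it has all finite weighted limits, every morphism factors as an $\mathsf{so}$-morphism followed by an $\mathsf{ff}$-morphism, and $\mathsf{so}$-morphisms are stable under pullback. A regular functor between regular categories is a functor preserving finite limits and $\mathsf{so}$-morphisms. A functor $F\colon\mathcal{C}\to\mathcal{D}$ is order-faithful if $Ff\le Fg$ implies $f\le g$ for all parallel $f,g$ in $\mathcal{C}$; fully order-faithful if it is full and order-faithful; covering if for every $Y\in\mathcal{D}$ there are $X\in\mathcal{C}$ and an effective epimorphism $FX\twoheadrightarrow Y$. A relation $R\colon X\looparrowright Y$ in a regular category is a subobject of $X\times Y$ represented by an $\mathsf{ff}$-morphism $\langle r_0,r_1\rangle\colon R\rightarrowtail X\times Y$; relations are ordered by inclusion. For $x\colon A\to X$, $y\colon A\to Y$ write $(x,y)\in_A R$ if $\langle x,y\rangle$ factors through $\langle r_0,r_1\rangle$. The composite $SR\colon X\looparrowright Z$ of $R\colon X\looparrowright Y$ and $S\colon Y\looparrowright Z$ is the $\mathsf{ff}$-part of the $(\mathsf{so},\mathsf{ff})$-factorization of $\langle r_0t_0,s_1t_1\rangle$, where $(T,t_0,t_1)$ is the pullback of $r_1$ and $s_0$. $R$ is weakening-closed if $x'\le x$, $(x,y)\in_A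 R$, $y\le y'$ imply $(x',y')\in_A R$. $I_X:=1_X/1_X$. For $f\colon X\to Y$, $f_*:=f/1_Y\colon X\looparrowright Y$, i.e. $(x,y)\in_A f_*\iff fx\le y$. A congruence on $X$ is a weakening-closed relation $E\colon X\looparrowright X$ that is reflexive and transitive. It is effective if $E=f/f$ for some morphism $f\colon X\to Y$. A regular category is exact if every congruence in it is effective. $Q_w(\mathcal{E})$ is the locally posetal bicategory with objects the pairs $(X,E)$, $E$ a congruence on $X\in\mathcal{E}$; morphisms $(X,E)\to(Y,F)$ the relations $\Phi\colon X\looparrowright Y$ in $\mathcal{E}$ with $F\Phi E=\Phi$, ordered by inclusion; composition that of relations; identity on $(X,E)$ the relation $E$. The category $\mathcal{E}_{ex/reg}$ has the same objects; its morphisms $(X,E)\to(Y,F)$ are the morphisms $R_*\colon(X,E)\to(Y,F)$ of $Q_w(\mathcal{E})$ having a right adjoint, i.e. for which there is $R^*\colon(Y,F)\to(X,E)$ in $Q_w(\mathcal{E})$ with $R^*R_*\supseteq E$ and $R_*R^*\subseteq F$; the order is $R_*\le S_*:\iff R_*\supseteq S_*$. The functor $\Gamma\colon\mathcal{E}\to\mathcal{E}_{ex/reg}$ sends $X$ to $(X,I_X)$ and $f\colon X\to Y$ to $f_*$. The category $\mathcal{E}_{ex/reg}$ is regular and exact, $\Gamma$ is a regular functor, and for every regular functor $F\colon\mathcal{E}\to\mathcal{F}$ with $\mathcal{F}$ exact there is a regular functor $\overline{F}\colon\mathcal{E}_{ex/reg}\to\mathcal{F}$, unique up to isomorphism, with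 $\overline{F}\Gamma\cong F$. *)

theory Defs
  imports Main
begin

section \<open>Categories and functors enriched in posets\<close>

record ('o, 'm) pcat =
  Obj :: "'o set"
  Arr :: "'m set"
  Dom :: "'m \<Rightarrow> 'o"
  Cod :: "'m \<Rightarrow> 'o"
  Ident :: "'o \<Rightarrow> 'm"
  Comp :: "'m \<Rightarrow> 'm \<Rightarrow> 'm" (infixr "\<cdot>\<index>" 70)
  Le :: "'m \<Rightarrow> 'm \<Rightarrow> bool" (infix "\<preceq>\<index>" 50)

definition hom :: "('o, 'm) pcat \<Rightarrow> 'o \<Rightarrow> 'o \<Rightarrow> 'm set" where
  "hom C X Y = {f \<in> Arr C. Dom C f = X \<and> Cod C f = Y}"

text \<open>Composition is written in the order of application of functions: \<open>g \<cdot> f\<close> is \<open>g\<close> after \<open>f\<close>.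
  The values of \<open>Comp\<close> on non-composable and of \<open>Le\<close> on non-parallel arrows are irrelevant.\<close>

locale pos_category =
  fixes C :: "('o, 'm) pcat" (structure)
  assumes dom_cod: "f \<in> Arr C \<Longrightarrow> Dom C f \<in> Obj C \<and> Cod C f \<in> Obj C"
    and ident_hom: "X \<in> Obj C \<Longrightarrow> Ident C X \<in> hom C X X"
    and comp_hom: "f \<in> hom C X Y \<Longrightarrow> g \<in> hom C Y Z \<Longrightarrow> g \<cdot> f \<in> hom C X Z"
    and ident_left: "f \<in> hom C X Y \<Longrightarrow> Ident C Y \<cdot> f = f"
    and ident_right: "f \<in> hom C X Y \<Longrightarrow> f \<cdot> Ident C X = f"
    and comp_assoc:
      "f \<in> hom C W X \<Longrightarrow> g \<in> hom C X Y \<Longrightarrow> h \<in> hom C Y Z \<Longrightarrow> (h \<cdot> g) \<cdot> f = h \<cdot> (g \<cdot> f)"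
    and le_refl: "f \<in> hom C X Y \<Longrightarrow> f \<preceq> f"
    and le_trans:
      "f \<in> hom C X Y \<Longrightarrow> g \<in> hom C X Y \<Longrightarrow> h \<in> hom C X Y \<Longrightarrow> f \<preceq> g \<Longrightarrow> g \<preceq> h \<Longrightarrow> f \<preceq> h"
    and le_antisym:
      "f \<in> hom C X Y \<Longrightarrow> g \<in> hom C X Y \<Longrightarrow> f \<preceq> g \<Longrightarrow> g \<preceq> f \<Longrightarrow> f = g"
    and comp_mono:
      "f \<in> hom C X Y \<Longrightarrow> f' \<in> hom C X Y \<Longrightarrow> g \<in> hom C Y Z \<Longrightarrow> g' \<in> hom C Y Z \<Longrightarrow>
        f \<preceq> f' \<Longrightarrow> g \<preceq> g' \<Longrightarrow> g \<cdot> f \<preceq> g' \<cdot> f'"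

record ('o, 'm, 'p, 'n) pfunctor =
  fobj :: "'o \<Rightarrow> 'p"
  farr :: "'m \<Rightarrow> 'n"

locale pos_functor =
  fixes C :: "('o, 'm) pcat" and D :: "('p, 'n) pcat" and F :: "('o, 'm, 'p, 'n) pfunctor"
  assumes fobj_Obj: "X \<in> Obj C \<Longrightarrow> fobj F X \<in> Obj D"
    and farr_hom: "f \<in> hom C X Y \<Longrightarrow> farr F f \<in> hom D (fobj F X) (fobj F Y)"
    and farr_ident: "X \<in> Obj C \<Longrightarrow> farr F (Ident C X) = Ident D (fobj F X)"
    and farr_comp:
      "f \<in> hom C X Y \<Longrightarrow> g \<in> hom C Y Z \<Longrightarrow> farr F (g \<cdot>\<^bsub>C\<^esub> f) = farr F g \<cdot>\<^bsub>D\<^esub> farr F f"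
    and farr_mono:
      "f \<in> hom C X Y \<Longrightarrow> g \<in> hom C X Y \<Longrightarrow> f \<preceq>\<^bsub>C\<^esub> g \<Longrightarrow> farr F f \<preceq>\<^bsub>D\<^esub> farr F g"

definition id_functor :: "('o, 'm, 'o, 'm) pfunctor" where
  "id_functor = \<lparr>fobj = \<lambda>X. X, farr = \<lambda>f. f\<rparr>"

definition comp_functor ::
    "('p, 'n, 'q, 'k) pfunctor \<Rightarrow> ('o, 'm, 'p, 'n) pfunctor \<Rightarrow> ('o, 'm, 'q, 'k) pfunctor" where
  "comp_functor G F = \<lparr>fobj = \<lambda>X. fobj G (fobj F X), farr = \<lambda>f. farr G (farr F f)\<rparr>"

definition iso_in :: "('o, 'm) pcat \<Rightarrow> 'm \<Rightarrow> bool" where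
  "iso_in C f \<longleftrightarrow> f \<in> Arr C \<and>
    (\<exists>g \<in> hom C (Cod C f) (Dom C f).
      g \<cdot>\<^bsub>C\<^esub> f = Ident C (Dom C f) \<and> f \<cdot>\<^bsub>C\<^esub> g = Ident C (Cod C f))"

definition nat_isomorphic ::
    "('o, 'm) pcat \<Rightarrow> ('p, 'n) pcat \<Rightarrow> ('o, 'm, 'p, 'n) pfunctor \<Rightarrow> ('o, 'm, 'p, 'n) pfunctor \<Rightarrow> bool"
where
  "nat_isomorphic C D F G \<longleftrightarrow> (\<exists>\<tau>.
    (\<forall>X \<in> Obj C. \<tau> X \<in> hom D (fobj F X) (fobj G X) \<and> iso_in D (\<tau> X)) \<and>
    (\<forall>X \<in> Obj C. \<forall>Y \<in> Obj C. \<forall>f \<in> hom C X Y.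
      \<tau> Y \<cdot>\<^bsub>D\<^esub> farr F f = farr G f \<cdot>\<^bsub>D\<^esub> \<tau> X))"

definition equivalence_functor ::
    "('o, 'm) pcat \<Rightarrow> ('p, 'n) pcat \<Rightarrow> ('o, 'm, 'p, 'n) pfunctor \<Rightarrow> bool" where
  "equivalence_functor C D F \<longleftrightarrow> pos_functor C D F \<and>
    (\<exists>G. pos_functor D C G \<and>
      nat_isomorphic C C (comp_functor G F) id_functor \<and>
      nat_isomorphic D D (comp_functor F G) id_functor)"


section \<open>Finite weighted limits\<close>

text \<open>A weight \<open>J \<rightarrow> Pos\<close>: the poset \<open>(wset W j, wle W j)\<close> for each object \<open>j\<close>, and the monotone
  map \<open>wmap W a\<close> for each arrow \<open>a\<close>. A finite weight has an indexing category with finitely many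
  objects and arrows and takes finite posets as values. Every finite weight is isomorphic to one
  whose objects, arrows and elements are natural numbers, which is why the type \<^typ>\<open>nat\<close>
  is used throughout.\<close>

record weight =
  wset :: "nat \<Rightarrow> nat set"
  wle :: "nat \<Rightarrow> nat \<Rightarrow> nat \<Rightarrow> bool"
  wmap :: "nat \<Rightarrow> nat \<Rightarrow> nat"

locale finite_weight = pos_category J
  for J :: "(nat, nat) pcat" and W :: weight +
  assumes finite_Obj: "finite (Obj J)"
    and finite_Arr: "finite (Arr J)"
    and finite_wset: "j \<in> Obj J \<Longrightarrow> finite (wset W j)"
    and wle_refl: "j \<in> Obj J \<Longrightarrow> w \<in> wset W j \<Longrightarrow> wle W j w w"
    and wle_trans: "j \<in> Obj J \<Longrightarrow> w \<in> wset W j \<Longrightarrow> w' \<in> wset W j \<Longrightarrow> w'' \<in> wset W j \<Longrightarrow>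
      wle W j w w' \<Longrightarrow> wle W j w' w'' \<Longrightarrow> wle W j w w''"
    and wle_antisym: "j \<in> Obj J \<Longrightarrow> w \<in> wset W j \<Longrightarrow> w' \<in> wset W j \<Longrightarrow>
      wle W j w w' \<Longrightarrow> wle W j w' w \<Longrightarrow> w = w'"
    and wmap_wset: "a \<in> hom J j k \<Longrightarrow> w \<in> wset W j \<Longrightarrow> wmap W a w \<in> wset W k"
    and wmap_mono: "a \<in> hom J j k \<Longrightarrow> w \<in> wset W j \<Longrightarrow> w' \<in> wset W j \<Longrightarrow>
      wle W j w w' \<Longrightarrow> wle W k (wmap W a w) (wmap W a w')"
    and wmap_ident: "j \<in> Obj J \<Longrightarrow> w \<in> wset W j \<Longrightarrow> wmap W (Ident J j) w = w"
    and wmap_comp: "a \<in> hom J i j \<Longrightarrow> b \<in> hom J j k \<Longrightarrow> w \<in> wset W i \<Longrightarrow>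
      wmap W (b \<cdot>\<^bsub>J\<^esub> a) w = wmap W b (wmap W a w)"
    and wmap_le: "a \<in> hom J j k \<Longrightarrow> b \<in> hom J j k \<Longrightarrow> a \<preceq>\<^bsub>J\<^esub> b \<Longrightarrow> w \<in> wset W j \<Longrightarrow>
      wle W k (wmap W a w) (wmap W b w)"

text \<open>The elements \<open>\<mu>\<close> of \<open>[J, Pos](W, C(Z, D-))\<close>.\<close>

definition weighted_cone ::
    "('o, 'm) pcat \<Rightarrow> (nat, nat) pcat \<Rightarrow> weight \<Rightarrow> (nat, nat, 'o, 'm) pfunctor \<Rightarrow>
      'o \<Rightarrow> (nat \<Rightarrow> nat \<Rightarrow> 'm) \<Rightarrow> bool" where
  "weighted_cone C J W D Z \<mu> \<longleftrightarrow> Z \<in> Obj C \<and>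
    (\<forall>j \<in> Obj J. \<forall>w \<in> wset W j. \<mu> j w \<in> hom C Z (fobj D j)) \<and>
    (\<forall>j \<in> Obj J. \<forall>w \<in> wset W j. \<forall>w' \<in> wset W j. wle W j w w' \<longrightarrow> \<mu> j w \<preceq>\<^bsub>C\<^esub> \<mu> j w') \<and>
    (\<forall>j \<in> Obj J. \<forall>k \<in> Obj J. \<forall>a \<in> hom J j k. \<forall>w \<in> wset W j.
      \<mu> k (wmap W a w) = farr D a \<cdot>\<^bsub>C\<^esub> \<mu> j w)"

text \<open>\<open>C(Z, L) \<rightarrow> [J, Pos](W, C(Z, D-))\<close> is an isomorphism of posets for every \<open>Z\<close>.\<close>

definition weighted_limit ::
    "('o, 'm) pcat \<Rightarrow> (nat, nat) pcat \<Rightarrow> weight \<Rightarrow> (nat, nat, 'o, 'm) pfunctor \<Rightarrow>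
      'o \<Rightarrow> (nat \<Rightarrow> nat \<Rightarrow> 'm) \<Rightarrow> bool" where
  "weighted_limit C J W D L \<pi> \<longleftrightarrow> weighted_cone C J W D L \<pi> \<and>
    (\<forall>Z \<mu>. weighted_cone C J W D Z \<mu> \<longrightarrow>
      (\<exists>!u. u \<in> hom C Z L \<and> (\<forall>j \<in> Obj J. \<forall>w \<in> wset W j. \<pi> j w \<cdot>\<^bsub>C\<^esub> u = \<mu> j w))) \<and>
    (\<forall>Z \<in> Obj C. \<forall>u \<in> hom C Z L. \<forall>v \<in> hom C Z L.
      (\<forall>j \<in> Obj J. \<forall>w \<in> wset W j. \<pi> j w \<cdot>\<^bsub>C\<^esub> u \<preceq>\<^bsub>C\<^esub> \<pi> j w \<cdot>\<^bsub>C\<^esub> v) \<longrightarrow> u \<preceq>\<^bsub>C\<^esub> v)"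

definition has_finite_limits :: "('o, 'm) pcat \<Rightarrow> bool" where
  "has_finite_limits C \<longleftrightarrow>
    (\<forall>J W D. finite_weight J W \<and> pos_functor J C D \<longrightarrow> (\<exists>L \<pi>. weighted_limit C J W D L \<pi>))"

definition preserves_finite_limits ::
    "('o, 'm) pcat \<Rightarrow> ('p, 'n) pcat \<Rightarrow> ('o, 'm, 'p, 'n) pfunctor \<Rightarrow> bool" where
  "preserves_finite_limits C C' F \<longleftrightarrow>
    (\<forall>J W D L \<pi>. finite_weight J W \<and> pos_functor J C D \<and> weighted_limit C J W D L \<pi> \<longrightarrow>
      weighted_limit C' J W (comp_functor F D) (fobj F L) (\<lambda>j w. farr F (\<pi> j w)))"


section \<open>Regular categories\<close>

definition ff_morphism :: "('o, 'm) pcat \<Rightarrow> 'm \<Rightarrow> bool" where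
  "ff_morphism C m \<longleftrightarrow> m \<in> Arr C \<and>
    (\<forall>Z \<in> Obj C. \<forall>f \<in> hom C Z (Dom C m). \<forall>g \<in> hom C Z (Dom C m).
      m \<cdot>\<^bsub>C\<^esub> f \<preceq>\<^bsub>C\<^esub> m \<cdot>\<^bsub>C\<^esub> g \<longrightarrow> f \<preceq>\<^bsub>C\<^esub> g)"

text \<open>The comparison map from \<open>C(B, X)\<close> to the pullback of \<open>C(A, X)\<close> and \<open>C(B, Y)\<close> over
  \<open>C(A, Y)\<close> is a bijection that reflects the (componentwise) order.\<close>

definition so_morphism :: "('o, 'm) pcat \<Rightarrow> 'm \<Rightarrow> bool" where
  "so_morphism C e \<longleftrightarrow> e \<in> Arr C \<and>
    (\<forall>m. ff_morphism C m \<longrightarrow>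
      (\<forall>u \<in> hom C (Dom C e) (Dom C m). \<forall>v \<in> hom C (Cod C e) (Cod C m).
        m \<cdot>\<^bsub>C\<^esub> u = v \<cdot>\<^bsub>C\<^esub> e \<longrightarrow>
        (\<exists>!d. d \<in> hom C (Cod C e) (Dom C m) \<and> d \<cdot>\<^bsub>C\<^esub> e = u \<and> m \<cdot>\<^bsub>C\<^esub> d = v)) \<and>
      (\<forall>d \<in> hom C (Cod C e) (Dom C m). \<forall>d' \<in> hom C (Cod C e) (Dom C m).
        d \<cdot>\<^bsub>C\<^esub> e \<preceq>\<^bsub>C\<^esub> d' \<cdot>\<^bsub>C\<^esub> e \<and> m \<cdot>\<^bsub>C\<^esub> d \<preceq>\<^bsub>C\<^esub> m \<cdot>\<^bsub>C\<^esub> d' \<longrightarrow> d \<preceq>\<^bsub>C\<^esub> d'))"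

definition coinserter :: "('o, 'm) pcat \<Rightarrow> 'm \<Rightarrow> 'm \<Rightarrow> 'm \<Rightarrow> bool" where
  "coinserter C f0 f1 e \<longleftrightarrow> f0 \<in> Arr C \<and> f1 \<in> hom C (Dom C f0) (Cod C f0) \<and>
    e \<in> Arr C \<and> Dom C e = Cod C f0 \<and>
    e \<cdot>\<^bsub>C\<^esub> f0 \<preceq>\<^bsub>C\<^esub> e \<cdot>\<^bsub>C\<^esub> f1 \<and>
    (\<forall>Z \<in> Obj C. \<forall>g \<in> hom C (Dom C e) Z. g \<cdot>\<^bsub>C\<^esub> f0 \<preceq>\<^bsub>C\<^esub> g \<cdot>\<^bsub>C\<^esub> f1 \<longrightarrow>
      (\<exists>u \<in> hom C (Cod C e) Z. g = u \<cdot>\<^bsub>C\<^esub> e)) \<and>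
    (\<forall>Z \<in> Obj C. \<forall>u \<in> hom C (Cod C e) Z. \<forall>v \<in> hom C (Cod C e) Z.
      u \<cdot>\<^bsub>C\<^esub> e \<preceq>\<^bsub>C\<^esub> v \<cdot>\<^bsub>C\<^esub> e \<longrightarrow> u \<preceq>\<^bsub>C\<^esub> v)"

definition effective_epi :: "('o, 'm) pcat \<Rightarrow> 'm \<Rightarrow> bool" where
  "effective_epi C e \<longleftrightarrow> (\<exists>f0 f1. coinserter C f0 f1 e)"

definition jointly_order_mono :: "('o, 'm) pcat \<Rightarrow> 'm \<Rightarrow> 'm \<Rightarrow> bool" where
  "jointly_order_mono C p0 p1 \<longleftrightarrow> p0 \<in> Arr C \<and> p1 \<in> Arr C \<and> Dom C p0 = Dom C p1 \<and>
    (\<forall>Z \<in> Obj C. \<forall>u \<in> hom C Z (Dom C p0). \<forall>v \<in> hom C Z (Dom C p0).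
      p0 \<cdot>\<^bsub>C\<^esub> u \<preceq>\<^bsub>C\<^esub> p0 \<cdot>\<^bsub>C\<^esub> v \<and> p1 \<cdot>\<^bsub>C\<^esub> u \<preceq>\<^bsub>C\<^esub> p1 \<cdot>\<^bsub>C\<^esub> v \<longrightarrow> u \<preceq>\<^bsub>C\<^esub> v)"

definition is_product :: "('o, 'm) pcat \<Rightarrow> 'o \<Rightarrow> 'o \<Rightarrow> 'm \<Rightarrow> 'm \<Rightarrow> bool" where
  "is_product C X Y p0 p1 \<longleftrightarrow> jointly_order_mono C p0 p1 \<and> Cod C p0 = X \<and> Cod C p1 = Y \<and>
    (\<forall>Z \<in> Obj C. \<forall>x \<in> hom C Z X. \<forall>y \<in> hom C Z Y.
      \<exists>u \<in> hom C Z (Dom C p0). p0 \<cdot>\<^bsub>C\<^esub> u = x \<and> p1 \<cdot>\<^bsub>C\<^esub> u = y)"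

definition is_pullback :: "('o, 'm) pcat \<Rightarrow> 'm \<Rightarrow> 'm \<Rightarrow> 'm \<Rightarrow> 'm \<Rightarrow> bool" where
  "is_pullback C f g p0 p1 \<longleftrightarrow> f \<in> Arr C \<and> g \<in> Arr C \<and> Cod C f = Cod C g \<and>
    jointly_order_mono C p0 p1 \<and> Cod C p0 = Dom C f \<and> Cod C p1 = Dom C g \<and>
    f \<cdot>\<^bsub>C\<^esub> p0 = g \<cdot>\<^bsub>C\<^esub> p1 \<and>
    (\<forall>Z \<in> Obj C. \<forall>x \<in> hom C Z (Dom C f). \<forall>y \<in> hom C Z (Dom C g).
      f \<cdot>\<^bsub>C\<^esub> x = g \<cdot>\<^bsub>C\<^esub> y \<longrightarrow>
      (\<exists>u \<in> hom C Z (Dom C p0). p0 \<cdot>\<^bsub>C\<^esub> u = x \<and> p1 \<cdot>\<^bsub>C\<^esub> u = y))"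

definition is_comma :: "('o, 'm) pcat \<Rightarrow> 'm \<Rightarrow> 'm \<Rightarrow> 'm \<Rightarrow> 'm \<Rightarrow> bool" where
  "is_comma C f g c0 c1 \<longleftrightarrow> f \<in> Arr C \<and> g \<in> Arr C \<and> Cod C f = Cod C g \<and>
    jointly_order_mono C c0 c1 \<and> Cod C c0 = Dom C f \<and> Cod C c1 = Dom C g \<and>
    f \<cdot>\<^bsub>C\<^esub> c0 \<preceq>\<^bsub>C\<^esub> g \<cdot>\<^bsub>C\<^esub> c1 \<and>
    (\<forall>Z \<in> Obj C. \<forall>x \<in> hom C Z (Dom C f). \<forall>y \<in> hom C Z (Dom C g).
      f \<cdot>\<^bsub>C\<^esub> x \<preceq>\<^bsub>C\<^esub> g \<cdot>\<^bsub>C\<^esub> y \<longrightarrow>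
      (\<exists>u \<in> hom C Z (Dom C c0). c0 \<cdot>\<^bsub>C\<^esub> u = x \<and> c1 \<cdot>\<^bsub>C\<^esub> u = y))"

locale regular_category = pos_category C
  for C :: "('o, 'm) pcat" +
  assumes finite_limits: "has_finite_limits C"
    and factorization: "f \<in> Arr C \<Longrightarrow>
      \<exists>e m. so_morphism C e \<and> ff_morphism C m \<and> Cod C e = Dom C m \<and> f = m \<cdot>\<^bsub>C\<^esub> e"
    and so_stable: "is_pullback C f e p0 p1 \<Longrightarrow> so_morphism C e \<Longrightarrow> so_morphism C p0"

definition regular_functor ::
    "('o, 'm) pcat \<Rightarrow> ('p, 'n) pcat \<Rightarrow> ('o, 'm, 'p, 'n) pfunctor \<Rightarrow> bool" where
  "regular_functor C D F \<longleftrightarrow> pos_functor C D F \<and> preserves_finite_limits C D F \<and>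
    (\<forall>e. so_morphism C e \<longrightarrow> so_morphism D (farr F e))"

definition order_faithful ::
    "('o, 'm) pcat \<Rightarrow> ('p, 'n) pcat \<Rightarrow> ('o, 'm, 'p, 'n) pfunctor \<Rightarrow> bool" where
  "order_faithful C D F \<longleftrightarrow>
    (\<forall>X \<in> Obj C. \<forall>Y \<in> Obj C. \<forall>f \<in> hom C X Y. \<forall>g \<in> hom C X Y.
      farr F f \<preceq>\<^bsub>D\<^esub> farr F g \<longrightarrow> f \<preceq>\<^bsub>C\<^esub> g)"

definition full ::
    "('o, 'm) pcat \<Rightarrow> ('p, 'n) pcat \<Rightarrow> ('o, 'm, 'p, 'n) pfunctor \<Rightarrow> bool" where
  "full C D F \<longleftrightarrow>
    (\<forall>X \<in> Obj C. \<forall>Y \<in> Obj C. \<forall>h \<in> hom D (fobj F X) (fobj F Y). \<exists>f \<in> hom C X Y. farr F f = h)"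

definition fully_order_faithful ::
    "('o, 'm) pcat \<Rightarrow> ('p, 'n) pcat \<Rightarrow> ('o, 'm, 'p, 'n) pfunctor \<Rightarrow> bool" where
  "fully_order_faithful C D F \<longleftrightarrow> full C D F \<and> order_faithful C D F"

definition covering ::
    "('o, 'm) pcat \<Rightarrow> ('p, 'n) pcat \<Rightarrow> ('o, 'm, 'p, 'n) pfunctor \<Rightarrow> bool" where
  "covering C D F \<longleftrightarrow>
    (\<forall>Y \<in> Obj D. \<exists>X \<in> Obj C. \<exists>e \<in> hom D (fobj F X) Y. effective_epi D e)"


section \<open>Relations\<close>

text \<open>A choice of binary products; it is only meaningful in a category that has them.\<close>

definition product_cone :: "('o, 'm) pcat \<Rightarrow> 'o \<Rightarrow> 'o \<Rightarrow> 'm \<times> 'm" where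
  "product_cone C X Y = (SOME p. is_product C X Y (fst p) (snd p))"

definition prj0 :: "('o, 'm) pcat \<Rightarrow> 'o \<Rightarrow> 'o \<Rightarrow> 'm" where
  "prj0 C X Y = fst (product_cone C X Y)"

definition prj1 :: "('o, 'm) pcat \<Rightarrow> 'o \<Rightarrow> 'o \<Rightarrow> 'm" where
  "prj1 C X Y = snd (product_cone C X Y)"

definition prod_obj :: "('o, 'm) pcat \<Rightarrow> 'o \<Rightarrow> 'o \<Rightarrow> 'o" where
  "prod_obj C X Y = Dom C (prj0 C X Y)"

definition pairing :: "('o, 'm) pcat \<Rightarrow> 'm \<Rightarrow> 'm \<Rightarrow> 'm" where
  "pairing C x y = (THE u. u \<in> hom C (Dom C x) (prod_obj C (Cod C x) (Cod C y)) \<and>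
    prj0 C (Cod C x) (Cod C y) \<cdot>\<^bsub>C\<^esub> u = x \<and> prj1 C (Cod C x) (Cod C y) \<cdot>\<^bsub>C\<^esub> u = y)"

definition factors_through :: "('o, 'm) pcat \<Rightarrow> 'm \<Rightarrow> 'm \<Rightarrow> bool" where
  "factors_through C f m \<longleftrightarrow> (\<exists>h \<in> hom C (Dom C f) (Dom C m). f = m \<cdot>\<^bsub>C\<^esub> h)"

text \<open>Subobjects are equivalence classes of \<open>ff\<close>-morphisms; this is the class of \<open>m\<close>.\<close>

definition subobject :: "('o, 'm) pcat \<Rightarrow> 'm \<Rightarrow> 'm set" where
  "subobject C m = {n. ff_morphism C n \<and> factors_through C n m \<and> factors_through C m n}"

definition relations :: "('o, 'm) pcat \<Rightarrow> 'o \<Rightarrow> 'o \<Rightarrow> 'm set set" where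
  "relations C X Y = {subobject C m | m. ff_morphism C m \<and> Cod C m = prod_obj C X Y}"

definition rel_le :: "('o, 'm) pcat \<Rightarrow> 'm set \<Rightarrow> 'm set \<Rightarrow> bool" where
  "rel_le C R S \<longleftrightarrow> (\<exists>r \<in> R. \<exists>s \<in> S. factors_through C r s)"

text \<open>\<open>(x, y) \<in>\<^sub>A R\<close>, for \<open>x\<close> and \<open>y\<close> with common domain \<open>A\<close>.\<close>

definition rel_mem :: "('o, 'm) pcat \<Rightarrow> 'm \<Rightarrow> 'm \<Rightarrow> 'm set \<Rightarrow> bool" where
  "rel_mem C x y R \<longleftrightarrow> (\<exists>r \<in> R. factors_through C (pairing C x y) r)"

text \<open>The composite of \<open>R\<close> from \<open>X\<close> to \<open>Y\<close> and \<open>S\<close> from \<open>Y\<close> to \<open>Z\<close>. The \<open>ff\<close>-parts \<open>m\<close> of all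
  \<open>(so, ff)\<close>-factorizations, for all representatives and pullbacks, form a single subobject.\<close>

definition rel_comp ::
    "('o, 'm) pcat \<Rightarrow> 'o \<Rightarrow> 'o \<Rightarrow> 'o \<Rightarrow> 'm set \<Rightarrow> 'm set \<Rightarrow> 'm set" where
  "rel_comp C X Y Z S R = {m. ff_morphism C m \<and>
    (\<exists>r \<in> R. \<exists>s \<in> S. \<exists>t0 t1 e.
      is_pullback C (prj1 C X Y \<cdot>\<^bsub>C\<^esub> r) (prj0 C Y Z \<cdot>\<^bsub>C\<^esub> s) t0 t1 \<and>
      so_morphism C e \<and> Cod C e = Dom C m \<and>
      pairing C ((prj0 C X Y \<cdot>\<^bsub>C\<^esub> r) \<cdot>\<^bsub>C\<^esub> t0) ((prj1 C Y Z \<cdot>\<^bsub>C\<^esub> s) \<cdot>\<^bsub>C\<^esub> t1) = m \<cdot>\<^bsub>C\<^esub> e)}"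

text \<open>The comma object \<open>f/g\<close> as a relation; again these representatives form one subobject.\<close>

definition comma_rel :: "('o, 'm) pcat \<Rightarrow> 'm \<Rightarrow> 'm \<Rightarrow> 'm set" where
  "comma_rel C f g = {pairing C c0 c1 | c0 c1. is_comma C f g c0 c1}"

definition hom_rel :: "('o, 'm) pcat \<Rightarrow> 'o \<Rightarrow> 'm set" where
  "hom_rel C X = comma_rel C (Ident C X) (Ident C X)"

definition lower_star :: "('o, 'm) pcat \<Rightarrow> 'm \<Rightarrow> 'm set" where
  "lower_star C f = comma_rel C f (Ident C (Cod C f))"

definition weakening_closed :: "('o, 'm) pcat \<Rightarrow> 'o \<Rightarrow> 'o \<Rightarrow> 'm set \<Rightarrow> bool" where
  "weakening_closed C X Y R \<longleftrightarrow>
    (\<forall>A \<in> Obj C. \<forall>x \<in> hom C A X. \<forall>x' \<in> hom C A X. \<forall>y \<in> hom C A Y. \<forall>y' \<in> hom C A Y.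
      x' \<preceq>\<^bsub>C\<^esub> x \<and> rel_mem C x y R \<and> y \<preceq>\<^bsub>C\<^esub> y' \<longrightarrow> rel_mem C x' y' R)"

definition reflexive_rel :: "('o, 'm) pcat \<Rightarrow> 'o \<Rightarrow> 'm set \<Rightarrow> bool" where
  "reflexive_rel C X R \<longleftrightarrow> (\<forall>A \<in> Obj C. \<forall>x \<in> hom C A X. rel_mem C x x R)"

definition transitive_rel :: "('o, 'm) pcat \<Rightarrow> 'o \<Rightarrow> 'm set \<Rightarrow> bool" where
  "transitive_rel C X R \<longleftrightarrow>
    (\<forall>A \<in> Obj C. \<forall>x \<in> hom C A X. \<forall>y \<in> hom C A X. \<forall>z \<in> hom C A X.
      rel_mem C x y R \<and> rel_mem C y z R \<longrightarrow> rel_mem C x z R)"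

definition congruence :: "('o, 'm) pcat \<Rightarrow> 'o \<Rightarrow> 'm set \<Rightarrow> bool" where
  "congruence C X E \<longleftrightarrow> E \<in> relations C X X \<and> weakening_closed C X X E \<and>
    reflexive_rel C X E \<and> transitive_rel C X E"

definition effective_congruence :: "('o, 'm) pcat \<Rightarrow> 'o \<Rightarrow> 'm set \<Rightarrow> bool" where
  "effective_congruence C X E \<longleftrightarrow> (\<exists>Y \<in> Obj C. \<exists>f \<in> hom C X Y. E = comma_rel C f f)"

locale exact_category = regular_category C
  for C :: "('o, 'm) pcat" +
  assumes effective: "X \<in> Obj C \<Longrightarrow> congruence C X E \<Longrightarrow> effective_congruence C X E"


section \<open>The exact completion of a regular category\<close>

text \<open>An arrow of \<open>Qw C\<close> is a relation together with its domain and codomain.\<close>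

type_synonym ('o, 'm) qobj = "'o \<times> 'm set"
type_synonym ('o, 'm) qarr = "('o, 'm) qobj \<times> ('o, 'm) qobj \<times> 'm set"

definition Qw :: "('o, 'm) pcat \<Rightarrow> (('o, 'm) qobj, ('o, 'm) qarr) pcat" where
  "Qw C = \<lparr>
    Obj = {(X, E). X \<in> Obj C \<and> congruence C X E},
    Arr = {((X, E), (Y, F), \<Phi>) | X E Y F \<Phi>.
      X \<in> Obj C \<and> congruence C X E \<and> Y \<in> Obj C \<and> congruence C Y F \<and>
      \<Phi> \<in> relations C X Y \<and> rel_comp C X Y Y F (rel_comp C X X Y \<Phi> E) = \<Phi>},
    Dom = (\<lambda>(A, B, \<Phi>). A),
    Cod = (\<lambda>(A, B, \<Phi>). B),
    Ident = (\<lambda>A. (A, A, snd A)),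
    Comp = (\<lambda>(B', Z, \<Psi>) (A, B, \<Phi>). (A, Z, rel_comp C (fst A) (fst B) (fst Z) \<Psi> \<Phi>)),
    Le = (\<lambda>(A, B, \<Phi>) (A', B', \<Phi>'). rel_le C \<Phi> \<Phi>')\<rparr>"

definition has_right_adjoint :: "('o, 'm) pcat \<Rightarrow> 'm \<Rightarrow> bool" where
  "has_right_adjoint Q f \<longleftrightarrow>
    (\<exists>g \<in> hom Q (Cod Q f) (Dom Q f).
      Ident Q (Dom Q f) \<preceq>\<^bsub>Q\<^esub> g \<cdot>\<^bsub>Q\<^esub> f \<and> f \<cdot>\<^bsub>Q\<^esub> g \<preceq>\<^bsub>Q\<^esub> Ident Q (Cod Q f))"

definition ex_reg :: "('o, 'm) pcat \<Rightarrow> (('o, 'm) qobj, ('o, 'm) qarr) pcat" where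
  "ex_reg C = (Qw C)\<lparr>
    Arr := {f \<in> Arr (Qw C). has_right_adjoint (Qw C) f},
    Le := (\<lambda>f g. g \<preceq>\<^bsub>Qw C\<^esub> f)\<rparr>"

definition Gamma :: "('o, 'm) pcat \<Rightarrow> ('o, 'm, ('o, 'm) qobj, ('o, 'm) qarr) pfunctor" where
  "Gamma C = \<lparr>
    fobj = \<lambda>X. (X, hom_rel C X),
    farr = \<lambda>f. ((Dom C f, hom_rel C (Dom C f)), (Cod C f, hom_rel C (Cod C f)), lower_star C f)\<rparr>"

end

theory Submission
  imports Defs
begin

text \<open>An object \<open>(X, A)\<close> of \<open>ex_reg E\<close> is a quotient of \<open>\<Gamma> X\<close>: the quotient map is the coinserter of
  \<open>\<Gamma> e0\<close> and \<open>\<Gamma> e1\<close> and has them as its kernel (the comma object with itself), where \<open>e0, e1\<close>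
  tabulate \<open>A\<close>. A map from \<open>(X, A)\<close> to \<open>(Y, B)\<close> is given by a span consisting of an \<open>so\<close>-morphism
  \<open>p\<close> into \<open>X\<close> and a morphism \<open>y\<close> into \<open>Y\<close>. Hence \<open>\<Gamma>\<close> is fully order-faithful and covering, and so is
  \<open>F\<close> if \<open>Fbar\<close> is an equivalence.

  Conversely, \<open>Fbar\<close> preserves the quotient maps and their kernels, so that \<open>Fbar (X, A)\<close> is covered by
  \<open>F X\<close> with kernel \<open>A\<close>. If \<open>F\<close> is fully order-faithful and covering, then the maps between such
  objects come from spans \<open>F p, F y\<close> and are compared on the covers. The kernel of a cover
  \<open>F X \<rightarrow> Y\<close> is itself covered by some \<open>F Z\<close>, and the image of the resulting \<open>Z \<rightarrow> X \<times> X\<close> is a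
  congruence \<open>A\<close> with that kernel, so that \<open>Y\<close> is isomorphic to \<open>Fbar (X, A)\<close>.\<close>

section \<open>Limits from finite weights\<close>

text \<open>Relations are sets of representatives and their composites involve an image
  factorization, so every statement about them is turned into one about generalized elements
  (\<open>rel_mem\<close>). A composite then reads as an existential statement that holds after
  passing to an \<open>so\<close>-cover of the stage, and membership descends along such covers.
  This is why a presentation of a map of \<open>ex_reg\<close> needs a cover \<open>p\<close>: the
  generic element of \<open>X\<close> has a value only locally.

  Kernels are comma objects, not kernel pairs, because the inequality \<open>e s \<le> e t\<close>
  rather than the equation has to be tabulated. An \<open>so\<close>-morphism is determined by this
  kernel (\<open>so_factor\<close>).

  \<open>Fbar\<close> is controlled only through the finite limits and \<open>so\<close>-morphisms
  that it preserves, and \<open>Fbar (Gamma X)\<close> is merely isomorphic to \<open>F X\<close>.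
  So the quotient map of \<open>ex_reg\<close> is shown to be a coinserter and to have the right
  comma object, both facts are carried over by \<open>Fbar\<close>, and the result is precomposed
  with \<open>\<sigma>\<close>. Fullness of \<open>F\<close> lifts arrows between images of
  \<open>F\<close> only; any other object of the target is first covered by such an image.\<close>

lemma hom_dom_cod: "f \<in> hom C X Y \<Longrightarrow> f \<in> Arr C \<and> Dom C f = X \<and> Cod C f = Y"
  by (simp add: hom_def)

context pos_category
begin

lemma arr_hom: "f \<in> Arr C \<Longrightarrow> f \<in> hom C (Dom C f) (Cod C f)"
  by (simp add: hom_def)

lemma dom_Obj [simp]: "f \<in> Arr C \<Longrightarrow> Dom C f \<in> Obj C"
  and cod_Obj [simp]: "f \<in> Arr C \<Longrightarrow> Cod C f \<in> Obj C"
  using dom_cod by auto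

lemma comp_arr [simp]: "\<lbrakk>f \<in> Arr C; g \<in> Arr C; Dom C g = Cod C f\<rbrakk> \<Longrightarrow> g \<cdot> f \<in> Arr C"
  and dom_comp [simp]: "\<lbrakk>f \<in> Arr C; g \<in> Arr C; Dom C g = Cod C f\<rbrakk> \<Longrightarrow> Dom C (g \<cdot> f) = Dom C f"
  and cod_comp [simp]: "\<lbrakk>f \<in> Arr C; g \<in> Arr C; Dom C g = Cod C f\<rbrakk> \<Longrightarrow> Cod C (g \<cdot> f) = Cod C g"
  using comp_hom[of f "Dom C f" "Cod C f" g "Cod C g"] by (auto simp: hom_def)

lemma comp_assoc_arr [simp]:
  "\<lbrakk>f \<in> Arr C; g \<in> Arr C; h \<in> Arr C; Dom C g = Cod C f; Dom C h = Cod C g\<rbrakk> \<Longrightarrow>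
    (h \<cdot> g) \<cdot> f = h \<cdot> (g \<cdot> f)"
  using comp_assoc[of f "Dom C f" "Cod C f" g "Cod C g" h "Cod C h"] by (simp add: hom_def)

lemma ident_arr [simp]: "X \<in> Obj C \<Longrightarrow> Ident C X \<in> Arr C"
  and dom_ident [simp]: "X \<in> Obj C \<Longrightarrow> Dom C (Ident C X) = X"
  and cod_ident [simp]: "X \<in> Obj C \<Longrightarrow> Cod C (Ident C X) = X"
  using ident_hom by (auto simp: hom_def)

lemma ident_comp [simp]: "\<lbrakk>f \<in> Arr C; Cod C f = Y\<rbrakk> \<Longrightarrow> Ident C Y \<cdot> f = f"
  and comp_ident [simp]: "\<lbrakk>f \<in> Arr C; Dom C f = X\<rbrakk> \<Longrightarrow> f \<cdot> Ident C X = f"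
  using ident_left ident_right by (auto simp: hom_def)

lemma le_refl_arr [simp]: "f \<in> Arr C \<Longrightarrow> f \<preceq> f"
  using le_refl arr_hom by blast

lemma hom_Obj: "f \<in> hom C X Y \<Longrightarrow> X \<in> Obj C" "f \<in> hom C X Y \<Longrightarrow> Y \<in> Obj C"
  using dom_cod by (auto simp: hom_def)

lemma comp_le:
  "\<lbrakk>f \<preceq> g; f \<in> hom C X Y; g \<in> hom C X Y; h \<in> hom C Y Z\<rbrakk> \<Longrightarrow> h \<cdot> f \<preceq> h \<cdot> g"
  "\<lbrakk>f \<preceq> g; f \<in> hom C X Y; g \<in> hom C X Y; k \<in> hom C W X\<rbrakk> \<Longrightarrow> f \<cdot> k \<preceq> g \<cdot> k"
  using comp_mono[of f X Y g h Z h] comp_mono[of k W X k f Y g] le_refl by blast+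

lemma jointly_order_monoD:
  "\<lbrakk>jointly_order_mono C p0 p1; u \<in> hom C Z (Dom C p0); v \<in> hom C Z (Dom C p0);
    p0 \<cdot> u \<preceq> p0 \<cdot> v; p1 \<cdot> u \<preceq> p1 \<cdot> v\<rbrakk> \<Longrightarrow> u \<preceq> v"
  unfolding jointly_order_mono_def by (metis (mono_tags, lifting) dom_Obj hom_def mem_Collect_eq)

lemma jointly_order_monoI:
  assumes "p0 \<in> hom C T X" "p1 \<in> hom C T Y"
    and "\<And>Z u v. \<lbrakk>u \<in> hom C Z T; v \<in> hom C Z T; p0 \<cdot> u \<preceq> p0 \<cdot> v; p1 \<cdot> u \<preceq> p1 \<cdot> v\<rbrakk> \<Longrightarrow> u \<preceq> v"
  shows "jointly_order_mono C p0 p1"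
proof -
  have p: "p0 \<in> Arr C" "p1 \<in> Arr C" "Dom C p0 = T" "Dom C p1 = T"
    using assms(1,2) by (auto simp: hom_def)
  show ?thesis
    unfolding jointly_order_mono_def p(3,4) by (intro conjI p refl ballI impI) (elim conjE, rule assms(3))
qed

lemma jointly_order_mono_eq:
  assumes "jointly_order_mono C p0 p1" "u \<in> hom C Z (Dom C p0)" "v \<in> hom C Z (Dom C p0)"
    and "p0 \<cdot> u = p0 \<cdot> v" "p1 \<cdot> u = p1 \<cdot> v"
  shows "u = v"
proof -
  have "p0 \<in> Arr C" "p1 \<in> Arr C" "Dom C p1 = Dom C p0"
    using assms(1) by (auto simp: jointly_order_mono_def)
  then have "p0 \<cdot> u \<in> Arr C" "p1 \<cdot> u \<in> Arr C"
    using assms(2) by (auto simp: hom_def)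
  then show ?thesis
    using assms jointly_order_monoD le_antisym le_refl_arr by metis
qed

end

section \<open>Binary products, pullbacks and comma objects as weighted limits\<close>

definition discrete_J :: "(nat, nat) pcat" where
  "discrete_J = \<lparr>Obj = {2, 3}, Arr = {2, 3}, Dom = (\<lambda>a. a), Cod = (\<lambda>a. a), Ident = (\<lambda>j. j),
    Comp = (\<lambda>g f. f), Le = (=)\<rparr>"

text \<open>The constant one-point weight: its weighted limits are ordinary conical ones, here
  binary products. The objects 2 and 3 of the shape double as their identities, and as these are the
  only arrows, composable arrows are equal.\<close>

definition discrete_W :: weight where
  "discrete_W = \<lparr>wset = (\<lambda>j. {2}), wle = (\<lambda>j. (=)), wmap = (\<lambda>a w. w)\<rparr>"

definition discrete_D :: "('o, 'm) pcat \<Rightarrow> 'o \<Rightarrow> 'o \<Rightarrow> (nat, nat, 'o, 'm) pfunctor" where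
  "discrete_D C X Y = \<lparr>fobj = (\<lambda>j. if j = 2 then X else Y),
    farr = (\<lambda>a. Ident C (if a = 2 then X else Y))\<rparr>"

text \<open>The objects 2, 3, 4 are their own identities; 5 and 6 are the arrows from 2 and 3 to 4.\<close>

definition cospan_J :: "(nat, nat) pcat" where
  "cospan_J = \<lparr>Obj = {2, 3, 4}, Arr = {2, 3, 4, 5, 6},
    Dom = (\<lambda>a. if a = 5 then 2 else if a = 6 then 3 else a),
    Cod = (\<lambda>a. if a = 5 \<or> a = 6 then 4 else a), Ident = (\<lambda>j. j),
    Comp = (\<lambda>g f. if g = 5 \<or> g = 6 then g else f), Le = (=)\<rparr>"

text \<open>The value at the vertex 4 is the chain \<open>2 \<le> b\<close>: the limits weighted by \<open>cospan_W 2\<close> are the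
  pullbacks, those weighted by \<open>cospan_W 3\<close> the comma objects.\<close>

definition cospan_W :: "nat \<Rightarrow> weight" where
  "cospan_W b = \<lparr>wset = (\<lambda>j. if j = 4 then {2, b} else {2}), wle = (\<lambda>j. (\<le>)),
    wmap = (\<lambda>a w. if a = 5 then 2 else if a = 6 then b else w)\<rparr>"

definition cospan_D :: "('o, 'm) pcat \<Rightarrow> 'm \<Rightarrow> 'm \<Rightarrow> (nat, nat, 'o, 'm) pfunctor" where
  "cospan_D C f g = (let ob = (\<lambda>j. if j = 2 then Dom C f else if j = 3 then Dom C g else Cod C f) in
    \<lparr>fobj = ob, farr = (\<lambda>a. if a = 5 then f else if a = 6 then g else Ident C (ob a))\<rparr>)"

lemma finite_weight_discrete: "finite_weight discrete_J discrete_W"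
  by unfold_locales (auto simp: discrete_J_def discrete_W_def hom_def)

lemma finite_weight_cospan: "finite_weight cospan_J (cospan_W b)"
  by unfold_locales (auto simp: cospan_J_def cospan_W_def hom_def split: if_splits)

text \<open>Quantifying over the finite set \<open>Arr J\<close> instead of over all typed triples
  \<open>j\<close>, \<open>k\<close>, \<open>a\<close> lets the naturality of a cone over a concrete
  shape be checked arrow by arrow.\<close>

lemma ball_hom_iff:
  assumes "\<forall>a \<in> Arr J. Dom J a \<in> Obj J \<and> Cod J a \<in> Obj J"
  shows "(\<forall>j \<in> Obj J. \<forall>k \<in> Obj J. \<forall>a \<in> hom J j k. Q j k a) \<longleftrightarrow>
    (\<forall>a \<in> Arr J. Q (Dom J a) (Cod J a) a)"
  using assms by (auto simp: hom_def)

context pos_category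
begin

lemma pos_functor_discrete: "\<lbrakk>X \<in> Obj C; Y \<in> Obj C\<rbrakk> \<Longrightarrow> pos_functor discrete_J C (discrete_D C X Y)"
  by unfold_locales (auto simp: discrete_J_def discrete_D_def hom_def split: if_splits)

lemma pos_functor_cospan:
  "\<lbrakk>f \<in> Arr C; g \<in> Arr C; Cod C f = Cod C g\<rbrakk> \<Longrightarrow> pos_functor cospan_J C (cospan_D C f g)"
  by unfold_locales (auto simp: cospan_J_def cospan_D_def hom_def Let_def split: if_splits)

lemma weighted_cone_discrete:
  assumes "X \<in> Obj C" "Y \<in> Obj C"
  shows "weighted_cone C discrete_J discrete_W (discrete_D C X Y) Z \<mu> \<longleftrightarrow>
    \<mu> 2 2 \<in> hom C Z X \<and> \<mu> 3 2 \<in> hom C Z Y" (is "?L \<longleftrightarrow> ?R")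
proof
  assume ?L
  then have "\<mu> j w \<in> hom C Z (fobj (discrete_D C X Y) j)"
    if "j \<in> Obj discrete_J" "w \<in> wset discrete_W j" for j w
    using that by (simp add: weighted_cone_def)
  from this[of 2 2] this[of 3 2] show ?R
    by (simp add: discrete_J_def discrete_W_def discrete_D_def)
next
  assume R: ?R
  have "\<forall>a \<in> Arr discrete_J. Dom discrete_J a \<in> Obj discrete_J \<and> Cod discrete_J a \<in> Obj discrete_J"
    by (auto simp: discrete_J_def)
  note b = ball_hom_iff[OF this]
  from R show ?L
    unfolding weighted_cone_def b
    by (auto simp: discrete_J_def discrete_W_def discrete_D_def hom_def)
qed

text \<open>The components at the vertex 4 are forced by naturality along the arrows 5 and 6, and
  the chain \<open>2 \<le> b\<close> adds their comparison. For \<open>b = 2\<close> both components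
  are the same \<open>\<mu> 4 2\<close>, so the cone is a commuting square; for \<open>b = 3\<close>
  it is a square with an inequality.\<close>

lemma weighted_cone_cospan:
  assumes "f \<in> Arr C" "g \<in> Arr C" "Cod C f = Cod C g" "b = 2 \<or> b = 3"
  shows "weighted_cone C cospan_J (cospan_W b) (cospan_D C f g) Z \<mu> \<longleftrightarrow>
    \<mu> 2 2 \<in> hom C Z (Dom C f) \<and> \<mu> 3 2 \<in> hom C Z (Dom C g) \<and>
    \<mu> 4 2 = f \<cdot> \<mu> 2 2 \<and> \<mu> 4 b = g \<cdot> \<mu> 3 2 \<and> \<mu> 4 2 \<preceq> \<mu> 4 b"
proof -
  have "\<forall>a \<in> Arr cospan_J. Dom cospan_J a \<in> Obj cospan_J \<and> Cod cospan_J a \<in> Obj cospan_J"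
    by (auto simp: cospan_J_def)
  note b = ball_hom_iff[OF this]
  have eqs: "Obj cospan_J = {2, 3, 4}" "Arr cospan_J = {2, 3, 4, 5, 6}"
    "wset (cospan_W b) 2 = {2}" "wset (cospan_W b) 3 = {2}" "wset (cospan_W b) 4 = {2, b}"
    "wle (cospan_W b) j w w' \<longleftrightarrow> w \<le> w'" for j w w'
    by (auto simp: cospan_J_def cospan_W_def)
  let ?D = "cospan_D C f g"
  have D: "fobj ?D 2 = Dom C f" "fobj ?D 3 = Dom C g" "fobj ?D 4 = Cod C f"
    "farr ?D 2 = Ident C (Dom C f)" "farr ?D 3 = Ident C (Dom C g)" "farr ?D 4 = Ident C (Cod C f)"
    "farr ?D 5 = f" "farr ?D 6 = g"
    by (auto simp: cospan_D_def Let_def)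
  have m: "Dom cospan_J 2 = 2" "Dom cospan_J 3 = 3" "Dom cospan_J 4 = 4"
    "Dom cospan_J 5 = 2" "Dom cospan_J 6 = 3"
    "Cod cospan_J 2 = 2" "Cod cospan_J 3 = 3" "Cod cospan_J 4 = 4"
    "Cod cospan_J 5 = 4" "Cod cospan_J 6 = 4"
    "wmap (cospan_W b) 2 w = w" "wmap (cospan_W b) 3 w = w" "wmap (cospan_W b) 4 w = w"
    "wmap (cospan_W b) 5 w = 2" "wmap (cospan_W b) 6 w = b" for w
    by (auto simp: cospan_J_def cospan_W_def)
  have i: "\<mu> j w \<in> hom C Z X \<Longrightarrow> Ident C X \<cdot> \<mu> j w = \<mu> j w" for j w X
    by (simp add: ident_left)
  have h: "\<mu> 2 2 \<in> hom C Z (Dom C f) \<Longrightarrow> f \<cdot> \<mu> 2 2 \<in> hom C Z (Cod C f)"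
    "\<mu> 3 2 \<in> hom C Z (Dom C g) \<Longrightarrow> g \<cdot> \<mu> 3 2 \<in> hom C Z (Cod C f)"
    using assms by (auto simp: hom_def)
  have o: "\<mu> 2 2 \<in> hom C Z (Dom C f) \<Longrightarrow> Z \<in> Obj C"
    by (auto simp: hom_def)
  have r: "\<mu> j w \<in> hom C Z X \<Longrightarrow> \<mu> j w \<preceq> \<mu> j w" for j w X
    by (rule le_refl)
  show ?thesis (is "?L \<longleftrightarrow> ?R")
  proof
    assume L: ?L
    then have n: "\<mu> (Cod cospan_J a) (wmap (cospan_W b) a w) = farr ?D a \<cdot> \<mu> (Dom cospan_J a) w"
      if "a \<in> Arr cospan_J" "w \<in> wset (cospan_W b) (Dom cospan_J a)" for a w
      using that unfolding weighted_cone_def b by blast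
    have "\<mu> j w \<in> hom C Z (fobj ?D j)" if "j \<in> Obj cospan_J" "w \<in> wset (cospan_W b) j" for j w
      using L that by (simp add: weighted_cone_def)
    from this[of 2 2] this[of 3 2] have "\<mu> 2 2 \<in> hom C Z (Dom C f)" "\<mu> 3 2 \<in> hom C Z (Dom C g)"
      by (simp_all add: eqs D)
    moreover have "\<mu> j w \<preceq> \<mu> j w'" if "j \<in> Obj cospan_J" "w \<in> wset (cospan_W b) j"
        "w' \<in> wset (cospan_W b) j" "wle (cospan_W b) j w w'" for j w w'
      using L that by (simp add: weighted_cone_def)
    from this[of 4 2 b] have "\<mu> 4 2 \<preceq> \<mu> 4 b"
      using assms(4) by (auto simp: eqs)
    moreover have "\<mu> 4 2 = f \<cdot> \<mu> 2 2" "\<mu> 4 b = g \<cdot> \<mu> 3 2"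
      using n[of 5 2] n[of 6 2] by (simp_all add: eqs m D)
    ultimately show ?R by simp
  next
    assume R: ?R
    then have h': "\<mu> 4 2 \<in> hom C Z (Cod C f)" "\<mu> 4 b \<in> hom C Z (Cod C f)"
      using h by auto
    have n: "\<forall>a\<in>{2, 3, 4, 5, 6}. \<forall>w\<in>wset (cospan_W b) (Dom cospan_J a).
      \<mu> (Cod cospan_J a) (wmap (cospan_W b) a w) = farr ?D a \<cdot> \<mu> (Dom cospan_J a) w"
      using R h' i ident_left[OF h(1)] ident_left[OF h(2)] by (simp add: m D eqs)
    have t: "\<forall>j\<in>{2, 3, 4}. \<forall>w\<in>wset (cospan_W b) j. \<mu> j w \<in> hom C Z (fobj ?D j)"
      using R h' by (simp add: eqs D)
    have l: "\<forall>j\<in>{2, 3, 4}. \<forall>w\<in>wset (cospan_W b) j. \<forall>w'\<in>wset (cospan_W b) j.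
        w \<le> w' \<longrightarrow> \<mu> j w \<preceq> \<mu> j w'"
      using R h' r le_refl[OF h(1)] le_refl[OF h(2)] assms(4) by (auto simp: eqs)
    have "Z \<in> Obj C" using R o by blast
    from this t l n show ?L
      unfolding weighted_cone_def b unfolding eqs(1,2,6) by (intro conjI)
  qed
qed

lemma weighted_limit_ex:
  "\<lbrakk>weighted_limit C J W D L \<pi>; weighted_cone C J W D Z \<mu>\<rbrakk> \<Longrightarrow>
    \<exists>u \<in> hom C Z L. \<forall>j \<in> Obj J. \<forall>w \<in> wset W j. \<pi> j w \<cdot> u = \<mu> j w"
  unfolding weighted_limit_def by blast

lemma weighted_limit_le:
  "\<lbrakk>weighted_limit C J W D L \<pi>; u \<in> hom C Z L; v \<in> hom C Z L;
    \<forall>j \<in> Obj J. \<forall>w \<in> wset W j. \<pi> j w \<cdot> u \<preceq> \<pi> j w \<cdot> v\<rbrakk> \<Longrightarrow> u \<preceq> v"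
  unfolding weighted_limit_def using dom_cod[of u] by (metis (mono_tags, lifting) hom_def mem_Collect_eq)

lemma weighted_limit_discrete:
  assumes "X \<in> Obj C" "Y \<in> Obj C"
    and lim: "weighted_limit C discrete_J discrete_W (discrete_D C X Y) L \<pi>"
  shows "is_product C X Y (\<pi> 2 2) (\<pi> 3 2)"
proof -
  have J: "Obj discrete_J = {2, 3}" "wset discrete_W j = {2}" for j
    by (auto simp: discrete_J_def discrete_W_def)
  note cone = weighted_cone_discrete[OF assms(1,2)]
  have p: "\<pi> 2 2 \<in> hom C L X" "\<pi> 3 2 \<in> hom C L Y"
    using lim by (auto simp: weighted_limit_def cone)
  have "\<exists>u\<in>hom C Z L. \<pi> 2 2 \<cdot> u = x \<and> \<pi> 3 2 \<cdot> u = y"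
    if "x \<in> hom C Z X" "y \<in> hom C Z Y" for Z x y
  proof -
    have "weighted_cone C discrete_J discrete_W (discrete_D C X Y) Z (\<lambda>j w. if j = 2 then x else y)"
      using that by (simp add: cone)
    from weighted_limit_ex[OF lim this] obtain u where "u \<in> hom C Z L"
      and u: "\<forall>j\<in>Obj discrete_J. \<forall>w\<in>wset discrete_W j. \<pi> j w \<cdot> u = (if j = 2 then x else y)"
      by blast
    moreover from u have "\<pi> 2 2 \<cdot> u = x" "\<pi> 3 2 \<cdot> u = y"
      by (auto simp: J)
    ultimately show ?thesis by blast
  qed
  moreover have "jointly_order_mono C (\<pi> 2 2) (\<pi> 3 2)"
    by (rule jointly_order_monoI[OF p]) (rule weighted_limit_le[OF lim], auto simp: J)
  ultimately show ?thesis
    using p by (auto simp: is_product_def hom_def)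
qed

lemma weighted_limit_cospan:
  assumes fg: "f \<in> Arr C" "g \<in> Arr C" "Cod C f = Cod C g" and b: "b = 2 \<or> b = 3"
    and lim: "weighted_limit C cospan_J (cospan_W b) (cospan_D C f g) L \<pi>"
  shows "\<pi> 2 2 \<in> hom C L (Dom C f)" "\<pi> 3 2 \<in> hom C L (Dom C g)"
    "f \<cdot> \<pi> 2 2 \<preceq> g \<cdot> \<pi> 3 2" "b = 2 \<Longrightarrow> f \<cdot> \<pi> 2 2 = g \<cdot> \<pi> 3 2"
    "jointly_order_mono C (\<pi> 2 2) (\<pi> 3 2)"
    "\<lbrakk>x \<in> hom C Z (Dom C f); y \<in> hom C Z (Dom C g); f \<cdot> x \<preceq> g \<cdot> y;
      b = 2 \<Longrightarrow> f \<cdot> x = g \<cdot> y\<rbrakk> \<Longrightarrow> \<exists>u\<in>hom C Z L. \<pi> 2 2 \<cdot> u = x \<and> \<pi> 3 2 \<cdot> u = y"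
proof -
  have J: "Obj cospan_J = {2, 3, 4}" "wset (cospan_W b) j = (if j = 4 then {2, b} else {2})" for j
    by (auto simp: cospan_J_def cospan_W_def)
  note cone = weighted_cone_cospan[OF fg b]
  have "weighted_cone C cospan_J (cospan_W b) (cospan_D C f g) L \<pi>"
    using lim by (simp add: weighted_limit_def)
  then have p4: "\<pi> 2 2 \<in> hom C L (Dom C f)" "\<pi> 3 2 \<in> hom C L (Dom C g)"
    "\<pi> 4 2 \<preceq> \<pi> 4 b" and c4: "\<pi> 4 2 = f \<cdot> \<pi> 2 2" "\<pi> 4 b = g \<cdot> \<pi> 3 2"
    unfolding cone by blast+
  show p: "\<pi> 2 2 \<in> hom C L (Dom C f)" "\<pi> 3 2 \<in> hom C L (Dom C g)"
    "f \<cdot> \<pi> 2 2 \<preceq> g \<cdot> \<pi> 3 2"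
    using p4 unfolding c4 by blast+
  show "b = 2 \<Longrightarrow> f \<cdot> \<pi> 2 2 = g \<cdot> \<pi> 3 2"
    using c4 by metis
  show "jointly_order_mono C (\<pi> 2 2) (\<pi> 3 2)"
  proof -
    have "u \<preceq> v" if uv: "u \<in> hom C Z L" "v \<in> hom C Z L"
      and le: "\<pi> 2 2 \<cdot> u \<preceq> \<pi> 2 2 \<cdot> v" "\<pi> 3 2 \<cdot> u \<preceq> \<pi> 3 2 \<cdot> v" for Z u v
    proof -
      have t: "\<pi> 2 2 \<cdot> w \<in> hom C Z (Dom C f)" "\<pi> 3 2 \<cdot> w \<in> hom C Z (Dom C g)"
        "(f \<cdot> \<pi> 2 2) \<cdot> w = f \<cdot> (\<pi> 2 2 \<cdot> w)" "(g \<cdot> \<pi> 3 2) \<cdot> w = g \<cdot> (\<pi> 3 2 \<cdot> w)"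
        if "w \<in> hom C Z L" for w
        using p(1,2) fg that by (auto simp: hom_def)
      \<comment> \<open>The components at 4 are composites of those at 2 and 3, so a comparison
        along the two projections extends to all legs of the weighted limit.\<close>
      have "f \<cdot> (\<pi> 2 2 \<cdot> u) \<preceq> f \<cdot> (\<pi> 2 2 \<cdot> v)" "g \<cdot> (\<pi> 3 2 \<cdot> u) \<preceq> g \<cdot> (\<pi> 3 2 \<cdot> v)"
        using comp_mono[OF t(1)[OF uv(1)] t(1)[OF uv(2)] arr_hom arr_hom le(1)]
          comp_mono[OF t(2)[OF uv(1)] t(2)[OF uv(2)] arr_hom arr_hom le(2)] fg(1,2) by simp_all
      then have "\<pi> 4 2 \<cdot> u \<preceq> \<pi> 4 2 \<cdot> v" "\<pi> 4 b \<cdot> u \<preceq> \<pi> 4 b \<cdot> v"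
        unfolding c4 t(3)[OF uv(1)] t(3)[OF uv(2)] t(4)[OF uv(1)] t(4)[OF uv(2)] by simp_all
      then have "\<forall>j\<in>Obj cospan_J. \<forall>w\<in>wset (cospan_W b) j. \<pi> j w \<cdot> u \<preceq> \<pi> j w \<cdot> v"
        using le by (simp add: J)
      then show ?thesis
        by (rule weighted_limit_le[OF lim uv])
    qed
    then show ?thesis
      by (rule jointly_order_monoI[OF p(1,2)])
  qed
  show "\<exists>u\<in>hom C Z L. \<pi> 2 2 \<cdot> u = x \<and> \<pi> 3 2 \<cdot> u = y"
    if xy: "x \<in> hom C Z (Dom C f)" "y \<in> hom C Z (Dom C g)" "f \<cdot> x \<preceq> g \<cdot> y"
      "b = 2 \<Longrightarrow> f \<cdot> x = g \<cdot> y"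
  proof -
    \<comment> \<open>At 4 the element 2 carries \<open>f \<cdot> x\<close> and the element
      \<open>b\<close> carries \<open>g \<cdot> y\<close>; when \<open>b = 2\<close> the two must
      agree, which is the extra equation assumed in that case.\<close>
    let ?\<mu> = "\<lambda>j w. if j = 2 then x else if j = 3 then y else if w = 2 then f \<cdot> x else g \<cdot> y"
    have "weighted_cone C cospan_J (cospan_W b) (cospan_D C f g) Z ?\<mu>"
      using xy b unfolding cone by auto
    from weighted_limit_ex[OF lim this] obtain u where "u \<in> hom C Z L"
      and u: "\<forall>j\<in>Obj cospan_J. \<forall>w\<in>wset (cospan_W b) j. \<pi> j w \<cdot> u = ?\<mu> j w"
      by blast
    moreover from u have "\<pi> 2 2 \<cdot> u = x" "\<pi> 3 2 \<cdot> u = y"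
      by (auto simp: J)
    ultimately show ?thesis by blast
  qed
qed

lemma weighted_limit_pullback:
  assumes "f \<in> Arr C" "g \<in> Arr C" "Cod C f = Cod C g"
    and "weighted_limit C cospan_J (cospan_W 2) (cospan_D C f g) L \<pi>"
  shows "is_pullback C f g (\<pi> 2 2) (\<pi> 3 2)"
proof -
  note w = weighted_limit_cospan[OF assms(1-3) disjI1[OF refl] assms(4)]
  have "f \<cdot> x \<preceq> g \<cdot> y" if "x \<in> hom C Z (Dom C f)" "f \<cdot> x = g \<cdot> y" for x y Z
  proof -
    have "f \<cdot> x \<in> Arr C"
      using that(1) assms(1) by (simp add: hom_def)
    then show ?thesis
      using le_refl_arr that(2) by fastforce
  qed
  then have "\<exists>u\<in>hom C Z L. \<pi> 2 2 \<cdot> u = x \<and> \<pi> 3 2 \<cdot> u = y"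
    if "x \<in> hom C Z (Dom C f)" "y \<in> hom C Z (Dom C g)" "f \<cdot> x = g \<cdot> y" for x y Z
    using that w(6) by blast
  then show ?thesis
    using w(1,2,4,5) assms(1-3) unfolding is_pullback_def by (auto simp: hom_def)
qed

lemma weighted_limit_comma:
  assumes "f \<in> Arr C" "g \<in> Arr C" "Cod C f = Cod C g"
    and "weighted_limit C cospan_J (cospan_W 3) (cospan_D C f g) L \<pi>"
  shows "is_comma C f g (\<pi> 2 2) (\<pi> 3 2)"
proof -
  note w = weighted_limit_cospan[OF assms(1-3) disjI2[OF refl] assms(4)]
  have "\<exists>u\<in>hom C Z L. \<pi> 2 2 \<cdot> u = x \<and> \<pi> 3 2 \<cdot> u = y"
    if "x \<in> hom C Z (Dom C f)" "y \<in> hom C Z (Dom C g)" "f \<cdot> x \<preceq> g \<cdot> y" for x y Z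
    using that w(6) by simp
  then show ?thesis
    using w(1,2,3,5) assms(1-3) unfolding is_comma_def by (auto simp: hom_def)
qed

text \<open>Preservation is defined for weighted limits, so a comma object given by its universal
  property has to be recognized as one before a functor can be applied to it.\<close>

lemma comma_weighted_limit:
  assumes com: "is_comma C f g c0 c1"
  shows "weighted_limit C cospan_J (cospan_W 3) (cospan_D C f g) (Dom C c0)
    (\<lambda>j w. if j = 2 then c0 else if j = 3 then c1 else if w = 2 then f \<cdot> c0 else g \<cdot> c1)"
    (is "weighted_limit C _ _ _ ?L ?\<pi>")
proof -
  have fg: "f \<in> Arr C" "g \<in> Arr C" "Cod C f = Cod C g" and j: "jointly_order_mono C c0 c1"
    and le: "f \<cdot> c0 \<preceq> g \<cdot> c1" and cod: "Cod C c0 = Dom C f" "Cod C c1 = Dom C g"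
    and ex: "\<And>Z x y. \<lbrakk>Z \<in> Obj C; x \<in> hom C Z (Dom C f); y \<in> hom C Z (Dom C g);
      f \<cdot> x \<preceq> g \<cdot> y\<rbrakk> \<Longrightarrow> \<exists>u\<in>hom C Z (Dom C c0). c0 \<cdot> u = x \<and> c1 \<cdot> u = y"
    using com by (auto simp: is_comma_def)
  have c: "c0 \<in> hom C ?L (Dom C f)" "c1 \<in> hom C ?L (Dom C g)"
    using j cod by (auto simp: jointly_order_mono_def hom_def)
  have J: "Obj cospan_J = {2, 3, 4}" "wset (cospan_W 3) j = (if j = 4 then {2, 3} else {2})" for j
    by (auto simp: cospan_J_def cospan_W_def)
  note cone = weighted_cone_cospan[OF fg disjI2[OF refl]]
  have "\<exists>!u. u \<in> hom C Z ?L \<and> (\<forall>j\<in>Obj cospan_J. \<forall>w\<in>wset (cospan_W 3) j. ?\<pi> j w \<cdot> u = \<mu> j w)"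
    if "weighted_cone C cospan_J (cospan_W 3) (cospan_D C f g) Z \<mu>" for Z \<mu>
  proof -
    have \<mu>: "\<mu> 2 2 \<in> hom C Z (Dom C f)" "\<mu> 3 2 \<in> hom C Z (Dom C g)"
      "\<mu> 4 2 = f \<cdot> \<mu> 2 2" "\<mu> 4 3 = g \<cdot> \<mu> 3 2" "\<mu> 4 2 \<preceq> \<mu> 4 3" and Z: "Z \<in> Obj C"
      using that by (auto simp: cone hom_def)
    then obtain u where u: "u \<in> hom C Z ?L" "c0 \<cdot> u = \<mu> 2 2" "c1 \<cdot> u = \<mu> 3 2"
      using ex by metis
    have "(f \<cdot> c0) \<cdot> u = f \<cdot> (c0 \<cdot> u)" "(g \<cdot> c1) \<cdot> u = g \<cdot> (c1 \<cdot> u)"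
      using c u fg by (auto simp: hom_def)
    then have "\<forall>j\<in>Obj cospan_J. \<forall>w\<in>wset (cospan_W 3) j. ?\<pi> j w \<cdot> u = \<mu> j w"
      using u(2,3) \<mu>(3,4) by (simp add: J)
    moreover have "v = u" if "v \<in> hom C Z ?L"
      "\<forall>j\<in>Obj cospan_J. \<forall>w\<in>wset (cospan_W 3) j. ?\<pi> j w \<cdot> v = \<mu> j w" for v
      using that u jointly_order_mono_eq[OF j, of v Z u] by (simp add: J)
    ultimately show ?thesis
      using u(1) by blast
  qed
  moreover have "weighted_cone C cospan_J (cospan_W 3) (cospan_D C f g) ?L ?\<pi>"
    using c le by (simp add: cone)
  moreover have "u \<preceq> v" if "u \<in> hom C Z ?L" "v \<in> hom C Z ?L"
    "\<forall>j\<in>Obj cospan_J. \<forall>w\<in>wset (cospan_W 3) j. ?\<pi> j w \<cdot> u \<preceq> ?\<pi> j w \<cdot> v" for Z u v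
    using jointly_order_monoD[OF j that(1,2)] that(3) by (simp add: J)
  ultimately show ?thesis
    unfolding weighted_limit_def by blast
qed

end

section \<open>Preservation of comma objects and of \<open>ff\<close>-morphisms\<close>

lemma preserves_comma:
  assumes "pos_category C" "pos_category D" "pos_functor C D F" "preserves_finite_limits C D F"
    and com: "is_comma C f g c0 c1"
  shows "is_comma D (farr F f) (farr F g) (farr F c0) (farr F c1)"
proof -
  interpret C: pos_category C by fact
  interpret D: pos_category D by fact
  interpret F: pos_functor C D F by fact
  have fg: "f \<in> Arr C" "g \<in> Arr C" "Cod C f = Cod C g"
    using com by (auto simp: is_comma_def)
  have F: "farr F h \<in> Arr D" "Dom D (farr F h) = fobj F (Dom C h)"
    "Cod D (farr F h) = fobj F (Cod C h)" if "h \<in> Arr C" for h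
    using F.farr_hom[OF C.arr_hom[OF that]] by (auto simp: hom_def)
  \<comment> \<open>The image of a cospan diagram is literally the cospan diagram of the images,
    since \<open>F\<close> preserves the identities at its three objects.\<close>
  have "comp_functor F (cospan_D C f g) = cospan_D D (farr F f) (farr F g)"
    using fg F.farr_ident by (auto simp: comp_functor_def cospan_D_def Let_def fun_eq_iff F)
  moreover have "weighted_limit D cospan_J (cospan_W 3) (comp_functor F (cospan_D C f g))
      (fobj F (Dom C c0)) (\<lambda>j w. farr F (if j = 2 then c0 else if j = 3 then c1
        else if w = 2 then f \<cdot>\<^bsub>C\<^esub> c0 else g \<cdot>\<^bsub>C\<^esub> c1))"
    using assms(4) finite_weight_cospan C.pos_functor_cospan[OF fg] C.comma_weighted_limit[OF com]
    unfolding preserves_finite_limits_def by blast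
  ultimately show ?thesis
    using D.weighted_limit_comma[of "farr F f" "farr F g"] fg F by fastforce
qed

text \<open>Being \<open>ff\<close> is a limit condition: \<open>m\<close> is \<open>ff\<close>
  exactly when the projections of the comma object \<open>m/m\<close> satisfy
  \<open>c0 \<preceq> c1\<close>, and both the comma object and this inequality are carried over by
  \<open>F\<close>.\<close>

lemma preserves_ff:
  assumes "pos_category C" "pos_category D" "pos_functor C D F" "preserves_finite_limits C D F"
    and lim: "has_finite_limits C" and m: "ff_morphism C m"
  shows "ff_morphism D (farr F m)"
proof -
  interpret C: pos_category C by fact
  interpret D: pos_category D by fact
  interpret F: pos_functor C D F by fact
  have m_arr: "m \<in> Arr C"
    using m by (simp add: ff_morphism_def)
  have "\<exists>L \<pi>. weighted_limit C cospan_J (cospan_W 3) (cospan_D C m m) L \<pi>"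
    using lim finite_weight_cospan C.pos_functor_cospan m_arr unfolding has_finite_limits_def
    by blast
  then obtain c0 c1 where com: "is_comma C m m c0 c1"
    using C.weighted_limit_comma m_arr by blast
  have c: "c0 \<in> hom C (Dom C c0) (Dom C m)" "c1 \<in> hom C (Dom C c0) (Dom C m)"
      "m \<cdot>\<^bsub>C\<^esub> c0 \<preceq>\<^bsub>C\<^esub> m \<cdot>\<^bsub>C\<^esub> c1"
    using com by (auto simp: is_comma_def jointly_order_mono_def hom_def)
  then have "c0 \<preceq>\<^bsub>C\<^esub> c1"
    using m unfolding ff_morphism_def by (metis C.dom_Obj com is_comma_def jointly_order_mono_def)
  then have le: "farr F c0 \<preceq>\<^bsub>D\<^esub> farr F c1"
    using F.farr_mono c by blast
  have Fc: "farr F c0 \<in> hom D (fobj F (Dom C c0)) (fobj F (Dom C m))"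
    "farr F c1 \<in> hom D (fobj F (Dom C c0)) (fobj F (Dom C m))"
    "farr F m \<in> hom D (fobj F (Dom C m)) (fobj F (Cod C m))"
    using F.farr_hom c C.arr_hom m_arr by auto
  note com' = preserves_comma[OF assms(1-4) com]
  show ?thesis
    unfolding ff_morphism_def
  proof (intro conjI ballI impI)
    show "farr F m \<in> Arr D"
      using Fc by (simp add: hom_def)
  next
    fix Z f g
    assume Z: "Z \<in> Obj D" and f: "f \<in> hom D Z (Dom D (farr F m))"
      and g: "g \<in> hom D Z (Dom D (farr F m))"
      and "farr F m \<cdot>\<^bsub>D\<^esub> f \<preceq>\<^bsub>D\<^esub> farr F m \<cdot>\<^bsub>D\<^esub> g"
    then obtain u where u: "u \<in> hom D Z (Dom D (farr F c0))"
        "farr F c0 \<cdot>\<^bsub>D\<^esub> u = f" "farr F c1 \<cdot>\<^bsub>D\<^esub> u = g"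
      using com' unfolding is_comma_def by blast
    then show "f \<preceq>\<^bsub>D\<^esub> g"
      using D.comp_le(2)[OF le Fc(1,2)] Fc(1) by (auto simp: hom_def)
  qed
qed

section \<open>\<open>so\<close>- and \<open>ff\<close>-morphisms\<close>

context pos_category
begin

lemma ffD:
  "\<lbrakk>ff_morphism C m; m \<in> hom C X Y; f \<in> hom C Z X; g \<in> hom C Z X; m \<cdot> f \<preceq> m \<cdot> g\<rbrakk> \<Longrightarrow> f \<preceq> g"
  unfolding ff_morphism_def using hom_Obj(1)[of f Z X] by (auto simp: hom_def)

lemma ff_mono:
  assumes "ff_morphism C m" "m \<in> hom C X Y" "f \<in> hom C Z X" "g \<in> hom C Z X" "m \<cdot> f = m \<cdot> g"
  shows "f = g"
proof -
  have "m \<cdot> f \<preceq> m \<cdot> f"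
    using assms by (intro le_refl_arr) (simp add: hom_def)
  then have "f \<preceq> g" "g \<preceq> f"
    using ffD[OF assms(1-4)] ffD[OF assms(1,2,4,3)] assms(5) by auto
  then show ?thesis
    using le_antisym assms by blast
qed

lemma ffI:
  assumes "m \<in> hom C X Y"
    and "\<And>Z f g. \<lbrakk>f \<in> hom C Z X; g \<in> hom C Z X; m \<cdot> f \<preceq> m \<cdot> g\<rbrakk> \<Longrightarrow> f \<preceq> g"
  shows "ff_morphism C m"
  using hom_dom_cod[OF assms(1)] unfolding ff_morphism_def
  by (intro conjI ballI impI) (simp, rule assms(2), auto)

lemma so_diagonal:
  assumes "so_morphism C e" "ff_morphism C m" "e \<in> hom C A B" "m \<in> hom C X Y"
    and "u \<in> hom C A X" "v \<in> hom C B Y" "m \<cdot> u = v \<cdot> e"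
  obtains d where "d \<in> hom C B X" "d \<cdot> e = u" "m \<cdot> d = v"
proof -
  have d: "A = Dom C e" "B = Cod C e" "X = Dom C m" "Y = Cod C m"
    using assms(3,4) by (auto simp: hom_def)
  have "\<exists>!d. d \<in> hom C B X \<and> d \<cdot> e = u \<and> m \<cdot> d = v"
    using assms(1,2,5-7) unfolding so_morphism_def d by blast
  then show ?thesis
    using that by blast
qed

lemma order_epi_eq:
  assumes epi: "\<And>Z u v. \<lbrakk>u \<in> hom C B Z; v \<in> hom C B Z; u \<cdot> e \<preceq> v \<cdot> e\<rbrakk> \<Longrightarrow> u \<preceq> v"
    and "e \<in> hom C A B" "u \<in> hom C B Z" "v \<in> hom C B Z" "u \<cdot> e = v \<cdot> e"
  shows "u = v"
proof -
  have "u \<cdot> e \<preceq> v \<cdot> e" "v \<cdot> e \<preceq> u \<cdot> e"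
    using assms(2-5) le_refl[OF comp_hom[OF assms(2,3)]] by auto
  then have "u \<preceq> v" "v \<preceq> u"
    using epi[OF assms(3,4)] epi[OF assms(4,3)] by auto
  then show ?thesis
    using le_antisym assms by blast
qed

text \<open>Since \<open>e\<close> can be cancelled on the right with respect to the order, it
  suffices to find a diagonal for the upper triangle: the lower triangle, uniqueness and the order
  clause of \<open>so_morphism\<close> follow by cancelling \<open>e\<close>.\<close>

lemma soI:
  assumes e: "e \<in> hom C A B"
    and epi: "\<And>Z u v. \<lbrakk>u \<in> hom C B Z; v \<in> hom C B Z; u \<cdot> e \<preceq> v \<cdot> e\<rbrakk> \<Longrightarrow> u \<preceq> v"
    and diag: "\<And>m X Y u v. \<lbrakk>ff_morphism C m; m \<in> hom C X Y; u \<in> hom C A X; v \<in> hom C B Y;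
      m \<cdot> u = v \<cdot> e\<rbrakk> \<Longrightarrow> \<exists>d \<in> hom C B X. d \<cdot> e = u"
  shows "so_morphism C e"
proof -
  have ed: "e \<in> Arr C" "Dom C e = A" "Cod C e = B"
    using e by (auto simp: hom_def)
  have eq: "u = v" if "u \<in> hom C B Z" "v \<in> hom C B Z" "u \<cdot> e = v \<cdot> e" for Z u v
    by (rule order_epi_eq[OF _ e that]) (rule epi)
  have "\<exists>!d. d \<in> hom C B (Dom C m) \<and> d \<cdot> e = u \<and> m \<cdot> d = v"
    if m: "ff_morphism C m" and u: "u \<in> hom C A (Dom C m)" and v: "v \<in> hom C B (Cod C m)"
      and sq: "m \<cdot> u = v \<cdot> e" for m u v
  proof -
    have mh: "m \<in> hom C (Dom C m) (Cod C m)"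
      using m by (auto simp: ff_morphism_def hom_def)
    obtain d where d: "d \<in> hom C B (Dom C m)" "d \<cdot> e = u"
      using diag[OF m mh u v sq] by blast
    have "(m \<cdot> d) \<cdot> e = v \<cdot> e"
      using comp_assoc[OF e d(1) mh] d(2) sq by simp
    then have "m \<cdot> d = v"
      using eq[OF comp_hom[OF d(1) mh] v] by blast
    moreover have "d' = d" if "d' \<in> hom C B (Dom C m)" "d' \<cdot> e = u" for d'
      using eq[OF that(1) d(1)] that(2) d(2) by simp
    ultimately show ?thesis
      using d by blast
  qed
  then show ?thesis
    unfolding so_morphism_def ed using ed(1) epi by (intro conjI ballI allI impI) blast+
qed

lemma coinserterI:
  assumes "f0 \<in> hom C T A" "f1 \<in> hom C T A" "e \<in> hom C A B" "e \<cdot> f0 \<preceq> e \<cdot> f1"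
    and ex: "\<And>Z g. \<lbrakk>g \<in> hom C A Z; g \<cdot> f0 \<preceq> g \<cdot> f1\<rbrakk> \<Longrightarrow> \<exists>u \<in> hom C B Z. g = u \<cdot> e"
    and epi: "\<And>Z u v. \<lbrakk>u \<in> hom C B Z; v \<in> hom C B Z; u \<cdot> e \<preceq> v \<cdot> e\<rbrakk> \<Longrightarrow> u \<preceq> v"
  shows "coinserter C f0 f1 e"
proof -
  have d: "f0 \<in> Arr C" "Dom C f0 = T" "Cod C f0 = A" "Dom C e = A" "Cod C e = B" "e \<in> Arr C"
    using assms(1-3) by (auto simp: hom_def)
  show ?thesis
    unfolding coinserter_def d
    by (intro conjI ballI impI d refl assms(2,4)) (rule ex epi; assumption)+
qed

text \<open>From \<open>m \<cdot> u = v \<cdot> e\<close> one gets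
  \<open>m u f0 \<preceq> m u f1\<close>; cancelling the \<open>ff\<close>-morphism \<open>m\<close>
  shows that \<open>u\<close> respects the pair, hence factors through the coinserter. It is stated
  for an arbitrary Pos-category so that it applies to \<open>ex_reg\<close>.\<close>

lemma effective_epi_so:
  assumes "effective_epi C e"
  shows "so_morphism C e"
proof -
  obtain f0 f1 where co: "coinserter C f0 f1 e"
    using assms by (auto simp: effective_epi_def)
  define A B T where "A = Dom C e" and "B = Cod C e" and "T = Dom C f0"
  have e: "e \<in> hom C A B" and f0: "f0 \<in> hom C T A" and f1: "f1 \<in> hom C T A"
    and le: "e \<cdot> f0 \<preceq> e \<cdot> f1"
    using co by (auto simp: coinserter_def A_def B_def T_def hom_def)
  have ex: "\<exists>u \<in> hom C B Z. g = u \<cdot> e" if "g \<in> hom C A Z" "g \<cdot> f0 \<preceq> g \<cdot> f1" for g Z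
    using co that hom_Obj[OF that(1)] unfolding coinserter_def A_def B_def by blast
  have epi: "u \<preceq> v" if "u \<in> hom C B Z" "v \<in> hom C B Z" "u \<cdot> e \<preceq> v \<cdot> e" for Z u v
    using co that hom_Obj[OF that(1)] unfolding coinserter_def A_def B_def by blast
  show ?thesis
  proof (rule soI[OF e])
    fix m X Y u v
    assume m: "ff_morphism C m" "m \<in> hom C X Y" and u: "u \<in> hom C A X" and v: "v \<in> hom C B Y"
      and sq: "m \<cdot> u = v \<cdot> e"
    have *: "m \<cdot> (u \<cdot> f) = v \<cdot> (e \<cdot> f)" if "f \<in> hom C T A" for f
      using comp_assoc[OF that u m(2)] comp_assoc[OF that e v] sq by simp
    have "m \<cdot> (u \<cdot> f0) \<preceq> m \<cdot> (u \<cdot> f1)"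
      unfolding *[OF f0] *[OF f1] using comp_le(1)[OF le] comp_hom e f0 f1 v by blast
    then have "u \<cdot> f0 \<preceq> u \<cdot> f1"
      using ffD[OF m] comp_hom u f0 f1 by blast
    then show "\<exists>d \<in> hom C B X. d \<cdot> e = u"
      using ex[OF u] by blast
  qed (rule epi)
qed

end

locale reg_cat = regular_category C for C :: "('o, 'm) pcat" (structure)
begin

section \<open>Limits, products and pairings in a regular category\<close>

lemma pullbackE:
  assumes "f \<in> hom C X Z" "g \<in> hom C Y Z"
  obtains P p0 p1 where "is_pullback C f g p0 p1" "p0 \<in> hom C P X" "p1 \<in> hom C P Y"
    "f \<cdot> p0 = g \<cdot> p1"
proof -
  have fg: "f \<in> Arr C" "g \<in> Arr C" "Cod C f = Cod C g"
    using assms by (auto simp: hom_def)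
  then obtain L \<pi> where "weighted_limit C cospan_J (cospan_W 2) (cospan_D C f g) L \<pi>"
    using finite_limits finite_weight_cospan pos_functor_cospan unfolding has_finite_limits_def by blast
  from weighted_limit_pullback[OF fg this] obtain p0 p1 where "is_pullback C f g p0 p1"
    by blast
  moreover from this have "p0 \<in> hom C (Dom C p0) X" "p1 \<in> hom C (Dom C p0) Y" "f \<cdot> p0 = g \<cdot> p1"
    using assms by (auto simp: is_pullback_def hom_def jointly_order_mono_def)
  ultimately show ?thesis
    using that by blast
qed

lemma pullback_lift:
  assumes "is_pullback C f g p0 p1" "p0 \<in> hom C P X" "p1 \<in> hom C P Y"
    and "x \<in> hom C A X" "y \<in> hom C A Y" "f \<cdot> x = g \<cdot> y"
  obtains u where "u \<in> hom C A P" "p0 \<cdot> u = x" "p1 \<cdot> u = y"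
proof -
  have d: "X = Dom C f" "Y = Dom C g" "P = Dom C p0"
    using assms(1-3) by (auto simp: is_pullback_def hom_def)
  have "\<exists>u\<in>hom C A P. p0 \<cdot> u = x \<and> p1 \<cdot> u = y"
    using assms(1,4-) hom_Obj(1)[OF assms(4)] unfolding is_pullback_def d by blast
  then show ?thesis
    using that by blast
qed

lemma comma_lift:
  assumes "is_comma C f g p0 p1" "p0 \<in> hom C P X" "p1 \<in> hom C P Y"
    and "x \<in> hom C A X" "y \<in> hom C A Y" "f \<cdot> x \<preceq> g \<cdot> y"
  obtains u where "u \<in> hom C A P" "p0 \<cdot> u = x" "p1 \<cdot> u = y"
proof -
  have d: "X = Dom C f" "Y = Dom C g" "P = Dom C p0"
    using assms(1-3) by (auto simp: is_comma_def hom_def)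
  have "\<exists>u\<in>hom C A P. p0 \<cdot> u = x \<and> p1 \<cdot> u = y"
    using assms(1,4-) hom_Obj(1)[OF assms(4)] unfolding is_comma_def d by blast
  then show ?thesis
    using that by blast
qed

lemma commaE:
  assumes "f \<in> hom C X Z" "g \<in> hom C Y Z"
  obtains P p0 p1 where "is_comma C f g p0 p1" "p0 \<in> hom C P X" "p1 \<in> hom C P Y"
    "f \<cdot> p0 \<preceq> g \<cdot> p1"
proof -
  have fg: "f \<in> Arr C" "g \<in> Arr C" "Cod C f = Cod C g"
    using assms by (auto simp: hom_def)
  then obtain L \<pi> where "weighted_limit C cospan_J (cospan_W 3) (cospan_D C f g) L \<pi>"
    using finite_limits finite_weight_cospan pos_functor_cospan unfolding has_finite_limits_def by blast
  from weighted_limit_comma[OF fg this] obtain p0 p1 where "is_comma C f g p0 p1"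
    by blast
  moreover from this have "p0 \<in> hom C (Dom C p0) X" "p1 \<in> hom C (Dom C p0) Y" "f \<cdot> p0 \<preceq> g \<cdot> p1"
    using assms by (auto simp: is_comma_def hom_def jointly_order_mono_def)
  ultimately show ?thesis
    using that by blast
qed

lemma product_prj:
  assumes "X \<in> Obj C" "Y \<in> Obj C"
  shows "is_product C X Y (prj0 C X Y) (prj1 C X Y)"
proof -
  obtain L \<pi> where "weighted_limit C discrete_J discrete_W (discrete_D C X Y) L \<pi>"
    using finite_limits finite_weight_discrete pos_functor_discrete[OF assms]
    unfolding has_finite_limits_def by blast
  from weighted_limit_discrete[OF assms this]
  have "\<exists>p. is_product C X Y (fst p) (snd p)"
    by (metis fst_conv snd_conv)
  then show ?thesis
    unfolding prj0_def prj1_def product_cone_def by (rule someI_ex)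
qed

lemma prj_hom:
  assumes "X \<in> Obj C" "Y \<in> Obj C"
  shows "prj0 C X Y \<in> hom C (prod_obj C X Y) X" "prj1 C X Y \<in> hom C (prod_obj C X Y) Y"
  using product_prj[OF assms]
  by (auto simp: is_product_def jointly_order_mono_def hom_def prod_obj_def)

lemma prod_le:
  assumes "X \<in> Obj C" "Y \<in> Obj C" "u \<in> hom C A (prod_obj C X Y)" "v \<in> hom C A (prod_obj C X Y)"
    and "prj0 C X Y \<cdot> u \<preceq> prj0 C X Y \<cdot> v" "prj1 C X Y \<cdot> u \<preceq> prj1 C X Y \<cdot> v"
  shows "u \<preceq> v"
proof -
  have "jointly_order_mono C (prj0 C X Y) (prj1 C X Y)"
    using product_prj[OF assms(1,2)] by (simp add: is_product_def)
  from jointly_order_monoD[OF this] show ?thesis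
    using assms(3-) by (simp add: prod_obj_def)
qed

lemma prod_eq:
  assumes "X \<in> Obj C" "Y \<in> Obj C" "u \<in> hom C A (prod_obj C X Y)" "v \<in> hom C A (prod_obj C X Y)"
    and "prj0 C X Y \<cdot> u = prj0 C X Y \<cdot> v" "prj1 C X Y \<cdot> u = prj1 C X Y \<cdot> v"
  shows "u = v"
proof -
  have "jointly_order_mono C (prj0 C X Y) (prj1 C X Y)"
    using product_prj[OF assms(1,2)] by (simp add: is_product_def)
  from jointly_order_mono_eq[OF this] show ?thesis
    using assms(3-) by (simp add: prod_obj_def)
qed

lemma pairing:
  assumes x: "x \<in> hom C A X" and y: "y \<in> hom C A Y"
  shows "pairing C x y \<in> hom C A (prod_obj C X Y)"
    "prj0 C X Y \<cdot> pairing C x y = x" "prj1 C X Y \<cdot> pairing C x y = y"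
proof -
  have X: "X \<in> Obj C" "Y \<in> Obj C" "A \<in> Obj C"
    using hom_Obj[OF x] hom_Obj[OF y] by auto
  have d: "Cod C x = X" "Cod C y = Y" "Dom C x = A"
    using x y by (auto simp: hom_def)
  let ?P = "\<lambda>u. u \<in> hom C A (prod_obj C X Y) \<and> prj0 C X Y \<cdot> u = x \<and> prj1 C X Y \<cdot> u = y"
  obtain u where "?P u"
    using product_prj[OF X(1,2)] X x y unfolding is_product_def prod_obj_def by blast
  moreover have "v = u" if "?P v" for v
    using that \<open>?P u\<close> prod_eq[OF X(1,2), of v A u] by simp
  ultimately have "?P (THE u. ?P u)"
    by (rule theI)
  then show "pairing C x y \<in> hom C A (prod_obj C X Y)"
    "prj0 C X Y \<cdot> pairing C x y = x" "prj1 C X Y \<cdot> pairing C x y = y"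
    unfolding pairing_def d by auto
qed

lemma pairing_prj:
  assumes X: "X \<in> Obj C" "Y \<in> Obj C" and u: "u \<in> hom C A (prod_obj C X Y)"
  shows "pairing C (prj0 C X Y \<cdot> u) (prj1 C X Y \<cdot> u) = u"
  using prod_eq[OF X _ u] pairing[OF comp_hom[OF u prj_hom(1)[OF X]] comp_hom[OF u prj_hom(2)[OF X]]]
  by blast

lemma pairing_comp:
  assumes x: "x \<in> hom C A X" and y: "y \<in> hom C A Y" and c: "c \<in> hom C B A"
  shows "pairing C (x \<cdot> c) (y \<cdot> c) = pairing C x y \<cdot> c"
proof -
  have X: "X \<in> Obj C" "Y \<in> Obj C"
    using hom_Obj[OF x] hom_Obj[OF y] by auto
  note p = pairing[OF x y]
  have "prj0 C X Y \<cdot> (pairing C x y \<cdot> c) = x \<cdot> c" "prj1 C X Y \<cdot> (pairing C x y \<cdot> c) = y \<cdot> c"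
    using comp_assoc[OF c p(1) prj_hom(1)[OF X]] comp_assoc[OF c p(1) prj_hom(2)[OF X]] p(2,3) by auto
  then show ?thesis
    using pairing_prj[OF X comp_hom[OF c p(1)]] by simp
qed

lemma ff_pairing:
  assumes x: "x \<in> hom C A X" and y: "y \<in> hom C A Y" and j: "jointly_order_mono C x y"
  shows "ff_morphism C (pairing C x y)"
proof (rule ffI[OF pairing(1)[OF x y]])
  fix Z f g
  assume f: "f \<in> hom C Z A" and g: "g \<in> hom C Z A"
    and le: "pairing C x y \<cdot> f \<preceq> pairing C x y \<cdot> g"
  have X: "X \<in> Obj C" "Y \<in> Obj C"
    using hom_Obj[OF x] hom_Obj[OF y] by auto
  note p = pairing[OF x y]
  have *: "prj0 C X Y \<cdot> (pairing C x y \<cdot> c) = x \<cdot> c" "prj1 C X Y \<cdot> (pairing C x y \<cdot> c) = y \<cdot> c"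
    if "c \<in> hom C Z A" for c
    using comp_assoc[OF that p(1) prj_hom(1)[OF X]] comp_assoc[OF that p(1) prj_hom(2)[OF X]] p(2,3)
    by auto
  have "x \<cdot> f \<preceq> x \<cdot> g" "y \<cdot> f \<preceq> y \<cdot> g"
    using comp_le(1)[OF le comp_hom[OF f p(1)] comp_hom[OF g p(1)] prj_hom(1)[OF X]]
      comp_le(1)[OF le comp_hom[OF f p(1)] comp_hom[OF g p(1)] prj_hom(2)[OF X]]
    by (simp_all add: *[OF f] *[OF g])
  then show "f \<preceq> g"
    using jointly_order_monoD[OF j, of f Z g] f g x by (simp add: hom_def)
qed

lemma jointly_order_mono_prj:
  assumes X: "X \<in> Obj C" "Y \<in> Obj C" and m: "m \<in> hom C T (prod_obj C X Y)" "ff_morphism C m"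
  shows "jointly_order_mono C (prj0 C X Y \<cdot> m) (prj1 C X Y \<cdot> m)"
proof (rule jointly_order_monoI[OF comp_hom comp_hom, OF m(1) prj_hom(1)[OF X] m(1) prj_hom(2)[OF X]])
  fix Z u v
  assume u: "u \<in> hom C Z T" and v: "v \<in> hom C Z T"
    and le: "(prj0 C X Y \<cdot> m) \<cdot> u \<preceq> (prj0 C X Y \<cdot> m) \<cdot> v" "(prj1 C X Y \<cdot> m) \<cdot> u \<preceq> (prj1 C X Y \<cdot> m) \<cdot> v"
  have "m \<cdot> u \<preceq> m \<cdot> v"
    using prod_le[OF X comp_hom[OF u m(1)] comp_hom[OF v m(1)]] le
      comp_assoc[OF u m(1)] comp_assoc[OF v m(1)] prj_hom[OF X] by metis
  then show "u \<preceq> v"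
    by (rule ffD[OF m(2,1) u v])
qed

section \<open>\<open>so\<close>-morphisms as covers\<close>

lemma so_order_epi:
  assumes so: "so_morphism C e" and e: "e \<in> hom C A B" and u: "u \<in> hom C B Z" and v: "v \<in> hom C B Z"
    and le: "u \<cdot> e \<preceq> v \<cdot> e"
  shows "u \<preceq> v"
proof -
  obtain K k0 k1 where com: "is_comma C u v k0 k1" and k: "k0 \<in> hom C K B" "k1 \<in> hom C K B"
    and kle: "u \<cdot> k0 \<preceq> v \<cdot> k1"
    using commaE[OF u v] .
  obtain h where h: "h \<in> hom C A K" "k0 \<cdot> h = e" "k1 \<cdot> h = e"
    using comma_lift[OF com k e e le] .
  have j: "jointly_order_mono C k0 k1"
    using com by (simp add: is_comma_def)
  have B: "B \<in> Obj C"
    using hom_Obj[OF e] by blast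
  note i = ident_hom[OF B]
  have "pairing C k0 k1 \<cdot> h = pairing C (Ident C B) (Ident C B) \<cdot> e"
    using pairing_comp[OF k h(1)] pairing_comp[OF i i e] h ident_left[OF e] by simp
  \<comment> \<open>The pairing of \<open>k0\<close> and \<open>k1\<close> is \<open>ff\<close>, and
    \<open>e\<close> followed by the diagonal of \<open>B\<close> factors through it. The fill-in
    \<open>d\<close> is a common section of \<open>k0\<close> and \<open>k1\<close>, so restricting
    \<open>u k0 \<preceq> v k1\<close> along \<open>d\<close> gives
    \<open>u \<preceq> v\<close>.\<close>
  then obtain d where d: "d \<in> hom C B K" "pairing C k0 k1 \<cdot> d = pairing C (Ident C B) (Ident C B)"
    using so_diagonal[OF so ff_pairing[OF k j] e pairing(1)[OF k] h(1) pairing(1)[OF i i]] by blast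
  then have "pairing C (k0 \<cdot> d) (k1 \<cdot> d) = pairing C (Ident C B) (Ident C B)"
    using pairing_comp[OF k d(1)] by simp
  then have kd: "k0 \<cdot> d = Ident C B" "k1 \<cdot> d = Ident C B"
    using pairing[OF comp_hom[OF d(1) k(1)] comp_hom[OF d(1) k(2)]] pairing[OF i i] by auto
  have "(u \<cdot> k0) \<cdot> d \<preceq> (v \<cdot> k1) \<cdot> d"
    by (rule comp_le(2)[OF kle comp_hom[OF k(1) u] comp_hom[OF k(2) v] d(1)])
  then show ?thesis
    using comp_assoc[OF d(1) k(1) u] comp_assoc[OF d(1) k(2) v] kd ident_right u v by simp
qed

lemma so_epi:
  assumes "so_morphism C e" "e \<in> hom C A B" "u \<in> hom C B Z" "v \<in> hom C B Z" "u \<cdot> e = v \<cdot> e"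
  shows "u = v"
  by (rule order_epi_eq[OF _ assms(2-5)]) (rule so_order_epi[OF assms(1,2)])

lemma so_ident: "X \<in> Obj C \<Longrightarrow> so_morphism C (Ident C X)"
  by (rule soI[OF ident_hom]) (auto simp: ident_right intro!: bexI)

lemma so_comp:
  assumes so: "so_morphism C e" "so_morphism C f" and e: "e \<in> hom C A B" and f: "f \<in> hom C B D"
  shows "so_morphism C (f \<cdot> e)"
proof (rule soI[OF comp_hom[OF e f]])
  fix Z u v
  assume u: "u \<in> hom C D Z" and v: "v \<in> hom C D Z" and "u \<cdot> (f \<cdot> e) \<preceq> v \<cdot> (f \<cdot> e)"
  then have "(u \<cdot> f) \<cdot> e \<preceq> (v \<cdot> f) \<cdot> e"
    using comp_assoc[OF e f] by simp
  then have "u \<cdot> f \<preceq> v \<cdot> f"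
    by (rule so_order_epi[OF so(1) e comp_hom[OF f u] comp_hom[OF f v]])
  then show "u \<preceq> v"
    by (rule so_order_epi[OF so(2) f u v])
next
  fix m X Y u v
  assume m: "ff_morphism C m" "m \<in> hom C X Y" and u: "u \<in> hom C A X" and v: "v \<in> hom C D Y"
    and "m \<cdot> u = v \<cdot> (f \<cdot> e)"
  then have "m \<cdot> u = (v \<cdot> f) \<cdot> e"
    using comp_assoc[OF e f v] by simp
  then obtain d where d: "d \<in> hom C B X" "d \<cdot> e = u" "m \<cdot> d = v \<cdot> f"
    using so_diagonal[OF so(1) m(1) e m(2) u comp_hom[OF f v]] by blast
  then obtain d' where "d' \<in> hom C D X" "d' \<cdot> f = d" "m \<cdot> d' = v"
    using so_diagonal[OF so(2) m(1) f m(2) d(1) v] by blast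
  then show "\<exists>d \<in> hom C D X. d \<cdot> (f \<cdot> e) = u"
    using comp_assoc[OF e f] d(2) by auto
qed

lemma so_cancel:
  assumes so: "so_morphism C (f \<cdot> e)" and e: "e \<in> hom C A B" and f: "f \<in> hom C B D"
  shows "so_morphism C f"
proof (rule soI[OF f])
  fix Z u v
  assume u: "u \<in> hom C D Z" and v: "v \<in> hom C D Z" and le: "u \<cdot> f \<preceq> v \<cdot> f"
  then have "(u \<cdot> f) \<cdot> e \<preceq> (v \<cdot> f) \<cdot> e"
    using comp_le(2)[OF le comp_hom[OF f u] comp_hom[OF f v] e] by simp
  then show "u \<preceq> v"
    using comp_assoc[OF e f] u v so_order_epi[OF so comp_hom[OF e f] u v] by simp
next
  fix m X Y u v
  assume m: "ff_morphism C m" "m \<in> hom C X Y" and u: "u \<in> hom C B X" and v: "v \<in> hom C D Y"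
    and sq: "m \<cdot> u = v \<cdot> f"
  then have "m \<cdot> (u \<cdot> e) = v \<cdot> (f \<cdot> e)"
    using comp_assoc[OF e u m(2)] comp_assoc[OF e f v] by simp
  then obtain d where d: "d \<in> hom C D X" "m \<cdot> d = v"
    using so_diagonal[OF so m(1) comp_hom[OF e f] m(2) comp_hom[OF e u] v] by blast
  have "m \<cdot> (d \<cdot> f) = m \<cdot> u"
    using comp_assoc[OF f d(1) m(2)] d(2) sq by simp
  then have "d \<cdot> f = u"
    by (rule ff_mono[OF m comp_hom[OF f d(1)] u])
  then show "\<exists>d \<in> hom C D X. d \<cdot> f = u"
    using d(1) by blast
qed

lemma so_split:
  assumes f: "f \<in> hom C A B" and g: "g \<in> hom C B A" and fg: "f \<cdot> g = Ident C B"
  shows "so_morphism C f"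
  using so_cancel[OF _ g f] so_ident hom_Obj(2)[OF f] fg by simp

lemma so_ff_iso:
  assumes so: "so_morphism C f" and ff: "ff_morphism C f" and f: "f \<in> hom C A B"
  obtains g where "g \<in> hom C B A" "g \<cdot> f = Ident C A" "f \<cdot> g = Ident C B"
proof -
  have A: "A \<in> Obj C" "B \<in> Obj C"
    using hom_Obj[OF f] by auto
  have "f \<cdot> Ident C A = Ident C B \<cdot> f"
    using ident_left[OF f] ident_right[OF f] by simp
  then show ?thesis
    using so_diagonal[OF so ff f f ident_hom[OF A(1)] ident_hom[OF A(2)]] that by blast
qed

text \<open>Pullback-stability gives local lifting: a generalized element of \<open>B\<close> comes
  from one of \<open>A\<close> after restriction along a cover. This is how covers of a stage arise
  in the element calculus below.\<close>

lemma lift_along_so: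
  assumes so: "so_morphism C e" and e: "e \<in> hom C A B" and x: "x \<in> hom C T B"
  obtains T' c a where "c \<in> hom C T' T" "so_morphism C c" "a \<in> hom C T' A" "x \<cdot> c = e \<cdot> a"
proof -
  obtain P p0 p1 where p: "is_pullback C x e p0 p1" "p0 \<in> hom C P T" "p1 \<in> hom C P A" "x \<cdot> p0 = e \<cdot> p1"
    using pullbackE[OF x e] .
  then show ?thesis
    using that so_stable[OF p(1) so] by blast
qed

text \<open>With \<open>m \<cdot> p\<close> the factorization of the pairing of \<open>e\<close> and \<open>g\<close>, the first component of \<open>m\<close> is
  both \<open>so\<close> and \<open>ff\<close>.\<close>

lemma so_factor:
  assumes so: "so_morphism C e" and e: "e \<in> hom C A B" and g: "g \<in> hom C A Z"
    and le: "\<And>T s t. \<lbrakk>s \<in> hom C T A; t \<in> hom C T A; e \<cdot> s \<preceq> e \<cdot> t\<rbrakk> \<Longrightarrow> g \<cdot> s \<preceq> g \<cdot> t"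
  shows "\<exists>u \<in> hom C B Z. g = u \<cdot> e"
proof -
  have X: "B \<in> Obj C" "Z \<in> Obj C"
    using hom_Obj[OF e] hom_Obj[OF g] by auto
  note eg = pairing[OF e g]
  obtain p m where pm: "so_morphism C p" "ff_morphism C m" "Cod C p = Dom C m" "pairing C e g = m \<cdot> p"
    using factorization[of "pairing C e g"] eg(1) by (auto simp: hom_def)
  define I where "I = Dom C m"
  have "p \<in> Arr C" "m \<in> Arr C"
    using pm by (auto simp: so_morphism_def ff_morphism_def)
  then have p: "p \<in> hom C A I" and m: "m \<in> hom C I (prod_obj C B Z)"
    using pm(3,4) eg(1) I_def by (auto simp: hom_def)
  define m0 m1 where "m0 = prj0 C B Z \<cdot> m" and "m1 = prj1 C B Z \<cdot> m"
  have m0: "m0 \<in> hom C I B" and m1: "m1 \<in> hom C I Z"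
    unfolding m0_def m1_def using comp_hom[OF m] prj_hom[OF X] by auto
  have m0p: "m0 \<cdot> p = e" and m1p: "m1 \<cdot> p = g"
    unfolding m0_def m1_def using comp_assoc[OF p m] prj_hom[OF X] eg(2,3) pm(4) by auto
  have so0: "so_morphism C m0"
    using so_cancel[OF _ p m0] so m0p by simp
  have "ff_morphism C m0"
  proof (rule ffI[OF m0])
    fix T s t
    assume s: "s \<in> hom C T I" and t: "t \<in> hom C T I" and mst: "m0 \<cdot> s \<preceq> m0 \<cdot> t"
    \<comment> \<open>\<open>s\<close> and \<open>t\<close> lift through \<open>p\<close> only
      locally. The cover for \<open>t\<close> is taken over the one for \<open>s\<close>, so that
      both lifts live over the composite \<open>c\<close>.\<close>
    obtain T1 c1 a1 where c1: "c1 \<in> hom C T1 T" "so_morphism C c1" "a1 \<in> hom C T1 A" "s \<cdot> c1 = p \<cdot> a1"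
      using lift_along_so[OF pm(1) p s] .
    obtain T2 c2 a2 where c2: "c2 \<in> hom C T2 T1" "so_morphism C c2" "a2 \<in> hom C T2 A"
        "(t \<cdot> c1) \<cdot> c2 = p \<cdot> a2"
      using lift_along_so[OF pm(1) p comp_hom[OF c1(1) t]] .
    define c a where "c = c1 \<cdot> c2" and "a = a1 \<cdot> c2"
    have c: "c \<in> hom C T2 T" "so_morphism C c" and a: "a \<in> hom C T2 A"
      unfolding c_def a_def using comp_hom c1 c2 so_comp by blast+
    have sc: "s \<cdot> c = p \<cdot> a" and tc: "t \<cdot> c = p \<cdot> a2"
      using c1 c2 comp_assoc[OF c2(1) c1(1) s] comp_assoc[OF c2(1) c1(1) t]
        comp_assoc[OF c2(1) c1(3) p] by (simp_all add: c_def a_def)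
    have *: "m0 \<cdot> (p \<cdot> b) = e \<cdot> b" "m1 \<cdot> (p \<cdot> b) = g \<cdot> b" if "b \<in> hom C T2 A" for b
      using comp_assoc[OF that p m0] comp_assoc[OF that p m1] m0p m1p by auto
    have "(m0 \<cdot> s) \<cdot> c \<preceq> (m0 \<cdot> t) \<cdot> c"
      by (rule comp_le(2)[OF mst comp_hom[OF s m0] comp_hom[OF t m0] c(1)])
    then have "e \<cdot> a \<preceq> e \<cdot> a2"
      using comp_assoc[OF c(1) s m0] comp_assoc[OF c(1) t m0] sc tc *[OF a] *[OF c2(3)] by simp
    then have "g \<cdot> a \<preceq> g \<cdot> a2"
      by (rule le[OF a c2(3)])
    then have "(m1 \<cdot> s) \<cdot> c \<preceq> (m1 \<cdot> t) \<cdot> c"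
      using comp_assoc[OF c(1) s m1] comp_assoc[OF c(1) t m1] sc tc *[OF a] *[OF c2(3)] by simp
    then have "m1 \<cdot> s \<preceq> m1 \<cdot> t"
      by (rule so_order_epi[OF c(2,1) comp_hom[OF s m1] comp_hom[OF t m1]])
    then show "s \<preceq> t"
      using jointly_order_monoD[OF jointly_order_mono_prj[OF X m pm(2)], of s T t] mst s t m0
      unfolding m0_def[symmetric] m1_def[symmetric] by (simp add: hom_def)
  qed
  from so_ff_iso[OF so0 this m0] obtain k where k: "k \<in> hom C B I" "k \<cdot> m0 = Ident C I"
    by blast
  have "(m1 \<cdot> k) \<cdot> e = m1 \<cdot> ((k \<cdot> m0) \<cdot> p)"
    using comp_assoc[OF e k(1) m1] comp_assoc[OF p m0 k(1)] m0p by simp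
  also have "\<dots> = g"
    using k ident_left[OF p] m1p by simp
  finally show ?thesis
    using comp_hom[OF k(1) m1] by blast
qed

text \<open>The kernel \<open>e/e\<close> serves as the parallel pair: a \<open>g\<close> with
  \<open>g k0 \<preceq> g k1\<close> respects every pair with \<open>e s \<preceq> e t\<close>, and
  \<open>so_factor\<close> applies. \<open>covering\<close> is phrased with effective epimorphisms,
  hence the need for this converse of \<open>effective_epi_so\<close>.\<close>

lemma so_effective_epi:
  assumes so: "so_morphism C e" and e: "e \<in> hom C A B"
  shows "effective_epi C e"
proof -
  obtain K k0 k1 where com: "is_comma C e e k0 k1" and k: "k0 \<in> hom C K A" "k1 \<in> hom C K A"
      "e \<cdot> k0 \<preceq> e \<cdot> k1"
    using commaE[OF e e] .
  have "\<exists>u\<in>hom C B Z. g = u \<cdot> e" if g: "g \<in> hom C A Z" and gk: "g \<cdot> k0 \<preceq> g \<cdot> k1" for Z g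
  proof -
    have "g \<cdot> s \<preceq> g \<cdot> t" if st: "s \<in> hom C T A" "t \<in> hom C T A" "e \<cdot> s \<preceq> e \<cdot> t" for T s t
    proof -
      obtain h where h: "h \<in> hom C T K" "k0 \<cdot> h = s" "k1 \<cdot> h = t"
        using comma_lift[OF com k(1,2) st] .
      then show ?thesis
        using comp_le(2)[OF gk comp_hom[OF k(1) g] comp_hom[OF k(2) g] h(1)]
          comp_assoc[OF h(1) k(1) g] comp_assoc[OF h(1) k(2) g] by simp
    qed
    then show ?thesis
      by (rule so_factor[OF so e g])
  qed
  moreover have "u \<preceq> v" if "u \<in> hom C B Z" "v \<in> hom C B Z" "u \<cdot> e \<preceq> v \<cdot> e" for Z u v
    by (rule so_order_epi[OF so e that])
  ultimately have "coinserter C k0 k1 e"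
    by (rule coinserterI[OF k(1,2) e k(3)])
  then show ?thesis
    by (auto simp: effective_epi_def)
qed

end

section \<open>Calculus of relations\<close>

context reg_cat
begin

lemma prj_comp_hom:
  assumes "X \<in> Obj C" "Y \<in> Obj C" "r \<in> hom C T (prod_obj C X Y)"
  shows "prj0 C X Y \<cdot> r \<in> hom C T X" "prj1 C X Y \<cdot> r \<in> hom C T Y"
  using comp_hom[OF assms(3)] prj_hom[OF assms(1,2)] by auto

lemma factors_pairing_iff:
  assumes r: "r \<in> hom C T (prod_obj C X Y)" and x: "x \<in> hom C A X" and y: "y \<in> hom C A Y"
  shows "factors_through C (pairing C x y) r \<longleftrightarrow>
    (\<exists>h \<in> hom C A T. (prj0 C X Y \<cdot> r) \<cdot> h = x \<and> (prj1 C X Y \<cdot> r) \<cdot> h = y)"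
proof -
  have X: "X \<in> Obj C" "Y \<in> Obj C"
    using hom_Obj x y by auto
  note p = pairing[OF x y]
  have d: "Dom C (pairing C x y) = A" "Dom C r = T"
    using p(1) r by (auto simp: hom_def)
  have "pairing C x y = r \<cdot> h \<longleftrightarrow> (prj0 C X Y \<cdot> r) \<cdot> h = x \<and> (prj1 C X Y \<cdot> r) \<cdot> h = y"
    if h: "h \<in> hom C A T" for h
  proof -
    have "(prj0 C X Y \<cdot> r) \<cdot> h = prj0 C X Y \<cdot> (r \<cdot> h)" "(prj1 C X Y \<cdot> r) \<cdot> h = prj1 C X Y \<cdot> (r \<cdot> h)"
      using comp_assoc[OF h r] prj_hom[OF X] by auto
    then show ?thesis
      using p pairing_prj[OF X comp_hom[OF h r]] by auto
  qed
  then show ?thesis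
    unfolding factors_through_def d by blast
qed

lemma factors_through_trans:
  assumes "factors_through C f g" "factors_through C g h" "h \<in> Arr C"
  shows "factors_through C f h"
proof -
  obtain k where k: "k \<in> hom C (Dom C f) (Dom C g)" "f = g \<cdot> k"
    using assms(1) by (auto simp: factors_through_def)
  obtain l where l: "l \<in> hom C (Dom C g) (Dom C h)" "g = h \<cdot> l"
    using assms(2) by (auto simp: factors_through_def)
  have "f = h \<cdot> (l \<cdot> k)"
    using comp_assoc[OF k(1) l(1) arr_hom[OF assms(3)]] k(2) l(2) by simp
  then show ?thesis
    using comp_hom[OF k(1) l(1)] by (auto simp: factors_through_def)
qed

lemma factors_through_self: "m \<in> Arr C \<Longrightarrow> factors_through C m m"
  unfolding factors_through_def using ident_hom[of "Dom C m"] by force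

lemma ff_arr: "ff_morphism C m \<Longrightarrow> m \<in> Arr C"
  by (simp add: ff_morphism_def)

lemma so_arr: "so_morphism C m \<Longrightarrow> m \<in> Arr C"
  by (simp add: so_morphism_def)

text \<open>Yoneda: an \<open>ff\<close>-morphism into the product factors through another as soon
  as its own pair of projections, its generic element, does.\<close>

lemma subobject_iff:
  assumes X: "X \<in> Obj C" "Y \<in> Obj C" and m: "ff_morphism C m" "Cod C m = prod_obj C X Y"
  shows "n \<in> subobject C m \<longleftrightarrow> ff_morphism C n \<and> Cod C n = prod_obj C X Y \<and>
    (\<forall>A x y. x \<in> hom C A X \<longrightarrow> y \<in> hom C A Y \<longrightarrow>
      factors_through C (pairing C x y) n = factors_through C (pairing C x y) m)"
    (is "?L \<longleftrightarrow> ?R")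
proof
  assume L: ?L
  then have n: "ff_morphism C n" "factors_through C n m" "factors_through C m n"
    by (auto simp: subobject_def)
  have "n \<in> Arr C" "m \<in> Arr C"
    using m n by (simp_all add: ff_arr)
  moreover have "Cod C n = Cod C m"
    using n(2) \<open>m \<in> Arr C\<close> by (auto simp: factors_through_def hom_def)
  ultimately show ?R
    using n m factors_through_trans by metis
next
  assume R: ?R
  have *: "factors_through C k l"
    if k: "ff_morphism C k" "Cod C k = prod_obj C X Y"
      and kl: "\<forall>A x y. x \<in> hom C A X \<longrightarrow> y \<in> hom C A Y \<longrightarrow>
      factors_through C (pairing C x y) k \<longrightarrow> factors_through C (pairing C x y) l" for k l
  proof -
    have kh: "k \<in> hom C (Dom C k) (prod_obj C X Y)"
      using ff_arr[OF k(1)] k(2) by (simp add: hom_def)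
    show ?thesis
      using kl prj_comp_hom[OF X kh] pairing_prj[OF X kh] factors_through_self[OF ff_arr[OF k(1)]]
      by metis
  qed
  show ?L
    using *[of n m] *[of m n] R m by (auto simp: subobject_def)
qed

section \<open>Membership, inclusion and equality of relations by generalized elements\<close>

lemma subobject_relations:
  "\<lbrakk>ff_morphism C m; Cod C m = prod_obj C X Y\<rbrakk> \<Longrightarrow> subobject C m \<in> relations C X Y"
  by (auto simp: relations_def)

lemma self_subobject: "ff_morphism C m \<Longrightarrow> m \<in> subobject C m"
  by (simp add: subobject_def factors_through_self ff_arr)

lemma relations_rep:
  assumes R: "R \<in> relations C X Y" "r \<in> R"
  shows "ff_morphism C r" "r \<in> hom C (Dom C r) (prod_obj C X Y)"
proof -
  obtain m where m: "ff_morphism C m" "Cod C m = prod_obj C X Y" "R = subobject C m"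
    using R(1) by (auto simp: relations_def)
  show "ff_morphism C r"
    using R(2) m by (simp add: subobject_def)
  moreover have "factors_through C r m"
    using R(2) m by (simp add: subobject_def)
  ultimately show "r \<in> hom C (Dom C r) (prod_obj C X Y)"
    using m ff_arr by (auto simp: factors_through_def hom_def)
qed

lemma relations_nonempty:
  assumes "R \<in> relations C X Y"
  obtains r where "r \<in> R"
  using assms self_subobject by (auto simp: relations_def)

lemma rel_mem_factors:
  assumes R: "R \<in> relations C X Y" "r \<in> R"
  shows "rel_mem C x y R \<longleftrightarrow> factors_through C (pairing C x y) r"
proof -
  obtain m where m: "ff_morphism C m" "Cod C m = prod_obj C X Y" "R = subobject C m"
    using R(1) by (auto simp: relations_def)
  have "factors_through C s r" "r \<in> Arr C" if "s \<in> R" for s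
    using factors_through_trans[of s m r] that R(2) m ff_arr by (auto simp: subobject_def)
  then show ?thesis
    unfolding rel_mem_def using factors_through_trans R(2) by blast
qed

lemma rel_mem_iff:
  assumes R: "R \<in> relations C X Y" "r \<in> R" and xy: "x \<in> hom C A X" "y \<in> hom C A Y"
  shows "rel_mem C x y R \<longleftrightarrow>
    (\<exists>h \<in> hom C A (Dom C r). (prj0 C X Y \<cdot> r) \<cdot> h = x \<and> (prj1 C X Y \<cdot> r) \<cdot> h = y)"
  using rel_mem_factors[OF R] factors_pairing_iff[OF relations_rep(2)[OF R] xy] by simp

text \<open>A tabulation by the two legs of a representative. It is this form, a span instead of a
  morphism into a product, to which \<open>Gamma\<close> is applied later on.\<close>

lemma relE:
  assumes R: "R \<in> relations C X Y" and X: "X \<in> Obj C" "Y \<in> Obj C"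
  obtains T r0 r1 where "r0 \<in> hom C T X" "r1 \<in> hom C T Y" "jointly_order_mono C r0 r1"
    "\<forall>A x y. x \<in> hom C A X \<longrightarrow> y \<in> hom C A Y \<longrightarrow>
      (rel_mem C x y R \<longleftrightarrow> (\<exists>h \<in> hom C A T. r0 \<cdot> h = x \<and> r1 \<cdot> h = y))"
proof -
  obtain r where r: "r \<in> R"
    using relations_nonempty[OF R] .
  note rep = relations_rep[OF R r]
  show ?thesis
    using that[OF prj_comp_hom[OF X rep(2)] jointly_order_mono_prj[OF X rep(2,1)]]
      rel_mem_iff[OF R r] by blast
qed

lemma relations_span:
  assumes r: "r0 \<in> hom C T X" "r1 \<in> hom C T Y" and j: "jointly_order_mono C r0 r1"
  obtains R where "R \<in> relations C X Y"
    "\<And>A x y. \<lbrakk>x \<in> hom C A X; y \<in> hom C A Y\<rbrakk> \<Longrightarrow>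
      rel_mem C x y R \<longleftrightarrow> (\<exists>h \<in> hom C A T. r0 \<cdot> h = x \<and> r1 \<cdot> h = y)"
proof -
  note p = pairing[OF r]
  have ff: "ff_morphism C (pairing C r0 r1)"
    by (rule ff_pairing[OF r j])
  have R: "subobject C (pairing C r0 r1) \<in> relations C X Y"
    using subobject_relations[OF ff] p(1) by (simp add: hom_def)
  have "Dom C (pairing C r0 r1) = T"
    using p(1) by (simp add: hom_def)
  then show ?thesis
    using that[OF R] rel_mem_iff[OF R self_subobject[OF ff]] p by simp
qed

lemma rel_mem_comp:
  assumes R: "R \<in> relations C X Y" and x: "x \<in> hom C A X" "y \<in> hom C A Y" and m: "rel_mem C x y R"
    and c: "c \<in> hom C B A"
  shows "rel_mem C (x \<cdot> c) (y \<cdot> c) R"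
proof -
  have X: "X \<in> Obj C" "Y \<in> Obj C"
    using hom_Obj x by auto
  obtain T r0 r1 where r: "r0 \<in> hom C T X" "r1 \<in> hom C T Y" "jointly_order_mono C r0 r1"
    and mem: "\<forall>A x y. x \<in> hom C A X \<longrightarrow> y \<in> hom C A Y \<longrightarrow>
      (rel_mem C x y R \<longleftrightarrow> (\<exists>h \<in> hom C A T. r0 \<cdot> h = x \<and> r1 \<cdot> h = y))"
    using relE[OF R X] .
  obtain h where h: "h \<in> hom C A T" "r0 \<cdot> h = x" "r1 \<cdot> h = y"
    using mem x m by blast
  then have "r0 \<cdot> (h \<cdot> c) = x \<cdot> c" "r1 \<cdot> (h \<cdot> c) = y \<cdot> c"
    using comp_assoc[OF c h(1)] r(1,2) by auto
  then show ?thesis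
    using mem comp_hom[OF c x(1)] comp_hom[OF c x(2)] comp_hom[OF c h(1)] by blast
qed

text \<open>Covers are orthogonal to \<open>ff\<close>-morphisms: the factorization over
  \<open>c\<close> and the pairing itself form a square whose diagonal is the wanted factorization.
  Membership in a relation is therefore a local property.\<close>

lemma factors_descent:
  assumes r: "ff_morphism C r" "r \<in> hom C T (prod_obj C X Y)" and x: "x \<in> hom C A X" "y \<in> hom C A Y"
    and c: "c \<in> hom C B A" "so_morphism C c"
    and m: "factors_through C (pairing C (x \<cdot> c) (y \<cdot> c)) r"
  shows "factors_through C (pairing C x y) r"
proof -
  note p = pairing[OF x]
  have d: "Dom C (pairing C x y \<cdot> c) = B" "Dom C r = T" "Dom C (pairing C x y) = A"
    using comp_hom[OF c(1) p(1)] r(2) p(1)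
    by (auto simp: hom_def)
  obtain h where h: "h \<in> hom C B T" "pairing C x y \<cdot> c = r \<cdot> h"
    using m unfolding factors_through_def d pairing_comp[OF x c(1)] by blast
  obtain k where "k \<in> hom C A T" "r \<cdot> k = pairing C x y"
    using so_diagonal[OF c(2) r(1) c(1) r(2) h(1) p(1) h(2)[symmetric]] by blast
  then show ?thesis
    unfolding factors_through_def d by metis
qed

lemma rel_mem_descent:
  assumes R: "R \<in> relations C X Y" and x: "x \<in> hom C A X" "y \<in> hom C A Y"
    and c: "c \<in> hom C B A" "so_morphism C c" and m: "rel_mem C (x \<cdot> c) (y \<cdot> c) R"
  shows "rel_mem C x y R"
proof -
  obtain r where r: "r \<in> R"
    using relations_nonempty[OF R] .
  show ?thesis
    using m unfolding rel_mem_factors[OF R r] by (rule factors_descent[OF relations_rep[OF R r] x c])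
qed

lemma rel_le_iff:
  assumes X: "X \<in> Obj C" "Y \<in> Obj C" and R: "R \<in> relations C X Y" and S: "S \<in> relations C X Y"
  shows "rel_le C R S \<longleftrightarrow>
    (\<forall>A x y. x \<in> hom C A X \<longrightarrow> y \<in> hom C A Y \<longrightarrow> rel_mem C x y R \<longrightarrow> rel_mem C x y S)"
    (is "?L \<longleftrightarrow> ?R")
proof
  assume ?L
  then obtain r s where rs: "r \<in> R" "s \<in> S" "factors_through C r s"
    by (auto simp: rel_le_def)
  then show ?R
    unfolding rel_mem_factors[OF R rs(1)] rel_mem_factors[OF S rs(2)]
    using factors_through_trans[OF _ rs(3)] relations_rep[OF S rs(2)] by (simp add: hom_def)
next
  assume *: ?R
  obtain r s where r: "r \<in> R" and s: "s \<in> S"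
    using relations_nonempty R S by metis
  note rep = relations_rep[OF R r]
  have "factors_through C (pairing C (prj0 C X Y \<cdot> r) (prj1 C X Y \<cdot> r)) s"
    using * prj_comp_hom[OF X rep(2)] factors_through_self[OF ff_arr[OF rep(1)]]
    unfolding rel_mem_factors[OF R r] rel_mem_factors[OF S s]
    by (metis X pairing_prj rep(2))
  then show ?L
    using r s pairing_prj[OF X rep(2)] by (auto simp: rel_le_def)
qed

text \<open>Relations are full classes of representatives, so agreement on generalized elements
  yields equality as sets and not just mutual inclusion.\<close>

lemma rel_eqI:
  assumes X: "X \<in> Obj C" "Y \<in> Obj C" and R: "R \<in> relations C X Y" and S: "S \<in> relations C X Y"
    and eq: "\<And>A x y. \<lbrakk>x \<in> hom C A X; y \<in> hom C A Y\<rbrakk> \<Longrightarrow> rel_mem C x y R \<longleftrightarrow> rel_mem C x y S"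
  shows "R = S"
proof -
  obtain m where m: "ff_morphism C m" "Cod C m = prod_obj C X Y" "R = subobject C m"
    using R by (auto simp: relations_def)
  obtain n where n: "ff_morphism C n" "Cod C n = prod_obj C X Y" "S = subobject C n"
    using S by (auto simp: relations_def)
  have "factors_through C (pairing C x y) m = factors_through C (pairing C x y) n"
    if "x \<in> hom C A X" "y \<in> hom C A Y" for A x y
    using eq[OF that] rel_mem_factors[OF R, of m] rel_mem_factors[OF S, of n] m n self_subobject
    by simp
  then show ?thesis
    unfolding m(3) n(3)
    using subobject_iff[OF X m(1,2)] subobject_iff[OF X n(1,2)] by (intro set_eqI) simp
qed

lemma comma_factors:
  assumes f: "f \<in> hom C X Z" and g: "g \<in> hom C Y Z" and com: "is_comma C f g c0 c1"
    and x: "x \<in> hom C A X" "y \<in> hom C A Y"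
  shows "factors_through C (pairing C x y) (pairing C c0 c1) \<longleftrightarrow> f \<cdot> x \<preceq> g \<cdot> y"
proof -
  define T where "T = Dom C c0"
  have c: "c0 \<in> hom C T X" "c1 \<in> hom C T Y" "f \<cdot> c0 \<preceq> g \<cdot> c1"
    using com f g by (auto simp: is_comma_def jointly_order_mono_def hom_def T_def)
  note p = pairing[OF c(1,2)]
  have "(\<exists>h \<in> hom C A T. c0 \<cdot> h = x \<and> c1 \<cdot> h = y) \<longleftrightarrow> f \<cdot> x \<preceq> g \<cdot> y"
  proof
    assume "\<exists>h \<in> hom C A T. c0 \<cdot> h = x \<and> c1 \<cdot> h = y"
    then obtain h where h: "h \<in> hom C A T" "c0 \<cdot> h = x" "c1 \<cdot> h = y"
      by blast
    then show "f \<cdot> x \<preceq> g \<cdot> y"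
      using comp_le(2)[OF c(3) comp_hom[OF c(1) f] comp_hom[OF c(2) g] h(1)]
        comp_assoc[OF h(1) c(1) f] comp_assoc[OF h(1) c(2) g] by simp
  next
    assume "f \<cdot> x \<preceq> g \<cdot> y"
    from comma_lift[OF com c(1,2) x this]
    show "\<exists>h \<in> hom C A T. c0 \<cdot> h = x \<and> c1 \<cdot> h = y"
      by blast
  qed
  then show ?thesis
    using factors_pairing_iff[OF p(1) x] p(2,3) by simp
qed

text \<open>\<open>comma_rel\<close> collects the pairings of all comma cones. These form one full
  subobject: any two comma objects have the same generalized elements, and conversely every
  representative of the class, composed with the projections, is again a comma object.\<close>

lemma comma_rel:
  assumes f: "f \<in> hom C X Z" and g: "g \<in> hom C Y Z"
  shows "comma_rel C f g \<in> relations C X Y"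
    and "\<And>A x y. \<lbrakk>x \<in> hom C A X; y \<in> hom C A Y\<rbrakk> \<Longrightarrow>
      rel_mem C x y (comma_rel C f g) \<longleftrightarrow> f \<cdot> x \<preceq> g \<cdot> y"
proof -
  have X: "X \<in> Obj C" "Y \<in> Obj C"
    using hom_Obj f g by auto
  have d: "Dom C f = X" "Dom C g = Y" "f \<in> Arr C" "g \<in> Arr C" "Cod C f = Cod C g"
    using f g by (auto simp: hom_def)
  have m: "ff_morphism C (pairing C d0 d1)" "Cod C (pairing C d0 d1) = prod_obj C X Y"
    if com: "is_comma C f g d0 d1" for d0 d1
  proof -
    have dd: "d0 \<in> hom C (Dom C d0) X" "d1 \<in> hom C (Dom C d0) Y" "jointly_order_mono C d0 d1"
      using com f g by (auto simp: is_comma_def jointly_order_mono_def hom_def)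
    show "ff_morphism C (pairing C d0 d1)" "Cod C (pairing C d0 d1) = prod_obj C X Y"
      using ff_pairing[OF dd] pairing(1)[OF dd(1,2)] by (auto simp: hom_def)
  qed
  obtain T c0 c1 where com: "is_comma C f g c0 c1"
    using commaE[OF f g] by blast
  have "n \<in> comma_rel C f g \<longleftrightarrow> n \<in> subobject C (pairing C c0 c1)" for n
  proof
    assume "n \<in> comma_rel C f g"
    then obtain d0 d1 where d: "is_comma C f g d0 d1" "n = pairing C d0 d1"
      by (auto simp: comma_rel_def)
    then show "n \<in> subobject C (pairing C c0 c1)"
      unfolding subobject_iff[OF X m[OF com]]
      using m[OF d(1)] comma_factors[OF f g d(1)] comma_factors[OF f g com] by simp
  next
    assume "n \<in> subobject C (pairing C c0 c1)"
    then have n: "ff_morphism C n" "Cod C n = prod_obj C X Y"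
      and mem: "\<And>A x y. \<lbrakk>x \<in> hom C A X; y \<in> hom C A Y\<rbrakk> \<Longrightarrow>
        factors_through C (pairing C x y) n \<longleftrightarrow> f \<cdot> x \<preceq> g \<cdot> y"
      unfolding subobject_iff[OF X m[OF com]] using comma_factors[OF f g com] by auto
    have nh: "n \<in> hom C (Dom C n) (prod_obj C X Y)"
      using ff_arr[OF n(1)] n(2) by (simp add: hom_def)
    let ?n0 = "prj0 C X Y \<cdot> n" and ?n1 = "prj1 C X Y \<cdot> n"
    note nn = prj_comp_hom[OF X nh]
    have "f \<cdot> ?n0 \<preceq> g \<cdot> ?n1"
      using mem[OF nn] pairing_prj[OF X nh] factors_through_self[OF ff_arr[OF n(1)]] by simp
    moreover have "\<exists>u\<in>hom C A (Dom C n). ?n0 \<cdot> u = x \<and> ?n1 \<cdot> u = y"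
      if "x \<in> hom C A X" "y \<in> hom C A Y" "f \<cdot> x \<preceq> g \<cdot> y" for A x y
      using mem[OF that(1,2)] that(3) factors_pairing_iff[OF nh that(1,2)] by simp
    moreover have "Dom C ?n0 = Dom C n" "Cod C ?n0 = X" "Cod C ?n1 = Y"
      using nn by (auto simp: hom_def)
    ultimately have "is_comma C f g ?n0 ?n1"
      using jointly_order_mono_prj[OF X nh n(1)] d unfolding is_comma_def by simp
    then show "n \<in> comma_rel C f g"
      using pairing_prj[OF X nh] unfolding comma_rel_def by force
  qed
  then have eq: "comma_rel C f g = subobject C (pairing C c0 c1)"
    by blast
  show R: "comma_rel C f g \<in> relations C X Y"
    unfolding eq by (rule subobject_relations[OF m[OF com]])
  show "rel_mem C x y (comma_rel C f g) \<longleftrightarrow> f \<cdot> x \<preceq> g \<cdot> y"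
    if "x \<in> hom C A X" "y \<in> hom C A Y" for A x y
    using rel_mem_factors[OF R] self_subobject[OF m(1)[OF com]] comma_factors[OF f g com that]
    unfolding eq by blast
qed

section \<open>Composition of relations\<close>

lemma rel_comp_factors:
  assumes X: "X \<in> Obj C" "Y \<in> Obj C" "Z \<in> Obj C"
    and R: "R \<in> relations C X Y" "r \<in> R" and S: "S \<in> relations C Y Z" "s \<in> S"
    and pb: "is_pullback C (prj1 C X Y \<cdot> r) (prj0 C Y Z \<cdot> s) t0 t1"
    and e: "so_morphism C e" "Cod C e = Dom C m" and m: "ff_morphism C m"
    and eq: "pairing C ((prj0 C X Y \<cdot> r) \<cdot> t0) ((prj1 C Y Z \<cdot> s) \<cdot> t1) = m \<cdot> e"
  shows "Cod C m = prod_obj C X Z"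
    and "\<And>A x z. \<lbrakk>x \<in> hom C A X; z \<in> hom C A Z\<rbrakk> \<Longrightarrow> factors_through C (pairing C x z) m \<longleftrightarrow>
      (\<exists>B c y. c \<in> hom C B A \<and> so_morphism C c \<and> y \<in> hom C B Y \<and>
        rel_mem C (x \<cdot> c) y R \<and> rel_mem C y (z \<cdot> c) S)"
proof -
  note rr = relations_rep[OF R] and ss = relations_rep[OF S]
  define r0 r1 s0 s1 where "r0 = prj0 C X Y \<cdot> r" and "r1 = prj1 C X Y \<cdot> r"
    and "s0 = prj0 C Y Z \<cdot> s" and "s1 = prj1 C Y Z \<cdot> s"
  note defs = r0_def[symmetric] r1_def[symmetric] s0_def[symmetric] s1_def[symmetric]
  have r: "r0 \<in> hom C (Dom C r) X" "r1 \<in> hom C (Dom C r) Y"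
    using prj_comp_hom[OF X(1,2) rr(2)] by (auto simp: defs)
  have s: "s0 \<in> hom C (Dom C s) Y" "s1 \<in> hom C (Dom C s) Z"
    using prj_comp_hom[OF X(2,3) ss(2)] by (auto simp: defs)
  note pb' = pb[unfolded defs] and eq' = eq[unfolded defs]
  define T where "T = Dom C t0"
  have t: "t0 \<in> hom C T (Dom C r)" "t1 \<in> hom C T (Dom C s)" "r1 \<cdot> t0 = s0 \<cdot> t1"
    using pb' r s by (auto simp: is_pullback_def jointly_order_mono_def hom_def T_def)
  note rt = comp_hom[OF t(1) r(1)] and st = comp_hom[OF t(2) s(2)]
  note p = pairing[OF rt st]
  define I where "I = Dom C m"
  have me: "m \<in> Arr C" "e \<in> Arr C"
    using ff_arr[OF m] so_arr[OF e(1)] by auto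
  have mh: "m \<in> hom C I (prod_obj C X Z)" and eh: "e \<in> hom C T I"
    using p(1) me e(2) unfolding eq' I_def by (auto simp: hom_def)
  then show "Cod C m = prod_obj C X Z"
    by (simp add: hom_def)
  define m0 m1 where "m0 = prj0 C X Z \<cdot> m" and "m1 = prj1 C X Z \<cdot> m"
  have mm: "m0 \<in> hom C I X" "m1 \<in> hom C I Z"
    using prj_comp_hom[OF X(1,3) mh] by (auto simp: m0_def m1_def)
  have m0e: "m0 \<cdot> e = r0 \<cdot> t0" and m1e: "m1 \<cdot> e = s1 \<cdot> t1"
    unfolding m0_def m1_def using comp_assoc[OF eh mh] prj_hom[OF X(1,3)] p(2,3) eq' by auto
  note memR = rel_mem_iff[OF R, unfolded defs] and memS = rel_mem_iff[OF S, unfolded defs]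
  show "factors_through C (pairing C x z) m \<longleftrightarrow>
      (\<exists>B c y. c \<in> hom C B A \<and> so_morphism C c \<and> y \<in> hom C B Y \<and>
        rel_mem C (x \<cdot> c) y R \<and> rel_mem C y (z \<cdot> c) S)" (is "?L \<longleftrightarrow> ?R")
    if x: "x \<in> hom C A X" and z: "z \<in> hom C A Z" for A x z
  proof
    assume ?L
    then obtain h where h: "h \<in> hom C A I" "m0 \<cdot> h = x" "m1 \<cdot> h = z"
      using factors_pairing_iff[OF mh x z] unfolding m0_def m1_def by blast
    \<comment> \<open>The image is reached only through \<open>e\<close>, so an element of
      \<open>m\<close> comes from the pullback after a cover; this is the existential quantifier
      over the middle variable \<open>y\<close>.\<close>
    obtain B c k where c: "c \<in> hom C B A" "so_morphism C c" "k \<in> hom C B T" "h \<cdot> c = e \<cdot> k"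
      using lift_along_so[OF e(1) eh h(1)] .
    have "x \<cdot> c = m0 \<cdot> (e \<cdot> k)" "z \<cdot> c = m1 \<cdot> (e \<cdot> k)"
      using comp_assoc[OF c(1) h(1)] mm h(2,3) c(4) by auto
    then have xc: "x \<cdot> c = r0 \<cdot> (t0 \<cdot> k)" and zc: "z \<cdot> c = s1 \<cdot> (t1 \<cdot> k)"
      using comp_assoc[OF c(3) eh] comp_assoc[OF c(3) t(1) r(1)] comp_assoc[OF c(3) t(2) s(2)]
        mm m0e m1e by metis+
    have yk: "r1 \<cdot> (t0 \<cdot> k) = s0 \<cdot> (t1 \<cdot> k)"
      using comp_assoc[OF c(3) t(1) r(2)] comp_assoc[OF c(3) t(2) s(1)] t(3) by simp
    note tk = comp_hom[OF c(3) t(1)] comp_hom[OF c(3) t(2)]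
    note yh = comp_hom[OF tk(1) r(2)]
    have "rel_mem C (x \<cdot> c) (r1 \<cdot> (t0 \<cdot> k)) R" "rel_mem C (r1 \<cdot> (t0 \<cdot> k)) (z \<cdot> c) S"
      using memR[OF comp_hom[OF c(1) x] yh] memS[OF yh comp_hom[OF c(1) z]] tk xc zc yk by auto
    then show ?R
      using c(1,2) yh by blast
  next
    assume ?R
    then obtain B c y where c: "c \<in> hom C B A" "so_morphism C c" "y \<in> hom C B Y"
      and mem: "rel_mem C (x \<cdot> c) y R" "rel_mem C y (z \<cdot> c) S"
      by blast
    note xc = comp_hom[OF c(1) x] and zc = comp_hom[OF c(1) z]
    obtain a b where a: "a \<in> hom C B (Dom C r)" "r0 \<cdot> a = x \<cdot> c" "r1 \<cdot> a = y"
      and b: "b \<in> hom C B (Dom C s)" "s0 \<cdot> b = y" "s1 \<cdot> b = z \<cdot> c"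
      using memR[OF xc c(3)] memS[OF c(3) zc] mem by blast
    have "r1 \<cdot> a = s0 \<cdot> b"
      using a b by simp
    then obtain k where k: "k \<in> hom C B T" "t0 \<cdot> k = a" "t1 \<cdot> k = b"
      using pullback_lift[OF pb' t(1,2) a(1) b(1)] by blast
    have "m0 \<cdot> (e \<cdot> k) = x \<cdot> c" "m1 \<cdot> (e \<cdot> k) = z \<cdot> c"
      using comp_assoc[OF k(1) eh mm(1)] comp_assoc[OF k(1) eh mm(2)] m0e m1e a b k
        comp_assoc[OF k(1) t(1) r(1)] comp_assoc[OF k(1) t(2) s(2)] by auto
    then have "factors_through C (pairing C (x \<cdot> c) (z \<cdot> c)) m"
      using factors_pairing_iff[OF mh xc zc] comp_hom[OF k(1) eh] unfolding m0_def m1_def by blast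
    then show ?L
      by (rule factors_descent[OF m mh x z c(1,2)])
  qed
qed

lemma rel_comp:
  assumes X: "X \<in> Obj C" "Y \<in> Obj C" "Z \<in> Obj C"
    and R: "R \<in> relations C X Y" and S: "S \<in> relations C Y Z"
  shows "rel_comp C X Y Z S R \<in> relations C X Z"
    and "\<And>A x z. \<lbrakk>x \<in> hom C A X; z \<in> hom C A Z\<rbrakk> \<Longrightarrow> rel_mem C x z (rel_comp C X Y Z S R) \<longleftrightarrow>
      (\<exists>B c y. c \<in> hom C B A \<and> so_morphism C c \<and> y \<in> hom C B Y \<and>
        rel_mem C (x \<cdot> c) y R \<and> rel_mem C y (z \<cdot> c) S)"
proof -
  obtain r s where r: "r \<in> R" and s: "s \<in> S"
    using relations_nonempty R S by metis
  note rr = prj_comp_hom[OF X(1,2) relations_rep(2)[OF R r]]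
    and ss = prj_comp_hom[OF X(2,3) relations_rep(2)[OF S s]]
  obtain T t0 t1 where pb: "is_pullback C (prj1 C X Y \<cdot> r) (prj0 C Y Z \<cdot> s) t0 t1"
    and t: "t0 \<in> hom C T (Dom C r)" "t1 \<in> hom C T (Dom C s)"
    using pullbackE[OF rr(2) ss(1)] by metis
  let ?p = "pairing C ((prj0 C X Y \<cdot> r) \<cdot> t0) ((prj1 C Y Z \<cdot> s) \<cdot> t1)"
  have "?p \<in> Arr C"
    using pairing(1)[OF comp_hom[OF t(1) rr(1)] comp_hom[OF t(2) ss(2)]] by (simp add: hom_def)
  then obtain e m where e: "so_morphism C e" "Cod C e = Dom C m" and m: "ff_morphism C m"
    and eq: "?p = m \<cdot> e"
    using factorization by metis
  note core = rel_comp_factors[OF X R r S s pb e m eq]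
  have "n \<in> rel_comp C X Y Z S R \<longleftrightarrow> n \<in> subobject C m" for n
  proof
    assume "n \<in> rel_comp C X Y Z S R"
    then obtain r' s' t0' t1' e' where n: "ff_morphism C n" "r' \<in> R" "s' \<in> S"
      "is_pullback C (prj1 C X Y \<cdot> r') (prj0 C Y Z \<cdot> s') t0' t1'"
      "so_morphism C e'" "Cod C e' = Dom C n"
      "pairing C ((prj0 C X Y \<cdot> r') \<cdot> t0') ((prj1 C Y Z \<cdot> s') \<cdot> t1') = n \<cdot> e'"
      unfolding rel_comp_def by blast
    note core' = rel_comp_factors[OF X R n(2) S n(3,4,5,6,1,7)]
    show "n \<in> subobject C m"
      unfolding subobject_iff[OF X(1,3) m core(1)] using n(1) core'(1) core(2) core'(2) by simp
  next
    assume "n \<in> subobject C m"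
    then have n: "ff_morphism C n" "factors_through C n m" "factors_through C m n"
      by (auto simp: subobject_def)
    have nm: "n \<in> Arr C" "m \<in> Arr C" "e \<in> Arr C"
      using n m e ff_arr so_arr by auto
    obtain h k where h: "h \<in> hom C (Dom C n) (Dom C m)" "n = m \<cdot> h"
      and k: "k \<in> hom C (Dom C m) (Dom C n)" "m = n \<cdot> k"
      using n(2,3) unfolding factors_through_def by blast
    have "n \<cdot> (k \<cdot> h) = (n \<cdot> k) \<cdot> h"
      using comp_assoc[OF h(1) k(1) arr_hom[OF nm(1)]] by simp
    also have "\<dots> = n \<cdot> Ident C (Dom C n)"
      unfolding k(2)[symmetric] h(2)[symmetric] using nm by simp
    finally have "k \<cdot> h = Ident C (Dom C n)"
      using ff_mono[OF n(1) arr_hom[OF nm(1)] comp_hom[OF h(1) k(1)] ident_hom] nm(1) by simp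
    then have "so_morphism C k"
      by (rule so_split[OF k(1) h(1)])
    moreover have eh: "e \<in> hom C (Dom C e) (Dom C m)"
      using nm e(2) by (simp add: hom_def)
    ultimately have "so_morphism C (k \<cdot> e)"
      using so_comp e(1) k(1) by blast
    moreover have "?p = n \<cdot> (k \<cdot> e)"
      unfolding eq comp_assoc[OF eh k(1) arr_hom[OF nm(1)], symmetric] k(2)[symmetric] ..
    moreover have "Cod C (k \<cdot> e) = Dom C n"
      using comp_hom[OF eh k(1)] by (simp add: hom_def)
    ultimately show "n \<in> rel_comp C X Y Z S R"
      unfolding rel_comp_def using r s pb n(1) by blast
  qed
  then have eq: "rel_comp C X Y Z S R = subobject C m"
    by blast
  show Q: "rel_comp C X Y Z S R \<in> relations C X Z"
    unfolding eq by (rule subobject_relations[OF m core(1)])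
  show "rel_mem C x z (rel_comp C X Y Z S R) \<longleftrightarrow>
      (\<exists>B c y. c \<in> hom C B A \<and> so_morphism C c \<and> y \<in> hom C B Y \<and>
        rel_mem C (x \<cdot> c) y R \<and> rel_mem C y (z \<cdot> c) S)"
    if "x \<in> hom C A X" "z \<in> hom C A Z" for A x z
    using rel_mem_factors[OF Q] self_subobject[OF m] core(2)[OF that] unfolding eq by blast
qed

end

section \<open>The category \<open>ex_reg C\<close>\<close>

abbreviation ex_comp (infixr "\<star>\<index>" 70) where "ex_comp C g f \<equiv> Comp (ex_reg C) g f"
abbreviation ex_le (infix "\<unlhd>\<index>" 50) where "ex_le C f g \<equiv> Le (ex_reg C) f g"

context reg_cat
begin

lemma congruenceD:
  assumes "congruence C X E"
  shows "E \<in> relations C X X"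
    "x \<in> hom C A X \<Longrightarrow> rel_mem C x x E"
    "\<lbrakk>x \<in> hom C A X; y \<in> hom C A X; z \<in> hom C A X; rel_mem C x y E; rel_mem C y z E\<rbrakk> \<Longrightarrow>
      rel_mem C x z E"
    "\<lbrakk>x \<in> hom C A X; x' \<in> hom C A X; y \<in> hom C A X; y' \<in> hom C A X; x' \<preceq> x; rel_mem C x y E;
      y \<preceq> y'\<rbrakk> \<Longrightarrow> rel_mem C x' y' E"
    "\<lbrakk>x \<in> hom C A X; y \<in> hom C A X; x \<preceq> y\<rbrakk> \<Longrightarrow> rel_mem C x y E"
proof -
  show "E \<in> relations C X X"
    using assms by (simp add: congruence_def)
  show refl: "rel_mem C x x E" if "x \<in> hom C A X" for x A
    using assms that hom_Obj(1)[OF that] unfolding congruence_def reflexive_rel_def by blast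
  show "rel_mem C x z E" if "x \<in> hom C A X" "y \<in> hom C A X" "z \<in> hom C A X"
    "rel_mem C x y E" "rel_mem C y z E" for x y z A
    using assms that hom_Obj(1)[OF that(1)] unfolding congruence_def transitive_rel_def by blast
  show weak: "rel_mem C x' y' E" if "x \<in> hom C A X" "x' \<in> hom C A X" "y \<in> hom C A X" "y' \<in> hom C A X"
    "x' \<preceq> x" "rel_mem C x y E" "y \<preceq> y'" for x x' y y' A
    using assms that hom_Obj(1)[OF that(1)] unfolding congruence_def weakening_closed_def by blast
  show "rel_mem C x y E" if "x \<in> hom C A X" "y \<in> hom C A X" "x \<preceq> y" for x y A
    using weak[OF that(1,1,1,2) le_refl[OF that(1)] refl[OF that(1)] that(3)] .
qed

lemma rel_comp_intro:
  assumes R: "R \<in> relations C X Y" and S: "S \<in> relations C Y Z"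
    and x: "x \<in> hom C A X" and y: "y \<in> hom C A Y" and z: "z \<in> hom C A Z"
    and m: "rel_mem C x y R" "rel_mem C y z S"
  shows "rel_mem C x z (rel_comp C X Y Z S R)"
proof -
  have X: "X \<in> Obj C" "Y \<in> Obj C" "Z \<in> Obj C" "A \<in> Obj C"
    using hom_Obj x y z by auto
  have "x \<cdot> Ident C A = x" "z \<cdot> Ident C A = z"
    using ident_right x z by auto
  then show ?thesis
    unfolding rel_comp(2)[OF X(1-3) R S x z] using ident_hom[OF X(4)] so_ident[OF X(4)] y m by metis
qed

text \<open>Witnesses of two existential statements live over different covers of the stage; pulling
  one cover back along the other brings them together.\<close>

lemma common_cover:
  assumes "c1 \<in> hom C B1 A" "so_morphism C c1" "c2 \<in> hom C B2 A" "so_morphism C c2"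
  obtains B d1 d2 where "d1 \<in> hom C B B1" "so_morphism C d1" "d2 \<in> hom C B B2" "c1 \<cdot> d1 = c2 \<cdot> d2"
    "c1 \<cdot> d1 \<in> hom C B A" "so_morphism C (c1 \<cdot> d1)"
proof -
  obtain B d1 d2 where d: "d1 \<in> hom C B B1" "so_morphism C d1" "d2 \<in> hom C B B2" "c1 \<cdot> d1 = c2 \<cdot> d2"
    using lift_along_so[OF assms(4,3,1)] .
  then show ?thesis
    using that comp_hom[OF d(1) assms(1)] so_comp[OF d(2) assms(2) d(1) assms(1)] by blast
qed

lemma rel_comp_assoc:
  assumes X: "X \<in> Obj C" "Y \<in> Obj C" "Z \<in> Obj C" "W \<in> Obj C"
    and R: "R \<in> relations C X Y" and S: "S \<in> relations C Y Z" and T: "T \<in> relations C Z W"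
  shows "rel_comp C X Y W (rel_comp C Y Z W T S) R = rel_comp C X Z W T (rel_comp C X Y Z S R)"
proof (rule rel_eqI)
  note SR = rel_comp[OF X(1-3) R S] and TS = rel_comp[OF X(2-4) S T]
  note TS_R = rel_comp[OF X(1,2,4) R TS(1)] and T_SR = rel_comp[OF X(1,3,4) SR(1) T]
  show "rel_comp C X Y W (rel_comp C Y Z W T S) R \<in> relations C X W"
    "rel_comp C X Z W T (rel_comp C X Y Z S R) \<in> relations C X W"
    by (fact TS_R(1), fact T_SR(1))
  fix A x w
  assume x: "x \<in> hom C A X" and w: "w \<in> hom C A W"
  \<comment> \<open>Both bracketings unfold to witnesses \<open>y\<close> and \<open>z\<close> over
    one cover: nested covers compose, and the outer witness is restricted to the finer
    stage.\<close>
  let ?Q = "\<exists>B c y z. c \<in> hom C B A \<and> so_morphism C c \<and> y \<in> hom C B Y \<and> z \<in> hom C B Z \<and>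
    rel_mem C (x \<cdot> c) y R \<and> rel_mem C y z S \<and> rel_mem C z (w \<cdot> c) T"
  have "rel_mem C x w (rel_comp C X Y W (rel_comp C Y Z W T S) R) \<longleftrightarrow> ?Q"
  proof
    assume "rel_mem C x w (rel_comp C X Y W (rel_comp C Y Z W T S) R)"
    then obtain B c y where c: "c \<in> hom C B A" "so_morphism C c" "y \<in> hom C B Y"
      "rel_mem C (x \<cdot> c) y R" "rel_mem C y (w \<cdot> c) (rel_comp C Y Z W T S)"
      unfolding TS_R(2)[OF x w] by blast
    then obtain D d z where d: "d \<in> hom C D B" "so_morphism C d" "z \<in> hom C D Z"
      "rel_mem C (y \<cdot> d) z S" "rel_mem C z ((w \<cdot> c) \<cdot> d) T"
      unfolding TS(2)[OF c(3) comp_hom[OF c(1) w]] by blast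
    have "rel_mem C (x \<cdot> (c \<cdot> d)) (y \<cdot> d) R"
      using rel_mem_comp[OF R comp_hom[OF c(1) x] c(3,4) d(1)] comp_assoc[OF d(1) c(1) x] by simp
    then show ?Q
      using comp_hom[OF d(1) c(1)] so_comp[OF d(2) c(2) d(1) c(1)] comp_hom[OF d(1) c(3)] d(3,4,5)
        comp_assoc[OF d(1) c(1) w] by metis
  next
    assume ?Q
    then obtain B c y z where "c \<in> hom C B A" "so_morphism C c" "y \<in> hom C B Y" "z \<in> hom C B Z"
      "rel_mem C (x \<cdot> c) y R" "rel_mem C y z S" "rel_mem C z (w \<cdot> c) T"
      by blast
    then show "rel_mem C x w (rel_comp C X Y W (rel_comp C Y Z W T S) R)"
      unfolding TS_R(2)[OF x w] using rel_comp_intro[OF S T] comp_hom w by blast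
  qed
  moreover have "rel_mem C x w (rel_comp C X Z W T (rel_comp C X Y Z S R)) \<longleftrightarrow> ?Q"
  proof
    assume "rel_mem C x w (rel_comp C X Z W T (rel_comp C X Y Z S R))"
    then obtain B c z where c: "c \<in> hom C B A" "so_morphism C c" "z \<in> hom C B Z"
      "rel_mem C (x \<cdot> c) z (rel_comp C X Y Z S R)" "rel_mem C z (w \<cdot> c) T"
      unfolding T_SR(2)[OF x w] by blast
    then obtain D d y where d: "d \<in> hom C D B" "so_morphism C d" "y \<in> hom C D Y"
      "rel_mem C ((x \<cdot> c) \<cdot> d) y R" "rel_mem C y (z \<cdot> d) S"
      unfolding SR(2)[OF comp_hom[OF c(1) x] c(3)] by blast
    have "rel_mem C (z \<cdot> d) (w \<cdot> (c \<cdot> d)) T"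
      using rel_mem_comp[OF T c(3) comp_hom[OF c(1) w] c(5) d(1)] comp_assoc[OF d(1) c(1) w] by simp
    then show ?Q
      using comp_hom[OF d(1) c(1)] so_comp[OF d(2) c(2) d(1) c(1)] comp_hom[OF d(1) c(3)] d(3,4,5)
        comp_assoc[OF d(1) c(1) x] by metis
  next
    assume ?Q
    then obtain B c y z where "c \<in> hom C B A" "so_morphism C c" "y \<in> hom C B Y" "z \<in> hom C B Z"
      "rel_mem C (x \<cdot> c) y R" "rel_mem C y z S" "rel_mem C z (w \<cdot> c) T"
      by blast
    then show "rel_mem C x w (rel_comp C X Z W T (rel_comp C X Y Z S R))"
      unfolding T_SR(2)[OF x w] using rel_comp_intro[OF R S] comp_hom x by blast
  qed
  ultimately show "rel_mem C x w (rel_comp C X Y W (rel_comp C Y Z W T S) R) \<longleftrightarrow>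
      rel_mem C x w (rel_comp C X Z W T (rel_comp C X Y Z S R))"
    by blast
qed (fact X)+

text \<open>The elementwise form of the condition \<open>F \<Phi> E = \<Phi>\<close>.\<close>

definition bimodule :: "'o \<Rightarrow> 'm set \<Rightarrow> 'o \<Rightarrow> 'm set \<Rightarrow> 'm set \<Rightarrow> bool" where
  "bimodule X E Y F \<Phi> \<longleftrightarrow> \<Phi> \<in> relations C X Y \<and>
    (\<forall>A x x' y y'. x \<in> hom C A X \<longrightarrow> x' \<in> hom C A X \<longrightarrow> y \<in> hom C A Y \<longrightarrow> y' \<in> hom C A Y \<longrightarrow>
      rel_mem C x' x E \<longrightarrow> rel_mem C x y \<Phi> \<longrightarrow> rel_mem C y y' F \<longrightarrow> rel_mem C x' y' \<Phi>)"

lemma bimoduleD: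
  assumes "bimodule X E Y F \<Phi>"
  shows "\<Phi> \<in> relations C X Y"
    "\<lbrakk>x \<in> hom C A X; x' \<in> hom C A X; y \<in> hom C A Y; y' \<in> hom C A Y; rel_mem C x' x E;
      rel_mem C x y \<Phi>; rel_mem C y y' F\<rbrakk> \<Longrightarrow> rel_mem C x' y' \<Phi>"
    "\<lbrakk>congruence C Y F; x \<in> hom C A X; x' \<in> hom C A X; y \<in> hom C A Y; rel_mem C x' x E;
      rel_mem C x y \<Phi>\<rbrakk> \<Longrightarrow> rel_mem C x' y \<Phi>"
    "\<lbrakk>congruence C X E; x \<in> hom C A X; y \<in> hom C A Y; y' \<in> hom C A Y;
      rel_mem C x y \<Phi>; rel_mem C y y' F\<rbrakk> \<Longrightarrow> rel_mem C x y' \<Phi>"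
proof -
  show "\<Phi> \<in> relations C X Y"
    using assms by (simp add: bimodule_def)
  show *: "rel_mem C x' y' \<Phi>" if "x \<in> hom C A X" "x' \<in> hom C A X" "y \<in> hom C A Y" "y' \<in> hom C A Y"
    "rel_mem C x' x E" "rel_mem C x y \<Phi>" "rel_mem C y y' F" for x x' y y' A
    using assms that unfolding bimodule_def by blast
  show "rel_mem C x' y \<Phi>" if "congruence C Y F" "x \<in> hom C A X" "x' \<in> hom C A X" "y \<in> hom C A Y"
    "rel_mem C x' x E" "rel_mem C x y \<Phi>"
    using *[OF that(2-4,4-6) congruenceD(2)[OF that(1,4)]] .
  show "rel_mem C x y' \<Phi>" if "congruence C X E" "x \<in> hom C A X" "y \<in> hom C A Y" "y' \<in> hom C A Y"
    "rel_mem C x y \<Phi>" "rel_mem C y y' F"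
    using *[OF that(2,2-4) congruenceD(2)[OF that(1,2)] that(5,6)] .
qed

text \<open>One inclusion is reflexivity of the congruence, which supplies a trivial middle element.
  For the other, the middle element is absorbed over the cover and the result descends. Thus the
  congruences act as identities.\<close>

lemma rel_comp_congruence:
  assumes X: "X \<in> Obj C" "Y \<in> Obj C" and E: "congruence C X E" and F: "congruence C Y F"
    and m: "bimodule X E Y F \<Phi>"
  shows "rel_comp C X X Y \<Phi> E = \<Phi>" "rel_comp C X Y Y F \<Phi> = \<Phi>"
proof -
  note P = bimoduleD(1)[OF m]
  show "rel_comp C X X Y \<Phi> E = \<Phi>"
  proof (rule rel_eqI[OF X rel_comp(1)[OF X(1,1,2) congruenceD(1)[OF E] P] P])
    fix A x y
    assume x: "x \<in> hom C A X" and y: "y \<in> hom C A Y"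
    show "rel_mem C x y (rel_comp C X X Y \<Phi> E) \<longleftrightarrow> rel_mem C x y \<Phi>"
    proof
      assume "rel_mem C x y (rel_comp C X X Y \<Phi> E)"
      then obtain B c x' where c: "c \<in> hom C B A" "so_morphism C c" "x' \<in> hom C B X"
        "rel_mem C (x \<cdot> c) x' E" "rel_mem C x' (y \<cdot> c) \<Phi>"
        unfolding rel_comp(2)[OF X(1,1,2) congruenceD(1)[OF E] P x y] by blast
      then have "rel_mem C (x \<cdot> c) (y \<cdot> c) \<Phi>"
        using bimoduleD(3)[OF m F c(3)] comp_hom x y by blast
      then show "rel_mem C x y \<Phi>"
        by (rule rel_mem_descent[OF P x y c(1,2)])
    qed (rule rel_comp_intro[OF congruenceD(1)[OF E] P x x y congruenceD(2)[OF E x]])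
  qed
  show "rel_comp C X Y Y F \<Phi> = \<Phi>"
  proof (rule rel_eqI[OF X rel_comp(1)[OF X(1,2,2) P congruenceD(1)[OF F]] P])
    fix A x y
    assume x: "x \<in> hom C A X" and y: "y \<in> hom C A Y"
    show "rel_mem C x y (rel_comp C X Y Y F \<Phi>) \<longleftrightarrow> rel_mem C x y \<Phi>"
    proof
      assume "rel_mem C x y (rel_comp C X Y Y F \<Phi>)"
      then obtain B c y' where c: "c \<in> hom C B A" "so_morphism C c" "y' \<in> hom C B Y"
        "rel_mem C (x \<cdot> c) y' \<Phi>" "rel_mem C y' (y \<cdot> c) F"
        unfolding rel_comp(2)[OF X(1,2,2) P congruenceD(1)[OF F] x y] by blast
      then have "rel_mem C (x \<cdot> c) (y \<cdot> c) \<Phi>"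
        using bimoduleD(4)[OF m E] comp_hom x y by blast
      then show "rel_mem C x y \<Phi>"
        by (rule rel_mem_descent[OF P x y c(1,2)])
    next
      assume "rel_mem C x y \<Phi>"
      then show "rel_mem C x y (rel_comp C X Y Y F \<Phi>)"
        by (rule rel_comp_intro[OF P congruenceD(1)[OF F] x y y _ congruenceD(2)[OF F y]])
    qed
  qed
qed

lemma bimodule_iff:
  assumes X: "X \<in> Obj C" "Y \<in> Obj C" and E: "congruence C X E" and F: "congruence C Y F"
    and P: "\<Phi> \<in> relations C X Y"
  shows "rel_comp C X Y Y F (rel_comp C X X Y \<Phi> E) = \<Phi> \<longleftrightarrow> bimodule X E Y F \<Phi>"
proof
  assume eq: "rel_comp C X Y Y F (rel_comp C X X Y \<Phi> E) = \<Phi>"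
  note E' = congruenceD(1)[OF E] and F' = congruenceD(1)[OF F]
  show "bimodule X E Y F \<Phi>"
    unfolding bimodule_def
  proof (intro conjI P allI impI)
    fix A x x' y y'
    assume x: "x \<in> hom C A X" "x' \<in> hom C A X" and y: "y \<in> hom C A Y" "y' \<in> hom C A Y"
      and m: "rel_mem C x' x E" "rel_mem C x y \<Phi>" "rel_mem C y y' F"
    have "rel_mem C x' y' (rel_comp C X Y Y F (rel_comp C X X Y \<Phi> E))"
      using rel_comp_intro[OF rel_comp(1)[OF X(1,1,2) E' P] F' x(2) y
          rel_comp_intro[OF E' P x(2,1) y(1) m(1,2)] m(3)] .
    then show "rel_mem C x' y' \<Phi>"
      by (simp add: eq)
  qed
next
  assume "bimodule X E Y F \<Phi>"
  then show "rel_comp C X Y Y F (rel_comp C X X Y \<Phi> E) = \<Phi>"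
    using rel_comp_congruence[OF X E F] by simp
qed

lemma bimodule_comp:
  assumes X: "X \<in> Obj C" "Y \<in> Obj C" "Z \<in> Obj C"
    and E: "congruence C X E" and F: "congruence C Y F" and G: "congruence C Z G"
    and m: "bimodule X E Y F \<Phi>" and n: "bimodule Y F Z G \<Psi>"
  shows "bimodule X E Z G (rel_comp C X Y Z \<Psi> \<Phi>)"
  unfolding bimodule_def
proof (intro conjI allI impI)
  note c = rel_comp[OF X bimoduleD(1)[OF m] bimoduleD(1)[OF n]]
  show "rel_comp C X Y Z \<Psi> \<Phi> \<in> relations C X Z"
    by (fact c(1))
  fix A x x' z z'
  assume x: "x \<in> hom C A X" "x' \<in> hom C A X" and z: "z \<in> hom C A Z" "z' \<in> hom C A Z"
    and mem: "rel_mem C x' x E" "rel_mem C x z (rel_comp C X Y Z \<Psi> \<Phi>)" "rel_mem C z z' G"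
  obtain B b y where b: "b \<in> hom C B A" "so_morphism C b" "y \<in> hom C B Y"
    "rel_mem C (x \<cdot> b) y \<Phi>" "rel_mem C y (z \<cdot> b) \<Psi>"
    using mem(2) unfolding c(2)[OF x(1) z(1)] by blast
  have "rel_mem C (x' \<cdot> b) y \<Phi>"
    by (rule bimoduleD(3)[OF m F comp_hom[OF b(1) x(1)] comp_hom[OF b(1) x(2)] b(3)
          rel_mem_comp[OF congruenceD(1)[OF E] x(2,1) mem(1) b(1)] b(4)])
  moreover have "rel_mem C y (z' \<cdot> b) \<Psi>"
    by (rule bimoduleD(4)[OF n F b(3) comp_hom[OF b(1) z(1)] comp_hom[OF b(1) z(2)]
          b(5) rel_mem_comp[OF congruenceD(1)[OF G] z mem(3) b(1)]])
  ultimately show "rel_mem C x' z' (rel_comp C X Y Z \<Psi> \<Phi>)"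
    unfolding c(2)[OF x(2) z(2)] using b by blast
qed

lemma bimodule_congruence: "congruence C X E \<Longrightarrow> bimodule X E X E E"
  unfolding bimodule_def using congruenceD(1,3) by blast

lemma rel_comp_mono:
  assumes X: "X \<in> Obj C" "Y \<in> Obj C" "Z \<in> Obj C"
    and R: "R \<in> relations C X Y" "R' \<in> relations C X Y" "rel_le C R R'"
    and S: "S \<in> relations C Y Z" "S' \<in> relations C Y Z" "rel_le C S S'"
  shows "rel_le C (rel_comp C X Y Z S R) (rel_comp C X Y Z S' R')"
  unfolding rel_le_iff[OF X(1,3) rel_comp(1)[OF X R(1) S(1)] rel_comp(1)[OF X R(2) S(2)]]
proof (intro allI impI)
  fix A x z
  assume x: "x \<in> hom C A X" and z: "z \<in> hom C A Z" and "rel_mem C x z (rel_comp C X Y Z S R)"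
  then obtain B c y where c: "c \<in> hom C B A" "so_morphism C c" "y \<in> hom C B Y"
    "rel_mem C (x \<cdot> c) y R" "rel_mem C y (z \<cdot> c) S"
    unfolding rel_comp(2)[OF X R(1) S(1) x z] by blast
  then have "rel_mem C (x \<cdot> c) y R'" "rel_mem C y (z \<cdot> c) S'"
    using R(3) S(3) comp_hom[OF c(1) x] comp_hom[OF c(1) z]
    unfolding rel_le_iff[OF X(1,2) R(1,2)] rel_le_iff[OF X(2,3) S(1,2)] by blast+
  then show "rel_mem C x z (rel_comp C X Y Z S' R')"
    unfolding rel_comp(2)[OF X R(2) S(2) x z] using c by blast
qed

section \<open>Maps as relations with a right adjoint\<close>

definition map_pair :: "'o \<Rightarrow> 'm set \<Rightarrow> 'o \<Rightarrow> 'm set \<Rightarrow> 'm set \<Rightarrow> 'm set \<Rightarrow> bool" where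
  "map_pair X E Y F \<Phi> \<Psi> \<longleftrightarrow> bimodule X E Y F \<Phi> \<and> bimodule Y F X E \<Psi> \<and>
    (\<forall>A x. x \<in> hom C A X \<longrightarrow> (\<exists>B c y. c \<in> hom C B A \<and> so_morphism C c \<and> y \<in> hom C B Y \<and>
      rel_mem C (x \<cdot> c) y \<Phi> \<and> rel_mem C y (x \<cdot> c) \<Psi>)) \<and>
    (\<forall>A x y y'. x \<in> hom C A X \<longrightarrow> y \<in> hom C A Y \<longrightarrow> y' \<in> hom C A Y \<longrightarrow>
      rel_mem C y x \<Psi> \<longrightarrow> rel_mem C x y' \<Phi> \<longrightarrow> rel_mem C y y' F)"

text \<open>The unit becomes local totality and the counit single-valuedness up to \<open>F\<close>.
  The unit needs testing only at \<open>(x, x)\<close>, because \<open>\<Psi>\<close> absorbs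
  \<open>E\<close> and so a related \<open>x'\<close> can replace the second \<open>x\<close>; the
  counit needs testing only without covers, because membership in \<open>F\<close> descends.\<close>

lemma map_pair_iff:
  assumes X: "X \<in> Obj C" "Y \<in> Obj C" and E: "congruence C X E" and F: "congruence C Y F"
    and m: "bimodule X E Y F \<Phi>" and n: "bimodule Y F X E \<Psi>"
  shows "rel_le C E (rel_comp C X Y X \<Psi> \<Phi>) \<and> rel_le C (rel_comp C Y X Y \<Phi> \<Psi>) F \<longleftrightarrow>
    map_pair X E Y F \<Phi> \<Psi>" (is "?L \<longleftrightarrow> ?R")
proof -
  note P = bimoduleD(1)[OF m] and Q = bimoduleD(1)[OF n]
    and E' = congruenceD(1)[OF E] and F' = congruenceD(1)[OF F]
  note c = rel_comp[OF X(1,2,1) P Q] and d = rel_comp[OF X(2,1,2) Q P]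
  have "rel_le C E (rel_comp C X Y X \<Psi> \<Phi>) \<longleftrightarrow>
    (\<forall>A x. x \<in> hom C A X \<longrightarrow> (\<exists>B c y. c \<in> hom C B A \<and> so_morphism C c \<and> y \<in> hom C B Y \<and>
      rel_mem C (x \<cdot> c) y \<Phi> \<and> rel_mem C y (x \<cdot> c) \<Psi>))" (is "?l \<longleftrightarrow> ?r")
  proof
    assume ?l
    then show ?r
      unfolding rel_le_iff[OF X(1,1) E' c(1)] using congruenceD(2)[OF E] c(2) by blast
  next
    assume r: ?r
    show ?l
      unfolding rel_le_iff[OF X(1,1) E' c(1)]
    proof (intro allI impI)
      fix A x x'
      assume x: "x \<in> hom C A X" "x' \<in> hom C A X" and mem: "rel_mem C x x' E"
      obtain B b y where b: "b \<in> hom C B A" "so_morphism C b" "y \<in> hom C B Y"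
        "rel_mem C (x \<cdot> b) y \<Phi>" "rel_mem C y (x \<cdot> b) \<Psi>"
        using r x(1) by blast
      have "rel_mem C y (x' \<cdot> b) \<Psi>"
        by (rule bimoduleD(4)[OF n F b(3) comp_hom[OF b(1) x(1)] comp_hom[OF b(1) x(2)] b(5)
              rel_mem_comp[OF E' x mem b(1)]])
      then show "rel_mem C x x' (rel_comp C X Y X \<Psi> \<Phi>)"
        unfolding c(2)[OF x] using b by blast
    qed
  qed
  moreover have "rel_le C (rel_comp C Y X Y \<Phi> \<Psi>) F \<longleftrightarrow>
    (\<forall>A x y y'. x \<in> hom C A X \<longrightarrow> y \<in> hom C A Y \<longrightarrow> y' \<in> hom C A Y \<longrightarrow>
      rel_mem C y x \<Psi> \<longrightarrow> rel_mem C x y' \<Phi> \<longrightarrow> rel_mem C y y' F)" (is "?l \<longleftrightarrow> ?r")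
  proof
    assume ?l
    then show ?r
      unfolding rel_le_iff[OF X(2,2) d(1) F'] using rel_comp_intro[OF Q P] by blast
  next
    assume r: ?r
    show ?l
      unfolding rel_le_iff[OF X(2,2) d(1) F']
    proof (intro allI impI)
      fix A y y'
      assume y: "y \<in> hom C A Y" "y' \<in> hom C A Y" and "rel_mem C y y' (rel_comp C Y X Y \<Phi> \<Psi>)"
      then obtain B b x where b: "b \<in> hom C B A" "so_morphism C b" "x \<in> hom C B X"
        "rel_mem C (y \<cdot> b) x \<Psi>" "rel_mem C x (y' \<cdot> b) \<Phi>"
        unfolding d(2)[OF y] by blast
      then have "rel_mem C (y \<cdot> b) (y' \<cdot> b) F"
        using r comp_hom y by blast
      then show "rel_mem C y y' F"
        by (rule rel_mem_descent[OF F' y b(1,2)])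
    qed
  qed
  ultimately show ?thesis
    unfolding map_pair_def using m n by blast
qed

lemma Qw_hom_iff:
  "u \<in> hom (Qw C) (X, E) (Y, F) \<longleftrightarrow> X \<in> Obj C \<and> Y \<in> Obj C \<and> congruence C X E \<and> congruence C Y F \<and>
    (\<exists>\<Phi>. u = ((X, E), (Y, F), \<Phi>) \<and> bimodule X E Y F \<Phi>)"
proof -
  have "u \<in> hom (Qw C) (X, E) (Y, F) \<longleftrightarrow> X \<in> Obj C \<and> Y \<in> Obj C \<and> congruence C X E \<and> congruence C Y F \<and>
    (\<exists>\<Phi>. u = ((X, E), (Y, F), \<Phi>) \<and> \<Phi> \<in> relations C X Y \<and>
      rel_comp C X Y Y F (rel_comp C X X Y \<Phi> E) = \<Phi>)"
    by (auto simp: hom_def Qw_def)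
  then show ?thesis
    using bimodule_iff bimoduleD(1) by metis
qed

lemma ex_reg_simps [simp]:
  "Dom (ex_reg C) (P, Q, \<Phi>) = P" "Cod (ex_reg C) (P, Q, \<Phi>) = Q"
  "Ident (ex_reg C) P = (P, P, snd P)"
  "Comp (ex_reg C) (Q', S, \<Psi>) (P, Q, \<Phi>) = (P, S, rel_comp C (fst P) (fst Q) (fst S) \<Psi> \<Phi>)"
  "Le (ex_reg C) (P, Q, \<Phi>) (P', Q'', \<Phi>') = rel_le C \<Phi>' \<Phi>"
  "(X, E) \<in> Obj (ex_reg C) \<longleftrightarrow> X \<in> Obj C \<and> congruence C X E"
  by (auto simp: ex_reg_def Qw_def)

lemma has_right_adjoint_iff:
  assumes "X \<in> Obj C" "Y \<in> Obj C" "congruence C X E" "congruence C Y F" "bimodule X E Y F \<Phi>"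
  shows "has_right_adjoint (Qw C) ((X, E), (Y, F), \<Phi>) \<longleftrightarrow> (\<exists>\<Psi>. map_pair X E Y F \<Phi> \<Psi>)"
    (is "?L \<longleftrightarrow> ?R")
proof
  assume ?L
  then obtain g where g: "g \<in> hom (Qw C) (Y, F) (X, E)"
    and le: "Ident (Qw C) (X, E) \<preceq>\<^bsub>Qw C\<^esub> g \<cdot>\<^bsub>Qw C\<^esub> ((X, E), (Y, F), \<Phi>)"
      "((X, E), (Y, F), \<Phi>) \<cdot>\<^bsub>Qw C\<^esub> g \<preceq>\<^bsub>Qw C\<^esub> Ident (Qw C) (Y, F)"
    unfolding has_right_adjoint_def by (auto simp: Qw_def)
  obtain \<Psi> where "g = ((Y, F), (X, E), \<Psi>)" "bimodule Y F X E \<Psi>"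
    using g unfolding Qw_hom_iff by blast
  then show ?R
    using map_pair_iff[OF assms, of \<Psi>] le by (auto simp: Qw_def)
next
  assume ?R
  then obtain \<Psi> where m: "map_pair X E Y F \<Phi> \<Psi>"
    by blast
  then have n: "bimodule Y F X E \<Psi>"
    by (simp add: map_pair_def)
  have "((Y, F), (X, E), \<Psi>) \<in> hom (Qw C) (Y, F) (X, E)"
    unfolding Qw_hom_iff using assms n by blast
  moreover have "rel_le C E (rel_comp C X Y X \<Psi> \<Phi>)" "rel_le C (rel_comp C Y X Y \<Phi> \<Psi>) F"
    using map_pair_iff[OF assms n] m by auto
  ultimately show ?L
    unfolding has_right_adjoint_def by (intro bexI[of _ "((Y, F), (X, E), \<Psi>)"]) (simp_all add: Qw_def)
qed

lemma ex_reg_hom_iff: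
  "u \<in> hom (ex_reg C) (X, E) (Y, F) \<longleftrightarrow> X \<in> Obj C \<and> Y \<in> Obj C \<and> congruence C X E \<and> congruence C Y F \<and>
    (\<exists>\<Phi> \<Psi>. u = ((X, E), (Y, F), \<Phi>) \<and> map_pair X E Y F \<Phi> \<Psi>)" (is "_ \<longleftrightarrow> ?R")
proof -
  have "u \<in> hom (ex_reg C) (X, E) (Y, F) \<longleftrightarrow>
      u \<in> hom (Qw C) (X, E) (Y, F) \<and> has_right_adjoint (Qw C) u"
    by (auto simp: ex_reg_def hom_def)
  moreover have "?R" if u: "u \<in> hom (Qw C) (X, E) (Y, F)" "has_right_adjoint (Qw C) u"
    using u has_right_adjoint_iff unfolding Qw_hom_iff by metis
  moreover have "u \<in> hom (Qw C) (X, E) (Y, F) \<and> has_right_adjoint (Qw C) u" if r: ?R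
  proof -
    obtain \<Phi> \<Psi> where u: "u = ((X, E), (Y, F), \<Phi>)" and m: "map_pair X E Y F \<Phi> \<Psi>"
      using r by blast
    then have "bimodule X E Y F \<Phi>"
      by (simp add: map_pair_def)
    then show ?thesis
      using r m u has_right_adjoint_iff[of X Y E F \<Phi>] unfolding Qw_hom_iff by blast
  qed
  ultimately show ?thesis
    by blast
qed

lemma map_pair_identity:
  assumes "X \<in> Obj C" "congruence C X E"
  shows "map_pair X E X E E E"
proof -
  have "\<exists>B c y. c \<in> hom C B A \<and> so_morphism C c \<and> y \<in> hom C B X \<and>
      rel_mem C (x \<cdot> c) y E \<and> rel_mem C y (x \<cdot> c) E" if x: "x \<in> hom C A X" for A x
    using hom_Obj(1)[OF x] ident_hom so_ident x congruenceD(2)[OF assms(2) x] ident_right[OF x] by metis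
  then show ?thesis
    unfolding map_pair_def using bimodule_congruence[OF assms(2)] congruenceD(3)[OF assms(2)] by blast
qed

lemma map_pair_comp:
  assumes X: "X \<in> Obj C" "Y \<in> Obj C" "Z \<in> Obj C"
    and E: "congruence C X E" and F: "congruence C Y F" and G: "congruence C Z G"
    and m: "map_pair X E Y F \<Phi> \<Phi>'" and n: "map_pair Y F Z G \<Psi> \<Psi>'"
  shows "map_pair X E Z G (rel_comp C X Y Z \<Psi> \<Phi>) (rel_comp C Z Y X \<Phi>' \<Psi>')"
proof -
  have bm: "bimodule X E Y F \<Phi>" "bimodule Y F X E \<Phi>'" "bimodule Y F Z G \<Psi>" "bimodule Z G Y F \<Psi>'"
    using m n by (auto simp: map_pair_def)
  note rels = bm[THEN bimoduleD(1)]
  note c = rel_comp[OF X rels(1,3)] and c' = rel_comp[OF X(3,2,1) rels(4,2)]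
  have tot: "\<exists>B c z. c \<in> hom C B A \<and> so_morphism C c \<and> z \<in> hom C B Z \<and>
      rel_mem C (x \<cdot> c) z (rel_comp C X Y Z \<Psi> \<Phi>) \<and> rel_mem C z (x \<cdot> c) (rel_comp C Z Y X \<Phi>' \<Psi>')"
    if x: "x \<in> hom C A X" for A x
  proof -
    obtain B b y where b: "b \<in> hom C B A" "so_morphism C b" "y \<in> hom C B Y"
      "rel_mem C (x \<cdot> b) y \<Phi>" "rel_mem C y (x \<cdot> b) \<Phi>'"
      using m x unfolding map_pair_def by blast
    obtain D d z where d: "d \<in> hom C D B" "so_morphism C d" "z \<in> hom C D Z"
      "rel_mem C (y \<cdot> d) z \<Psi>" "rel_mem C z (y \<cdot> d) \<Psi>'"
      using n b(3) unfolding map_pair_def by blast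
    note xb = comp_hom[OF b(1) x]
    have "rel_mem C ((x \<cdot> b) \<cdot> d) z (rel_comp C X Y Z \<Psi> \<Phi>)"
      "rel_mem C z ((x \<cdot> b) \<cdot> d) (rel_comp C Z Y X \<Phi>' \<Psi>')"
      using rel_comp_intro[OF rels(1,3) comp_hom[OF d(1) xb] comp_hom[OF d(1) b(3)] d(3)
          rel_mem_comp[OF rels(1) xb b(3,4) d(1)] d(4)]
        rel_comp_intro[OF rels(4,2) d(3) comp_hom[OF d(1) b(3)] comp_hom[OF d(1) xb] d(5)
          rel_mem_comp[OF rels(2) b(3) xb b(5) d(1)]] by auto
    then show ?thesis
      using comp_assoc[OF d(1) b(1) x] comp_hom[OF d(1) b(1)] so_comp[OF d(2) b(2) d(1) b(1)] d(3)
      by metis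
  qed
  have sgl: "rel_mem C z z' G" if x: "x \<in> hom C A X" and z: "z \<in> hom C A Z" "z' \<in> hom C A Z"
    and mem: "rel_mem C z x (rel_comp C Z Y X \<Phi>' \<Psi>')" "rel_mem C x z' (rel_comp C X Y Z \<Psi> \<Phi>)"
    for A x z z'
  proof -
    obtain B1 c1 y1 where c1: "c1 \<in> hom C B1 A" "so_morphism C c1" "y1 \<in> hom C B1 Y"
      "rel_mem C (z \<cdot> c1) y1 \<Psi>'" "rel_mem C y1 (x \<cdot> c1) \<Phi>'"
      using mem(1) unfolding c'(2)[OF z(1) x] by blast
    obtain B2 c2 y2 where c2: "c2 \<in> hom C B2 A" "so_morphism C c2" "y2 \<in> hom C B2 Y"
      "rel_mem C (x \<cdot> c2) y2 \<Phi>" "rel_mem C y2 (z' \<cdot> c2) \<Psi>"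
      using mem(2) unfolding c(2)[OF x z(2)] by blast
    \<comment> \<open>The witnesses \<open>y1\<close> and \<open>y2\<close> are found over different
      covers, so they are compared over a common refinement.\<close>
    obtain B d1 d2 where d: "d1 \<in> hom C B B1" "so_morphism C d1" "d2 \<in> hom C B B2"
      "c1 \<cdot> d1 = c2 \<cdot> d2" "c1 \<cdot> d1 \<in> hom C B A" "so_morphism C (c1 \<cdot> d1)"
      using common_cover[OF c1(1,2) c2(1,2)] .
    have a1: "(w \<cdot> c1) \<cdot> d1 = w \<cdot> (c1 \<cdot> d1)" and a2: "(w \<cdot> c2) \<cdot> d2 = w \<cdot> (c1 \<cdot> d1)"
      if "w \<in> hom C A W" for w W
      using comp_assoc[OF d(1) c1(1) that] comp_assoc[OF d(3) c2(1) that] d(4) by auto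
    have zh: "z \<cdot> (c1 \<cdot> d1) \<in> hom C B Z" "z' \<cdot> (c1 \<cdot> d1) \<in> hom C B Z"
      and xh: "x \<cdot> (c1 \<cdot> d1) \<in> hom C B X"
      and yh: "y1 \<cdot> d1 \<in> hom C B Y" "y2 \<cdot> d2 \<in> hom C B Y"
      using comp_hom[OF d(5) z(1)] comp_hom[OF d(5) z(2)] comp_hom[OF d(5) x]
        comp_hom[OF d(1) c1(3)] comp_hom[OF d(3) c2(3)] .
    have m1: "rel_mem C (z \<cdot> (c1 \<cdot> d1)) (y1 \<cdot> d1) \<Psi>'" "rel_mem C (y1 \<cdot> d1) (x \<cdot> (c1 \<cdot> d1)) \<Phi>'"
      using rel_mem_comp[OF rels(4) comp_hom[OF c1(1) z(1)] c1(3,4) d(1)]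
        rel_mem_comp[OF rels(2) c1(3) comp_hom[OF c1(1) x] c1(5) d(1)] a1[OF z(1)] a1[OF x] by auto
    have m2: "rel_mem C (x \<cdot> (c1 \<cdot> d1)) (y2 \<cdot> d2) \<Phi>" "rel_mem C (y2 \<cdot> d2) (z' \<cdot> (c1 \<cdot> d1)) \<Psi>"
      using rel_mem_comp[OF rels(1) comp_hom[OF c2(1) x] c2(3,4) d(3)]
        rel_mem_comp[OF rels(3) c2(3) comp_hom[OF c2(1) z(2)] c2(5) d(3)] a2[OF z(2)] a2[OF x] by auto
    \<comment> \<open>Single-valuedness of \<open>\<Phi>\<close> relates the two middle elements,
      \<open>\<Psi>\<close> absorbs this relation, and single-valuedness of \<open>\<Psi>\<close>
      finishes.\<close>
    have "rel_mem C (y1 \<cdot> d1) (y2 \<cdot> d2) F"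
      using m xh yh m1(2) m2(1) unfolding map_pair_def by blast
    then have "rel_mem C (y1 \<cdot> d1) (z' \<cdot> (c1 \<cdot> d1)) \<Psi>"
      using bimoduleD(3)[OF bm(3) G yh(2,1) zh(2)] m2(2) by blast
    then have "rel_mem C (z \<cdot> (c1 \<cdot> d1)) (z' \<cdot> (c1 \<cdot> d1)) G"
      using n yh(1) zh m1(1) unfolding map_pair_def by blast
    then show ?thesis
      by (rule rel_mem_descent[OF congruenceD(1)[OF G] z d(5,6)])
  qed
  show ?thesis
    unfolding map_pair_def using bimodule_comp[OF X E F G bm(1,3)] bimodule_comp[OF X(3,2,1) G F E bm(4,2)]
      tot sgl by blast
qed

lemma ex_reg_homE:
  assumes "u \<in> hom (ex_reg C) P Q"
  obtains X E Y F \<Phi> \<Psi> where "P = (X, E)" "Q = (Y, F)" "u = ((X, E), (Y, F), \<Phi>)"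
    "X \<in> Obj C" "Y \<in> Obj C" "congruence C X E" "congruence C Y F" "map_pair X E Y F \<Phi> \<Psi>"
    "bimodule X E Y F \<Phi>" "\<Phi> \<in> relations C X Y"
proof -
  obtain X E Y F where PQ: "P = (X, E)" "Q = (Y, F)"
    by (metis surj_pair)
  then obtain \<Phi> \<Psi> where u: "u = ((X, E), (Y, F), \<Phi>)" "X \<in> Obj C" "Y \<in> Obj C" "congruence C X E"
    "congruence C Y F" "map_pair X E Y F \<Phi> \<Psi>"
    using assms unfolding PQ ex_reg_hom_iff by blast
  then have "bimodule X E Y F \<Phi>"
    by (simp add: map_pair_def)
  then show ?thesis
    using that[OF PQ u _ bimoduleD(1)] by blast
qed

lemma pos_category_ex_reg: "pos_category (ex_reg C)"
proof
  fix f
  assume "f \<in> Arr (ex_reg C)"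
  then have "f \<in> hom (ex_reg C) (Dom (ex_reg C) f) (Cod (ex_reg C) f)"
    by (simp add: hom_def)
  then show "Dom (ex_reg C) f \<in> Obj (ex_reg C) \<and> Cod (ex_reg C) f \<in> Obj (ex_reg C)"
    by (elim ex_reg_homE) simp
next
  fix P
  assume "P \<in> Obj (ex_reg C)"
  then show "Ident (ex_reg C) P \<in> hom (ex_reg C) P P"
    by (cases P) (auto simp: ex_reg_hom_iff intro!: exI map_pair_identity)
next
  fix f g P Q S
  assume f: "f \<in> hom (ex_reg C) P Q" and g: "g \<in> hom (ex_reg C) Q S"
  show "g \<star> f \<in> hom (ex_reg C) P S"
    using f g by (elim ex_reg_homE) (simp add: ex_reg_hom_iff, intro exI, rule map_pair_comp, auto)
next
  fix f P Q
  assume f: "f \<in> hom (ex_reg C) P Q"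
  show "Ident (ex_reg C) Q \<star> f = f" "f \<star> Ident (ex_reg C) P = f"
    using f by (elim ex_reg_homE; simp add: rel_comp_congruence)+
next
  fix f g h P Q S T
  assume f: "f \<in> hom (ex_reg C) P Q" and g: "g \<in> hom (ex_reg C) Q S" and h: "h \<in> hom (ex_reg C) S T"
  show "(h \<star> g) \<star> f = h \<star> (g \<star> f)"
    using f g h by (elim ex_reg_homE) (simp add: rel_comp_assoc)
next
  fix f P Q
  assume f: "f \<in> hom (ex_reg C) P Q"
  then show "f \<unlhd> f"
    by (elim ex_reg_homE) (simp add: rel_le_iff)
next
  fix f g h P Q
  assume f: "f \<in> hom (ex_reg C) P Q" and g: "g \<in> hom (ex_reg C) P Q" and h: "h \<in> hom (ex_reg C) P Q"
    and le: "f \<unlhd> g" "g \<unlhd> h"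
  show "f \<unlhd> h"
    using f g h le by (elim ex_reg_homE) (simp add: rel_le_iff)
next
  fix f g P Q
  assume f: "f \<in> hom (ex_reg C) P Q" and g: "g \<in> hom (ex_reg C) P Q"
    and le: "f \<unlhd> g" "g \<unlhd> f"
  show "f = g"
    using f g le by (elim ex_reg_homE) (simp add: rel_le_iff, intro rel_eqI, auto)
next
  fix f f' g g' P Q S
  assume f: "f \<in> hom (ex_reg C) P Q" "f' \<in> hom (ex_reg C) P Q"
    and g: "g \<in> hom (ex_reg C) Q S" "g' \<in> hom (ex_reg C) Q S"
    and le: "f \<unlhd> f'" "g \<unlhd> g'"
  show "g \<star> f \<unlhd> g' \<star> f'"
    using f g le by (elim ex_reg_homE) (simp add: rel_comp_mono)
qed

end

section \<open>Presentations of maps\<close>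

context reg_cat
begin

text \<open>A map of \<open>ex_reg C\<close> from \<open>(X, E)\<close> to \<open>(Y, F)\<close> is represented by an \<open>so\<close>-morphism \<open>p\<close> into \<open>X\<close> and
  a morphism \<open>y\<close> into \<open>Y\<close> on the same domain: the class of \<open>p a\<close> is sent to the class of \<open>y a\<close>.\<close>

definition presents :: "'o \<Rightarrow> 'm \<Rightarrow> 'm \<Rightarrow> 'o \<Rightarrow> 'o \<Rightarrow> 'm set \<Rightarrow> 'm set \<Rightarrow> bool" where
  "presents A p y X Y F \<Phi> \<longleftrightarrow> p \<in> hom C A X \<and> so_morphism C p \<and> y \<in> hom C A Y \<and>
    (\<forall>B a y'. a \<in> hom C B A \<longrightarrow> y' \<in> hom C B Y \<longrightarrow>
      (rel_mem C (p \<cdot> a) y' \<Phi> \<longleftrightarrow> rel_mem C (y \<cdot> a) y' F))"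

lemma presentsD:
  assumes "presents A p y X Y F \<Phi>"
  shows "p \<in> hom C A X" "so_morphism C p" "y \<in> hom C A Y"
    "\<lbrakk>a \<in> hom C B A; y' \<in> hom C B Y\<rbrakk> \<Longrightarrow> rel_mem C (p \<cdot> a) y' \<Phi> \<longleftrightarrow> rel_mem C (y \<cdot> a) y' F"
  using assms unfolding presents_def by blast+

text \<open>Totality is applied to the generic element \<open>Ident C X\<close>: its local value is
  \<open>y\<close>, over a cover \<open>p\<close> of \<open>X\<close> itself. The two memberships
  then say that the values of \<open>\<Phi>\<close> at \<open>p a\<close> are exactly the elements
  above \<open>y a\<close> under \<open>F\<close>.\<close>

lemma presentation_exists:
  assumes X: "X \<in> Obj C" and E: "congruence C X E" and F: "congruence C Y F"
    and m: "map_pair X E Y F \<Phi> \<Psi>"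
  obtains A p y where "presents A p y X Y F \<Phi>"
proof -
  have b: "bimodule X E Y F \<Phi>" "bimodule Y F X E \<Psi>"
    using m by (auto simp: map_pair_def)
  obtain A p y where p: "p \<in> hom C A X" "so_morphism C p" and y: "y \<in> hom C A Y"
    and mem: "rel_mem C (Ident C X \<cdot> p) y \<Phi>" "rel_mem C y (Ident C X \<cdot> p) \<Psi>"
    using m ident_hom[OF X] unfolding map_pair_def by blast
  note mem' = mem[unfolded ident_left[OF p(1)]]
  have "rel_mem C (p \<cdot> a) y' \<Phi> \<longleftrightarrow> rel_mem C (y \<cdot> a) y' F"
    if a: "a \<in> hom C B A" and y': "y' \<in> hom C B Y" for B a y'
  proof
    note h = comp_hom[OF a p(1)] comp_hom[OF a y]
    show "rel_mem C (y \<cdot> a) y' F" if "rel_mem C (p \<cdot> a) y' \<Phi>"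
      using m h y' that rel_mem_comp[OF bimoduleD(1)[OF b(2)] y p(1) mem'(2) a]
      unfolding map_pair_def by blast
    show "rel_mem C (p \<cdot> a) y' \<Phi>" if "rel_mem C (y \<cdot> a) y' F"
      by (rule bimoduleD(4)[OF b(1) E h y' rel_mem_comp[OF bimoduleD(1)[OF b(1)] p(1) y mem'(1) a] that])
  qed
  then show ?thesis
    using that p y unfolding presents_def by blast
qed

lemma presents_refine:
  assumes pr: "presents A p y X Y F \<Phi>" and c: "c \<in> hom C B A" "so_morphism C c"
  shows "presents B (p \<cdot> c) (y \<cdot> c) X Y F \<Phi>"
proof -
  note p = presentsD(1-3)[OF pr]
  have "rel_mem C ((p \<cdot> c) \<cdot> a) y' \<Phi> \<longleftrightarrow> rel_mem C ((y \<cdot> c) \<cdot> a) y' F"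
    if a: "a \<in> hom C D B" and y': "y' \<in> hom C D Y" for D a y'
    unfolding comp_assoc[OF a c(1) p(1)] comp_assoc[OF a c(1) p(3)]
    by (rule presentsD(4)[OF pr comp_hom[OF a c(1)] y'])
  then show ?thesis
    unfolding presents_def using comp_hom[OF c(1) p(1)] comp_hom[OF c(1) p(3)] so_comp[OF c(2) p(2) c(1) p(1)]
    by blast
qed

lemma common_presentation:
  assumes p: "presents A p y X Y F \<Phi>" and q: "presents B q z X Z G \<Psi>"
  obtains T r y' z' where "presents T r y' X Y F \<Phi>" "presents T r z' X Z G \<Psi>"
proof -
  note pp = presentsD(1,2)[OF p] and qq = presentsD(1,2)[OF q]
  obtain T d1 d2 where d: "d1 \<in> hom C T A" "so_morphism C d1" "d2 \<in> hom C T B" "p \<cdot> d1 = q \<cdot> d2"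
    and "so_morphism C d2"
  proof -
    obtain P p0 p1 where pb: "is_pullback C p q p0 p1" "p0 \<in> hom C P A" "p1 \<in> hom C P B" "p \<cdot> p0 = q \<cdot> p1"
      using pullbackE[OF pp(1) qq(1)] .
    \<comment> \<open>Both legs have to be covers, as both presentations get refined; hence the
      pullback square is used in both orientations.\<close>
    have "is_pullback C q p p1 p0"
      using pb(1) unfolding is_pullback_def jointly_order_mono_def by metis
    then show ?thesis
      using that pb so_stable pp(2) qq(2) by blast
  qed
  then show ?thesis
    using that presents_refine[OF p d(1,2)] presents_refine[OF q d(3)] by metis
qed

text \<open>Well-definedness on classes: \<open>y b\<close> is a value at \<open>p b\<close>, hence
  also at \<open>p a\<close> because \<open>\<Phi>\<close> absorbs \<open>E\<close>, and the values
  at \<open>p a\<close> are those above \<open>y a\<close>.\<close>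

lemma presents_kernel:
  assumes E: "congruence C X E" and F: "congruence C Y F" and m: "bimodule X E Y F \<Phi>"
    and pr: "presents A p y X Y F \<Phi>"
    and ab: "a \<in> hom C B A" "b \<in> hom C B A" and k: "rel_mem C (p \<cdot> a) (p \<cdot> b) E"
  shows "rel_mem C (y \<cdot> a) (y \<cdot> b) F"
proof -
  note p = presentsD(1-3)[OF pr]
  note yb = comp_hom[OF ab(2) p(3)]
  have "rel_mem C (p \<cdot> b) (y \<cdot> b) \<Phi>"
    using presentsD(4)[OF pr ab(2) yb] congruenceD(2)[OF F yb] by simp
  then have "rel_mem C (p \<cdot> a) (y \<cdot> b) \<Phi>"
    using bimoduleD(3)[OF m F comp_hom[OF ab(2) p(1)] comp_hom[OF ab(1) p(1)] yb k] by simp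
  then show ?thesis
    using presentsD(4)[OF pr ab(1) yb] by simp
qed

text \<open>The values at \<open>p a\<close> form the up-set of \<open>y a\<close>, so a larger map
  has a smaller relation; this is why the order of \<open>ex_reg\<close> reverses inclusion.
  Evaluation at the generic element of \<open>A\<close> gives one direction, local lifting along
  \<open>p\<close> the other.\<close>

lemma presents_le:
  assumes X: "X \<in> Obj C" "Y \<in> Obj C" and F: "congruence C Y F"
    and m: "\<Phi> \<in> relations C X Y" "\<Phi>' \<in> relations C X Y"
    and pr: "presents A p y X Y F \<Phi>" "presents A p y' X Y F \<Phi>'"
  shows "rel_le C \<Phi>' \<Phi> \<longleftrightarrow> rel_mem C y y' F"
proof
  note p = presentsD(1-3)[OF pr(1)] and p' = presentsD(1-3)[OF pr(2)]
  have A: "A \<in> Obj C"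
    using hom_Obj p by blast
  note i = ident_hom[OF A]
  {
    assume "rel_le C \<Phi>' \<Phi>"
    moreover have "rel_mem C (p \<cdot> Ident C A) y' \<Phi>'"
      unfolding presentsD(4)[OF pr(2) i p'(3)] ident_right[OF p'(3)] by (rule congruenceD(2)[OF F p'(3)])
    ultimately have "rel_mem C (p \<cdot> Ident C A) y' \<Phi>"
      unfolding rel_le_iff[OF X m(2,1)] using comp_hom[OF i p(1)] p'(3) by blast
    then show "rel_mem C y y' F"
      unfolding presentsD(4)[OF pr(1) i p'(3)] ident_right[OF p(3)] .
  }
  assume le: "rel_mem C y y' F"
  show "rel_le C \<Phi>' \<Phi>"
    unfolding rel_le_iff[OF X m(2,1)]
  proof (intro allI impI)
    fix T x z
    assume x: "x \<in> hom C T X" and z: "z \<in> hom C T Y" and mem: "rel_mem C x z \<Phi>'"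
    obtain B c a where c: "c \<in> hom C B T" "so_morphism C c" "a \<in> hom C B A" "x \<cdot> c = p \<cdot> a"
      using lift_along_so[OF p(2,1) x] .
    note zc = comp_hom[OF c(1) z]
    have "rel_mem C (p \<cdot> a) (z \<cdot> c) \<Phi>'"
      using rel_mem_comp[OF m(2) x z mem c(1)] c(4) by simp
    then have "rel_mem C (y' \<cdot> a) (z \<cdot> c) F"
      unfolding presentsD(4)[OF pr(2) c(3) zc] .
    then have "rel_mem C (y \<cdot> a) (z \<cdot> c) F"
      by (rule congruenceD(3)[OF F comp_hom[OF c(3) p(3)] comp_hom[OF c(3) p'(3)] zc
            rel_mem_comp[OF congruenceD(1)[OF F] p(3) p'(3) le c(3)]])
    then have "rel_mem C (x \<cdot> c) (z \<cdot> c) \<Phi>"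
      using presentsD(4)[OF pr(1) c(3) zc] c(4) by simp
    then show "rel_mem C x z \<Phi>"
      by (rule rel_mem_descent[OF m(1) x z c(1,2)])
  qed
qed

lemma presents_unique:
  assumes X: "X \<in> Obj C" "Y \<in> Obj C" and F: "congruence C Y F"
    and m: "\<Phi> \<in> relations C X Y" "\<Phi>' \<in> relations C X Y"
    and pr: "presents A p y X Y F \<Phi>" "presents A p y X Y F \<Phi>'"
  shows "\<Phi> = \<Phi>'"
proof (rule rel_eqI[OF X m])
  have "rel_mem C y y F"
    using presentsD(3)[OF pr(1)] congruenceD(2)[OF F] by blast
  then show "rel_mem C x z \<Phi> \<longleftrightarrow> rel_mem C x z \<Phi>'" if "x \<in> hom C B X" "z \<in> hom C B Y" for B x z
    using presents_le[OF X F m pr] presents_le[OF X F m(2,1) pr(2,1)] that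
    unfolding rel_le_iff[OF X m] rel_le_iff[OF X m(2,1)] by blast
qed

text \<open>Assumption \<open>eq\<close> says that the values of \<open>\<Psi>\<close> at
  \<open>y a\<close> are those above \<open>z a\<close>. It stands in for a presentation of
  \<open>\<Psi>\<close>, because \<open>y\<close> is in general not a cover.\<close>

lemma presents_comp:
  assumes X: "X \<in> Obj C" "Y \<in> Obj C" "Z \<in> Obj C"
    and F: "congruence C Y F" and G: "congruence C Z G"
    and m: "\<Phi> \<in> relations C X Y" and n: "bimodule Y F Z G \<Psi>"
    and pr: "presents A p y X Y F \<Phi>" and z: "z \<in> hom C A Z"
    and eq: "\<And>B a z'. \<lbrakk>a \<in> hom C B A; z' \<in> hom C B Z\<rbrakk> \<Longrightarrow>
      rel_mem C (y \<cdot> a) z' \<Psi> \<longleftrightarrow> rel_mem C (z \<cdot> a) z' G"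
  shows "presents A p z X Z G (rel_comp C X Y Z \<Psi> \<Phi>)"
proof -
  note p = presentsD(1-3)[OF pr]
  note c = rel_comp(2)[OF X m bimoduleD(1)[OF n]]
  have "rel_mem C (p \<cdot> a) w (rel_comp C X Y Z \<Psi> \<Phi>) \<longleftrightarrow> rel_mem C (z \<cdot> a) w G"
    if a: "a \<in> hom C B A" and w: "w \<in> hom C B Z" for B a w
    unfolding eq[OF a w, symmetric]
  proof
    note pa = comp_hom[OF a p(1)] and ya = comp_hom[OF a p(3)]
    show "rel_mem C (y \<cdot> a) w \<Psi>" if mem: "rel_mem C (p \<cdot> a) w (rel_comp C X Y Z \<Psi> \<Phi>)"
    proof -
      obtain T d v where d: "d \<in> hom C T B" "so_morphism C d" "v \<in> hom C T Y"
        "rel_mem C ((p \<cdot> a) \<cdot> d) v \<Phi>" "rel_mem C v (w \<cdot> d) \<Psi>"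
        using mem unfolding c[OF pa w] by blast
      have "rel_mem C ((y \<cdot> a) \<cdot> d) v F"
        using d(4) presentsD(4)[OF pr comp_hom[OF d(1) a] d(3)]
        unfolding comp_assoc[OF d(1) a p(1)] comp_assoc[OF d(1) a p(3)] by simp
      then have "rel_mem C ((y \<cdot> a) \<cdot> d) (w \<cdot> d) \<Psi>"
        using bimoduleD(3)[OF n G d(3) comp_hom[OF d(1) ya] comp_hom[OF d(1) w]] d(5) by blast
      then show ?thesis
        by (rule rel_mem_descent[OF bimoduleD(1)[OF n] ya w d(1,2)])
    qed
    show "rel_mem C (p \<cdot> a) w (rel_comp C X Y Z \<Psi> \<Phi>)" if "rel_mem C (y \<cdot> a) w \<Psi>"
      using rel_comp_intro[OF m bimoduleD(1)[OF n] pa ya w _ that]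
        presentsD(4)[OF pr a ya] congruenceD(2)[OF F ya] by blast
  qed
  then show ?thesis
    unfolding presents_def using p z by blast
qed

text \<open>The restrictions of \<open>E\<close> along \<open>p\<close> in one variable are
  composites of \<open>E\<close> with the comma relations of \<open>p\<close> and the identity. The
  inequality that the comma relation introduces is absorbed because \<open>E\<close> is
  weakening-closed.\<close>

lemma congruence_pullback:
  assumes X: "X \<in> Obj C" and E: "congruence C X E" and p: "p \<in> hom C A X"
  obtains R R' where "R \<in> relations C X A" "R' \<in> relations C A X"
    "\<And>B x a. \<lbrakk>x \<in> hom C B X; a \<in> hom C B A\<rbrakk> \<Longrightarrow> rel_mem C x a R \<longleftrightarrow> rel_mem C x (p \<cdot> a) E"
    "\<And>B x a. \<lbrakk>x \<in> hom C B X; a \<in> hom C B A\<rbrakk> \<Longrightarrow> rel_mem C a x R' \<longleftrightarrow> rel_mem C (p \<cdot> a) x E"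
proof -
  have A: "A \<in> Obj C"
    using hom_Obj p by blast
  note i = ident_hom[OF X] and E' = congruenceD(1)[OF E]
  note l = comma_rel[OF i p] and l' = comma_rel[OF p i]
  let ?R = "rel_comp C X X A (comma_rel C (Ident C X) p) E"
    and ?R' = "rel_comp C A X X E (comma_rel C p (Ident C X))"
  note c = rel_comp[OF X X A E' l(1)] and c' = rel_comp[OF A X X l'(1) E']
  have "rel_mem C x a ?R \<longleftrightarrow> rel_mem C x (p \<cdot> a) E" if x: "x \<in> hom C B X" and a: "a \<in> hom C B A" for B x a
  proof
    note pa = comp_hom[OF a p]
    show "rel_mem C x (p \<cdot> a) E" if mem: "rel_mem C x a ?R"
    proof -
      obtain T d x' where d: "d \<in> hom C T B" "so_morphism C d" "x' \<in> hom C T X"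
        "rel_mem C (x \<cdot> d) x' E" "rel_mem C x' (a \<cdot> d) (comma_rel C (Ident C X) p)"
        using mem unfolding c(2)[OF x a] by blast
      have "x' \<preceq> (p \<cdot> a) \<cdot> d"
        using d(5) unfolding l(2)[OF d(3) comp_hom[OF d(1) a]] ident_left[OF d(3)] comp_assoc[OF d(1) a p] .
      then have "rel_mem C (x \<cdot> d) ((p \<cdot> a) \<cdot> d) E"
        using congruenceD(4)[OF E _ _ d(3) _ _ d(4)] comp_hom[OF d(1) x] comp_hom[OF d(1) pa]
          le_refl by blast
      then show ?thesis
        by (rule rel_mem_descent[OF E' x pa d(1,2)])
    qed
    show "rel_mem C x a ?R" if "rel_mem C x (p \<cdot> a) E"
      by (rule rel_comp_intro[OF E' l(1) x pa a that])
        (simp add: l(2)[OF pa a] ident_left[OF pa] le_refl[OF pa])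
  qed
  moreover have "rel_mem C a x ?R' \<longleftrightarrow> rel_mem C (p \<cdot> a) x E"
    if x: "x \<in> hom C B X" and a: "a \<in> hom C B A" for B x a
  proof
    note pa = comp_hom[OF a p]
    show "rel_mem C (p \<cdot> a) x E" if mem: "rel_mem C a x ?R'"
    proof -
      obtain T d x' where d: "d \<in> hom C T B" "so_morphism C d" "x' \<in> hom C T X"
        "rel_mem C (a \<cdot> d) x' (comma_rel C p (Ident C X))" "rel_mem C x' (x \<cdot> d) E"
        using mem unfolding c'(2)[OF a x] by blast
      have "(p \<cdot> a) \<cdot> d \<preceq> x'"
        using d(4) unfolding l'(2)[OF comp_hom[OF d(1) a] d(3)] ident_left[OF d(3)] comp_assoc[OF d(1) a p] .
      then have "rel_mem C ((p \<cdot> a) \<cdot> d) (x \<cdot> d) E"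
        using congruenceD(4)[OF E d(3) _ _ _ _ d(5)] comp_hom[OF d(1) x] comp_hom[OF d(1) pa]
          le_refl by blast
      then show ?thesis
        by (rule rel_mem_descent[OF E' pa x d(1,2)])
    qed
    show "rel_mem C a x ?R'" if "rel_mem C (p \<cdot> a) x E"
      by (rule rel_comp_intro[OF l'(1) E' a pa x _ that])
        (simp add: l'(2)[OF a pa] ident_left[OF pa] le_refl[OF pa])
  qed
  ultimately show ?thesis
    using that[OF c(1) c'(1)] by blast
qed

text \<open>With \<open>a\<close> existentially quantified, the condition is a composite through
  \<open>A\<close> of two one-sided restrictions of the congruences, and so defines a relation.
  Transitivity of \<open>E\<close> and \<open>F\<close> makes it a bimodule.\<close>

lemma span_bimodule:
  assumes X: "X \<in> Obj C" "Y \<in> Obj C" and E: "congruence C X E" and F: "congruence C Y F"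
    and p: "p \<in> hom C A X" and y: "y \<in> hom C A Y"
  obtains \<Phi> where "bimodule X E Y F \<Phi>"
    "\<forall>T x z. x \<in> hom C T X \<longrightarrow> z \<in> hom C T Y \<longrightarrow> (rel_mem C x z \<Phi> \<longleftrightarrow>
      (\<exists>B c a. c \<in> hom C B T \<and> so_morphism C c \<and> a \<in> hom C B A \<and>
        rel_mem C (x \<cdot> c) (p \<cdot> a) E \<and> rel_mem C (y \<cdot> a) (z \<cdot> c) F))"
proof -
  note E' = congruenceD(1)[OF E] and F' = congruenceD(1)[OF F]
  have A: "A \<in> Obj C"
    using hom_Obj p by blast
  obtain R where R: "R \<in> relations C X A"
    and mR: "\<And>B x a. \<lbrakk>x \<in> hom C B X; a \<in> hom C B A\<rbrakk> \<Longrightarrow> rel_mem C x a R \<longleftrightarrow> rel_mem C x (p \<cdot> a) E"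
    by (rule congruence_pullback[OF X(1) E p]) blast
  obtain S where S: "S \<in> relations C A Y"
    and mS: "\<And>B x a. \<lbrakk>x \<in> hom C B Y; a \<in> hom C B A\<rbrakk> \<Longrightarrow> rel_mem C a x S \<longleftrightarrow> rel_mem C (y \<cdot> a) x F"
    by (rule congruence_pullback[OF X(2) F y]) blast
  define \<Phi> where "\<Phi> = rel_comp C X A Y S R"
  note c = rel_comp[OF X(1) A X(2) R S, folded \<Phi>_def]
  have mem: "rel_mem C x z \<Phi> \<longleftrightarrow> (\<exists>B c a. c \<in> hom C B T \<and> so_morphism C c \<and> a \<in> hom C B A \<and>
      rel_mem C (x \<cdot> c) (p \<cdot> a) E \<and> rel_mem C (y \<cdot> a) (z \<cdot> c) F)"
    if x: "x \<in> hom C T X" and z: "z \<in> hom C T Y" for T x z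
    unfolding c(2)[OF x z] using mR[OF comp_hom[OF _ x]] mS[OF comp_hom[OF _ z]] by blast
  have "bimodule X E Y F \<Phi>"
    unfolding bimodule_def
  proof (intro conjI c(1) allI impI)
    fix T x x' z z'
    assume x: "x \<in> hom C T X" "x' \<in> hom C T X" and z: "z \<in> hom C T Y" "z' \<in> hom C T Y"
      and m: "rel_mem C x' x E" "rel_mem C x z \<Phi>" "rel_mem C z z' F"
    obtain B c a where c: "c \<in> hom C B T" "so_morphism C c" "a \<in> hom C B A"
      "rel_mem C (x \<cdot> c) (p \<cdot> a) E" "rel_mem C (y \<cdot> a) (z \<cdot> c) F"
      using m(2) unfolding mem[OF x(1) z(1)] by blast
    have "rel_mem C (x' \<cdot> c) (p \<cdot> a) E" "rel_mem C (y \<cdot> a) (z' \<cdot> c) F"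
      using congruenceD(3)[OF E comp_hom[OF c(1) x(2)] comp_hom[OF c(1) x(1)] comp_hom[OF c(3) p]
          rel_mem_comp[OF E' x(2,1) m(1) c(1)] c(4)]
        congruenceD(3)[OF F comp_hom[OF c(3) y] comp_hom[OF c(1) z(1)] comp_hom[OF c(1) z(2)]
          c(5) rel_mem_comp[OF F' z m(3) c(1)]] .
    then show "rel_mem C x' z' \<Phi>"
      unfolding mem[OF x(2) z(2)] using c by blast
  qed
  then show ?thesis
    using that mem by blast
qed

text \<open>\<open>\<Phi>\<close> is the relation of the span and its right adjoint
  \<open>\<Psi>\<close> that of the reversed span. Totality holds because \<open>p\<close> is a
  cover, single-valuedness because \<open>ker\<close> makes \<open>y\<close> compatible with the
  classes of \<open>p\<close>.\<close>

lemma map_from_presentation: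
  assumes X: "X \<in> Obj C" "Y \<in> Obj C" and E: "congruence C X E" and F: "congruence C Y F"
    and p: "p \<in> hom C A X" "so_morphism C p" and y: "y \<in> hom C A Y"
    and ker: "\<And>B a b. \<lbrakk>a \<in> hom C B A; b \<in> hom C B A; rel_mem C (p \<cdot> a) (p \<cdot> b) E\<rbrakk> \<Longrightarrow>
      rel_mem C (y \<cdot> a) (y \<cdot> b) F"
  obtains \<Phi> \<Psi> where "map_pair X E Y F \<Phi> \<Psi>" "presents A p y X Y F \<Phi>"
proof -
  note E' = congruenceD(1)[OF E] and F' = congruenceD(1)[OF F]
  obtain \<Phi> where b1: "bimodule X E Y F \<Phi>"
    and a\<Phi>: "\<forall>T x z. x \<in> hom C T X \<longrightarrow> z \<in> hom C T Y \<longrightarrow> (rel_mem C x z \<Phi> \<longleftrightarrow>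
      (\<exists>B c a. c \<in> hom C B T \<and> so_morphism C c \<and> a \<in> hom C B A \<and>
        rel_mem C (x \<cdot> c) (p \<cdot> a) E \<and> rel_mem C (y \<cdot> a) (z \<cdot> c) F))"
    using span_bimodule[OF X E F p(1) y] .
  obtain \<Psi> where b2: "bimodule Y F X E \<Psi>"
    and a\<Psi>: "\<forall>T z x. z \<in> hom C T Y \<longrightarrow> x \<in> hom C T X \<longrightarrow> (rel_mem C z x \<Psi> \<longleftrightarrow>
      (\<exists>B c a. c \<in> hom C B T \<and> so_morphism C c \<and> a \<in> hom C B A \<and>
        rel_mem C (z \<cdot> c) (y \<cdot> a) F \<and> rel_mem C (p \<cdot> a) (x \<cdot> c) E))"
    using span_bimodule[OF X(2,1) F E y p(1)] .
  note m\<Phi> = a\<Phi>[rule_format] and m\<Psi> = a\<Psi>[rule_format]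
  have intro_id: "\<exists>B c a. c \<in> hom C B T \<and> so_morphism C c \<and> a \<in> hom C B A \<and> Q c a"
    if "a \<in> hom C T A" "Q (Ident C T) a" for T a Q
    using that ident_hom so_ident hom_Obj(1)[OF that(1)] by blast
  have tot: "\<exists>B c z. c \<in> hom C B T \<and> so_morphism C c \<and> z \<in> hom C B Y \<and>
      rel_mem C (x \<cdot> c) z \<Phi> \<and> rel_mem C z (x \<cdot> c) \<Psi>" if x: "x \<in> hom C T X" for T x
  proof -
    obtain B c a where c: "c \<in> hom C B T" "so_morphism C c" "a \<in> hom C B A" "x \<cdot> c = p \<cdot> a"
      using lift_along_so[OF p(2,1) x] .
    note pa = comp_hom[OF c(3) p(1)] and ya = comp_hom[OF c(3) y]
    have "rel_mem C (p \<cdot> a) (y \<cdot> a) \<Phi>"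
      unfolding m\<Phi>[OF pa ya]
      by (rule intro_id[OF c(3)])
        (simp add: ident_right[OF pa] ident_right[OF ya] congruenceD(2)[OF E pa] congruenceD(2)[OF F ya])
    moreover have "rel_mem C (y \<cdot> a) (p \<cdot> a) \<Psi>"
      unfolding m\<Psi>[OF ya pa]
      by (rule intro_id[OF c(3)])
        (simp add: ident_right[OF pa] ident_right[OF ya] congruenceD(2)[OF E pa] congruenceD(2)[OF F ya])
    ultimately show ?thesis
      using c ya by metis
  qed
  have sgl: "rel_mem C z z' F" if x: "x \<in> hom C T X" and z: "z \<in> hom C T Y" "z' \<in> hom C T Y"
    and mem: "rel_mem C z x \<Psi>" "rel_mem C x z' \<Phi>" for T x z z'
  proof -
    obtain B1 c1 a1 where c1: "c1 \<in> hom C B1 T" "so_morphism C c1" "a1 \<in> hom C B1 A"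
      "rel_mem C (z \<cdot> c1) (y \<cdot> a1) F" "rel_mem C (p \<cdot> a1) (x \<cdot> c1) E"
      using mem(1) unfolding m\<Psi>[OF z(1) x] by blast
    obtain B2 c2 a2 where c2: "c2 \<in> hom C B2 T" "so_morphism C c2" "a2 \<in> hom C B2 A"
      "rel_mem C (x \<cdot> c2) (p \<cdot> a2) E" "rel_mem C (y \<cdot> a2) (z' \<cdot> c2) F"
      using mem(2) unfolding m\<Phi>[OF x z(2)] by blast
    obtain B d1 d2 where d: "d1 \<in> hom C B B1" "so_morphism C d1" "d2 \<in> hom C B B2"
      "c1 \<cdot> d1 = c2 \<cdot> d2" "c1 \<cdot> d1 \<in> hom C B T" "so_morphism C (c1 \<cdot> d1)"
      using common_cover[OF c1(1,2) c2(1,2)] .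
    have s1: "(w \<cdot> c1) \<cdot> d1 = w \<cdot> (c1 \<cdot> d1)" and s2: "(w \<cdot> c2) \<cdot> d2 = w \<cdot> (c1 \<cdot> d1)"
      if "w \<in> hom C T W" for w W
      using comp_assoc[OF d(1) c1(1) that] comp_assoc[OF d(3) c2(1) that] d(4) by auto
    have s3: "(w \<cdot> a1) \<cdot> d1 = w \<cdot> (a1 \<cdot> d1)" and s4: "(w \<cdot> a2) \<cdot> d2 = w \<cdot> (a2 \<cdot> d2)"
      if "w \<in> hom C A W" for w W
      using comp_assoc[OF d(1) c1(3) that] comp_assoc[OF d(3) c2(3) that] by auto
    note ah = comp_hom[OF d(1) c1(3)] comp_hom[OF d(3) c2(3)]
    have "rel_mem C (p \<cdot> (a1 \<cdot> d1)) (x \<cdot> (c1 \<cdot> d1)) E" "rel_mem C (x \<cdot> (c1 \<cdot> d1)) (p \<cdot> (a2 \<cdot> d2)) E"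
      using rel_mem_comp[OF E' comp_hom[OF c1(3) p(1)] comp_hom[OF c1(1) x] c1(5) d(1)]
        rel_mem_comp[OF E' comp_hom[OF c2(1) x] comp_hom[OF c2(3) p(1)] c2(4) d(3)]
        s1[OF x] s2[OF x] s3[OF p(1)] s4[OF p(1)] by auto
    then have "rel_mem C (p \<cdot> (a1 \<cdot> d1)) (p \<cdot> (a2 \<cdot> d2)) E"
      by (rule congruenceD(3)[OF E comp_hom[OF ah(1) p(1)] comp_hom[OF d(5) x] comp_hom[OF ah(2) p(1)]])
    then have yy: "rel_mem C (y \<cdot> (a1 \<cdot> d1)) (y \<cdot> (a2 \<cdot> d2)) F"
      by (rule ker[OF ah])
    have "rel_mem C (z \<cdot> (c1 \<cdot> d1)) (y \<cdot> (a1 \<cdot> d1)) F" "rel_mem C (y \<cdot> (a2 \<cdot> d2)) (z' \<cdot> (c1 \<cdot> d1)) F"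
      using rel_mem_comp[OF F' comp_hom[OF c1(1) z(1)] comp_hom[OF c1(3) y] c1(4) d(1)]
        rel_mem_comp[OF F' comp_hom[OF c2(3) y] comp_hom[OF c2(1) z(2)] c2(5) d(3)]
        s1[OF z(1)] s2[OF z(2)] s3[OF y] s4[OF y] by auto
    then have "rel_mem C (z \<cdot> (c1 \<cdot> d1)) (z' \<cdot> (c1 \<cdot> d1)) F"
      using congruenceD(3)[OF F comp_hom[OF d(5) z(1)] comp_hom[OF ah(1) y] comp_hom[OF ah(2) y] _ yy]
        congruenceD(3)[OF F comp_hom[OF d(5) z(1)] comp_hom[OF ah(2) y] comp_hom[OF d(5) z(2)]] by blast
    then show ?thesis
      by (rule rel_mem_descent[OF F' z d(5,6)])
  qed
  have mp: "map_pair X E Y F \<Phi> \<Psi>"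
    unfolding map_pair_def using b1 b2 tot sgl by blast
  have "rel_mem C (p \<cdot> a) z \<Phi> \<longleftrightarrow> rel_mem C (y \<cdot> a) z F" if a: "a \<in> hom C T A" and z: "z \<in> hom C T Y" for T a z
  proof
    note pa = comp_hom[OF a p(1)] and ya = comp_hom[OF a y]
    show "rel_mem C (y \<cdot> a) z F" if mem: "rel_mem C (p \<cdot> a) z \<Phi>"
    proof -
      obtain B c b where c: "c \<in> hom C B T" "so_morphism C c" "b \<in> hom C B A"
        "rel_mem C ((p \<cdot> a) \<cdot> c) (p \<cdot> b) E" "rel_mem C (y \<cdot> b) (z \<cdot> c) F"
        using mem unfolding m\<Phi>[OF pa z] by blast
      have "rel_mem C ((y \<cdot> a) \<cdot> c) (y \<cdot> b) F"
        using ker[OF comp_hom[OF c(1) a] c(3)] c(4) comp_assoc[OF c(1) a p(1)] comp_assoc[OF c(1) a y]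
        by simp
      then have "rel_mem C ((y \<cdot> a) \<cdot> c) (z \<cdot> c) F"
        using congruenceD(3)[OF F comp_hom[OF c(1) ya] comp_hom[OF c(3) y] comp_hom[OF c(1) z] _ c(5)]
        by blast
      then show ?thesis
        by (rule rel_mem_descent[OF F' ya z c(1,2)])
    qed
    show "rel_mem C (p \<cdot> a) z \<Phi>" if "rel_mem C (y \<cdot> a) z F"
      unfolding m\<Phi>[OF pa z]
      by (rule intro_id[OF a])
        (simp add: ident_right[OF pa] ident_right[OF z] congruenceD(2)[OF E pa] that)
  qed
  then have "presents A p y X Y F \<Phi>"
    unfolding presents_def using p y by blast
  then show ?thesis
    using that mp by blast
qed

end

section \<open>The functor \<open>Gamma\<close> and the quotient maps\<close>

context reg_cat
begin

lemma hom_rel: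
  assumes X: "X \<in> Obj C"
  shows "hom_rel C X \<in> relations C X X"
    and "\<And>A x y. \<lbrakk>x \<in> hom C A X; y \<in> hom C A X\<rbrakk> \<Longrightarrow> rel_mem C x y (hom_rel C X) \<longleftrightarrow> x \<preceq> y"
    and "congruence C X (hom_rel C X)"
proof -
  note i = ident_hom[OF X]
  show R: "hom_rel C X \<in> relations C X X"
    unfolding hom_rel_def by (rule comma_rel(1)[OF i i])
  show mem: "rel_mem C x y (hom_rel C X) \<longleftrightarrow> x \<preceq> y" if "x \<in> hom C A X" "y \<in> hom C A X" for A x y
    using comma_rel(2)[OF i i that] ident_left[OF that(1)] ident_left[OF that(2)]
    by (simp add: hom_rel_def)
  show "congruence C X (hom_rel C X)"
    unfolding congruence_def
  proof (intro conjI R)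
    show "weakening_closed C X X (hom_rel C X)"
      unfolding weakening_closed_def
    proof (intro ballI impI)
      fix A x x' y y'
      assume x: "x \<in> hom C A X" "x' \<in> hom C A X" and y: "y \<in> hom C A X" "y' \<in> hom C A X"
        and h: "x' \<preceq> x \<and> rel_mem C x y (hom_rel C X) \<and> y \<preceq> y'"
      then have "x' \<preceq> x" "x \<preceq> y" "y \<preceq> y'"
        using mem by auto
      then have "x' \<preceq> y'"
        using le_trans[OF x(2,1) y(1)] le_trans[OF x(2) y] by blast
      then show "rel_mem C x' y' (hom_rel C X)"
        using mem x y by simp
    qed
    show "reflexive_rel C X (hom_rel C X)"
      unfolding reflexive_rel_def using mem le_refl by blast
    show "transitive_rel C X (hom_rel C X)"
      unfolding transitive_rel_def
    proof (intro ballI impI)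
      fix A x y z
      assume x: "x \<in> hom C A X" and y: "y \<in> hom C A X" and z: "z \<in> hom C A X"
        and h: "rel_mem C x y (hom_rel C X) \<and> rel_mem C y z (hom_rel C X)"
      then have "x \<preceq> z"
        using mem le_trans[OF x y z] by simp
      then show "rel_mem C x z (hom_rel C X)"
        using mem x z by simp
    qed
  qed
qed

lemma lower_star:
  assumes f: "f \<in> hom C X Y"
  shows "lower_star C f \<in> relations C X Y"
    and "\<And>A x y. \<lbrakk>x \<in> hom C A X; y \<in> hom C A Y\<rbrakk> \<Longrightarrow> rel_mem C x y (lower_star C f) \<longleftrightarrow> f \<cdot> x \<preceq> y"
proof -
  have Y: "Y \<in> Obj C" "Cod C f = Y"
    using hom_Obj f by (auto simp: hom_def)
  note i = ident_hom[OF Y(1)]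
  show "lower_star C f \<in> relations C X Y"
    unfolding lower_star_def Y by (rule comma_rel(1)[OF f i])
  show "rel_mem C x y (lower_star C f) \<longleftrightarrow> f \<cdot> x \<preceq> y" if "x \<in> hom C A X" "y \<in> hom C A Y" for A x y
    using comma_rel(2)[OF f i that] ident_left[OF that(2)] by (simp add: lower_star_def Y)
qed

section \<open>Arrows of \<open>ex_reg\<close> handled through presentations\<close>

definition repr :: "'o \<Rightarrow> 'm \<Rightarrow> 'm \<Rightarrow> ('o, 'm) qarr \<Rightarrow> bool" where
  "repr A p y u \<longleftrightarrow>
    presents A p y (fst (fst u)) (fst (fst (snd u))) (snd (fst (snd u))) (snd (snd u))"

lemma repr_hom:
  assumes "u \<in> hom (ex_reg C) (X, E) (Y, F)" "repr A p y u"
  shows "p \<in> hom C A X" "so_morphism C p" "y \<in> hom C A Y"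
  using assms presentsD(1-3) unfolding repr_def ex_reg_hom_iff by auto

lemma repr_exists:
  assumes u: "u \<in> hom (ex_reg C) (X, E) (Y, F)"
  obtains A p y where "repr A p y u"
proof -
  obtain \<Phi> \<Psi> where "X \<in> Obj C" "congruence C X E" "congruence C Y F" "map_pair X E Y F \<Phi> \<Psi>"
    and "u = ((X, E), (Y, F), \<Phi>)"
    using u unfolding ex_reg_hom_iff by blast
  then show ?thesis
    using presentation_exists[of X E Y F \<Phi> \<Psi>] that unfolding repr_def by auto
qed

lemma repr_common:
  assumes u: "u \<in> hom (ex_reg C) (X, E) (Y, F)" and v: "v \<in> hom (ex_reg C) (X, E) (Z, G)"
  obtains A p y z where "repr A p y u" "repr A p z v"
proof -
  obtain A p y where p: "repr A p y u"
    using repr_exists[OF u] .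
  obtain B q z where q: "repr B q z v"
    using repr_exists[OF v] .
  have "fst (fst u) = X" "fst (fst v) = X"
    using u v unfolding ex_reg_hom_iff by auto
  then show ?thesis
    using common_presentation p q that unfolding repr_def by metis
qed

lemma repr_le_iff:
  assumes u: "u \<in> hom (ex_reg C) (X, E) (Y, F)" and v: "v \<in> hom (ex_reg C) (X, E) (Y, F)"
    and r: "repr A p y u" "repr A p z v"
  shows "u \<unlhd> v \<longleftrightarrow> rel_mem C y z F"
proof -
  obtain \<Phi> \<Phi>' where uv: "u = ((X, E), (Y, F), \<Phi>)" "v = ((X, E), (Y, F), \<Phi>')"
    and X: "X \<in> Obj C" "Y \<in> Obj C" "congruence C Y F" and m: "bimodule X E Y F \<Phi>" "bimodule X E Y F \<Phi>'"
    using u v unfolding ex_reg_hom_iff map_pair_def by blast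
  show ?thesis
    using presents_le[OF X bimoduleD(1)[OF m(1)] bimoduleD(1)[OF m(2)]] r
    unfolding uv repr_def by simp
qed

lemma repr_unique:
  assumes u: "u \<in> hom (ex_reg C) (X, E) (Y, F)" and v: "v \<in> hom (ex_reg C) (X, E) (Y, F)"
    and r: "repr A p y u" "repr A p y v"
  shows "u = v"
proof -
  obtain \<Phi> \<Phi>' where uv: "u = ((X, E), (Y, F), \<Phi>)" "v = ((X, E), (Y, F), \<Phi>')"
    and X: "X \<in> Obj C" "Y \<in> Obj C" "congruence C Y F" and m: "bimodule X E Y F \<Phi>" "bimodule X E Y F \<Phi>'"
    using u v unfolding ex_reg_hom_iff map_pair_def by blast
  show ?thesis
    using presents_unique[OF X bimoduleD(1)[OF m(1)] bimoduleD(1)[OF m(2)]] r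
    unfolding uv repr_def by simp
qed

lemma repr_kernel:
  assumes u: "u \<in> hom (ex_reg C) (X, E) (Y, F)" and r: "repr A p y u"
    and ab: "a \<in> hom C B A" "b \<in> hom C B A" "rel_mem C (p \<cdot> a) (p \<cdot> b) E"
  shows "rel_mem C (y \<cdot> a) (y \<cdot> b) F"
proof -
  obtain \<Phi> where u: "u = ((X, E), (Y, F), \<Phi>)" and X: "congruence C X E" "congruence C Y F"
    and m: "bimodule X E Y F \<Phi>"
    using u unfolding ex_reg_hom_iff map_pair_def by blast
  show ?thesis
    using presents_kernel[OF X m _ ab] r unfolding u repr_def by simp
qed

lemma repr_construct:
  assumes X: "X \<in> Obj C" "Y \<in> Obj C" and E: "congruence C X E" and F: "congruence C Y F"
    and p: "p \<in> hom C A X" "so_morphism C p" and y: "y \<in> hom C A Y"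
    and ker: "\<And>B a b. \<lbrakk>a \<in> hom C B A; b \<in> hom C B A; rel_mem C (p \<cdot> a) (p \<cdot> b) E\<rbrakk> \<Longrightarrow>
      rel_mem C (y \<cdot> a) (y \<cdot> b) F"
  obtains u where "u \<in> hom (ex_reg C) (X, E) (Y, F)" "repr A p y u"
proof -
  obtain \<Phi> \<Psi> where mp: "map_pair X E Y F \<Phi> \<Psi>" and pr: "presents A p y X Y F \<Phi>"
    by (rule map_from_presentation[OF X E F p y]) (rule ker)
  show ?thesis
  proof (rule that)
    show "((X, E), (Y, F), \<Phi>) \<in> hom (ex_reg C) (X, E) (Y, F)"
      unfolding ex_reg_hom_iff using X E F mp by blast
    show "repr A p y ((X, E), (Y, F), \<Phi>)"
      using pr by (simp add: repr_def)
  qed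
qed

lemma repr_refine:
  "\<lbrakk>repr A p y u; c \<in> hom C B A; so_morphism C c\<rbrakk> \<Longrightarrow> repr B (p \<cdot> c) (y \<cdot> c) u"
  unfolding repr_def by (rule presents_refine)

text \<open>Composition is substitution once the value \<open>y\<close> of \<open>u\<close> has been
  lifted through the cover \<open>q\<close> of the second map; \<open>t\<close> is such a
  lift.\<close>

lemma repr_comp:
  assumes u: "u \<in> hom (ex_reg C) (X, E) (Y, F)" and v: "v \<in> hom (ex_reg C) (Y, F) (Z, G)"
    and r: "repr A p y u" "repr B q w v" and t: "t \<in> hom C A B" "y = q \<cdot> t"
  shows "repr A p (w \<cdot> t) (v \<star> u)"
proof -
  obtain \<Phi> where u': "u = ((X, E), (Y, F), \<Phi>)" and X: "X \<in> Obj C" "Y \<in> Obj C"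
    and F: "congruence C Y F" and m: "bimodule X E Y F \<Phi>"
    using u unfolding ex_reg_hom_iff map_pair_def by blast
  obtain \<Psi> where v': "v = ((Y, F), (Z, G), \<Psi>)" and Z: "Z \<in> Obj C"
    and G: "congruence C Z G" and n: "bimodule Y F Z G \<Psi>"
    using v unfolding ex_reg_hom_iff map_pair_def by blast
  have pu: "presents A p y X Y F \<Phi>" and pv: "presents B q w Y Z G \<Psi>"
    using r by (auto simp: repr_def u' v')
  note q = presentsD(1-3)[OF pv]
  have "rel_mem C (y \<cdot> a) z' \<Psi> \<longleftrightarrow> rel_mem C ((w \<cdot> t) \<cdot> a) z' G"
    if a: "a \<in> hom C D A" and z': "z' \<in> hom C D Z" for D a z'
    unfolding t(2) comp_assoc[OF a t(1) q(1)] comp_assoc[OF a t(1) q(3)]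
    by (rule presentsD(4)[OF pv comp_hom[OF a t(1)] z'])
  then have "presents A p (w \<cdot> t) X Z G (rel_comp C X Y Z \<Psi> \<Phi>)"
    by (rule presents_comp[OF X Z F G bimoduleD(1)[OF m] n pu comp_hom[OF t(1) q(3)]])
  then show ?thesis
    by (simp add: u' v' repr_def)
qed

abbreviation \<Gamma>o :: "'o \<Rightarrow> ('o, 'm) qobj" where "\<Gamma>o X \<equiv> (X, hom_rel C X)"
abbreviation \<Gamma>m :: "'m \<Rightarrow> ('o, 'm) qarr" where "\<Gamma>m f \<equiv> farr (Gamma C) f"
definition quot :: "'o \<Rightarrow> 'm set \<Rightarrow> ('o, 'm) qarr" where "quot X E = (\<Gamma>o X, (X, E), E)"

text \<open>No right adjoint has to be exhibited for an explicitly given relation: a compatible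
  presentation determines a map, and by uniqueness of what is presented its relation is the given
  one.\<close>

lemma ex_reg_homI:
  assumes X: "X \<in> Obj C" "Y \<in> Obj C" and E: "congruence C X E" and F: "congruence C Y F"
    and R: "\<Phi> \<in> relations C X Y" and p: "presents A p y X Y F \<Phi>"
    and ker: "\<And>B a b. \<lbrakk>a \<in> hom C B A; b \<in> hom C B A; rel_mem C (p \<cdot> a) (p \<cdot> b) E\<rbrakk> \<Longrightarrow>
      rel_mem C (y \<cdot> a) (y \<cdot> b) F"
  shows "((X, E), (Y, F), \<Phi>) \<in> hom (ex_reg C) (X, E) (Y, F)"
proof -
  obtain \<Phi>' \<Psi> where mp: "map_pair X E Y F \<Phi>' \<Psi>" and pr: "presents A p y X Y F \<Phi>'"
    by (rule map_from_presentation[OF X E F presentsD(1-3)[OF p]]) (rule ker)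
  have "\<Phi>' = \<Phi>"
    using presents_unique[OF X F bimoduleD(1) R pr p] mp unfolding map_pair_def by blast
  then show ?thesis
    unfolding ex_reg_hom_iff using X E F mp by blast
qed

lemma Gamma_hom:
  assumes f: "f \<in> hom C X Y"
  shows "\<Gamma>m f \<in> hom (ex_reg C) (\<Gamma>o X) (\<Gamma>o Y)" "repr X (Ident C X) f (\<Gamma>m f)"
proof -
  have X: "X \<in> Obj C" "Y \<in> Obj C" "Dom C f = X" "Cod C f = Y"
    using hom_Obj f by (auto simp: hom_def)
  note ls = lower_star[OF f] and i = ident_hom[OF X(1)]
  have "rel_mem C (Ident C X \<cdot> a) y' (lower_star C f) \<longleftrightarrow> rel_mem C (f \<cdot> a) y' (hom_rel C Y)"
    if a: "a \<in> hom C B X" and y': "y' \<in> hom C B Y" for B a y'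
    unfolding ident_left[OF a] ls(2)[OF a y'] hom_rel(2)[OF X(2) comp_hom[OF a f] y'] ..
  then have pr: "presents X (Ident C X) f X Y (hom_rel C Y) (lower_star C f)"
    unfolding presents_def using i so_ident[OF X(1)] f by blast
  then show "repr X (Ident C X) f (\<Gamma>m f)"
    by (simp add: repr_def Gamma_def X)
  have "((X, hom_rel C X), (Y, hom_rel C Y), lower_star C f) \<in> hom (ex_reg C) (\<Gamma>o X) (\<Gamma>o Y)"
  proof (rule ex_reg_homI[OF X(1,2) hom_rel(3)[OF X(1)] hom_rel(3)[OF X(2)] ls(1) pr])
    fix B a b
    assume a: "a \<in> hom C B X" and b: "b \<in> hom C B X"
      and "rel_mem C (Ident C X \<cdot> a) (Ident C X \<cdot> b) (hom_rel C X)"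
    then have "a \<preceq> b"
      using hom_rel(2)[OF X(1) a b] ident_left a b by simp
    then show "rel_mem C (f \<cdot> a) (f \<cdot> b) (hom_rel C Y)"
      using comp_le(1)[OF _ a b f] hom_rel(2)[OF X(2) comp_hom[OF a f] comp_hom[OF b f]] by simp
  qed
  then show "\<Gamma>m f \<in> hom (ex_reg C) (\<Gamma>o X) (\<Gamma>o Y)"
    by (simp add: Gamma_def X)
qed

lemma quot_hom:
  assumes X: "X \<in> Obj C" and E: "congruence C X E"
  shows "quot X E \<in> hom (ex_reg C) (\<Gamma>o X) (X, E)" "repr X (Ident C X) (Ident C X) (quot X E)"
proof -
  note i = ident_hom[OF X]
  have pr: "presents X (Ident C X) (Ident C X) X X E E"
    unfolding presents_def using i so_ident[OF X] by blast
  then show "repr X (Ident C X) (Ident C X) (quot X E)"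
    by (simp add: repr_def quot_def)
  show "quot X E \<in> hom (ex_reg C) (\<Gamma>o X) (X, E)"
    unfolding quot_def
  proof (rule ex_reg_homI[OF X X hom_rel(3)[OF X] E congruenceD(1)[OF E] pr])
    fix B a b
    assume a: "a \<in> hom C B X" and b: "b \<in> hom C B X"
      and "rel_mem C (Ident C X \<cdot> a) (Ident C X \<cdot> b) (hom_rel C X)"
    then show "rel_mem C (Ident C X \<cdot> a) (Ident C X \<cdot> b) E"
      using hom_rel(2)[OF X a b] ident_left a b congruenceD(5)[OF E a b] by simp
  qed
qed

lemma repr_Gamma_comp:
  assumes u: "u \<in> hom (ex_reg C) (X, E) (\<Gamma>o Y)" and r: "repr A p y u" and f: "f \<in> hom C Y Z"
  shows "repr A p (f \<cdot> y) (\<Gamma>m f \<star> u)"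
  using repr_comp[OF u Gamma_hom(1)[OF f] r Gamma_hom(2)[OF f] repr_hom(3)[OF u r]]
    ident_left[OF repr_hom(3)[OF u r]] by simp

lemma repr_quot_comp:
  assumes u: "u \<in> hom (ex_reg C) (X, E) (\<Gamma>o Y)" and r: "repr A p y u"
    and Y: "Y \<in> Obj C" and F: "congruence C Y F"
  shows "repr A p y (quot Y F \<star> u)"
  using repr_comp[OF u quot_hom(1)[OF Y F] r quot_hom(2)[OF Y F] repr_hom(3)[OF u r]]
    ident_left[OF repr_hom(3)[OF u r]] by simp

lemma repr_comp_Gamma:
  assumes u: "u \<in> hom (ex_reg C) (\<Gamma>o X) (Y, F)" and r: "repr A p y u" and a: "a \<in> hom C B A"
  shows "repr B (Ident C B) (y \<cdot> a) (u \<star> \<Gamma>m (p \<cdot> a))"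
  using repr_comp[OF Gamma_hom(1) u Gamma_hom(2) r a refl] comp_hom[OF a repr_hom(1)[OF u r]] by blast

lemma repr_comp_quot:
  assumes u: "u \<in> hom (ex_reg C) (X, E) (Y, F)" and r: "repr A p y u"
    and X: "X \<in> Obj C" and E: "congruence C X E"
  shows "repr A p y (u \<star> quot X E)"
proof -
  note p = repr_hom[OF u r]
  have A: "A \<in> Obj C"
    using hom_Obj p by blast
  have "repr A p p (quot X E)"
    using repr_refine[OF quot_hom(2)[OF X E] p(1,2)] ident_left[OF p(1)] by simp
  from repr_comp[OF quot_hom(1)[OF X E] u this r ident_hom[OF A]] show ?thesis
    using ident_right p by simp
qed

lemma Gamma_comp:
  assumes f: "f \<in> hom C X Y" and g: "g \<in> hom C Y Z"
  shows "\<Gamma>m (g \<cdot> f) = \<Gamma>m g \<star> \<Gamma>m f"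
proof -
  interpret R: pos_category "ex_reg C"
    by (rule pos_category_ex_reg)
  show ?thesis
    using repr_unique[OF Gamma_hom(1) R.comp_hom, OF comp_hom[OF f g] Gamma_hom(1)[OF f]
        Gamma_hom(1)[OF g] Gamma_hom(2)[OF comp_hom[OF f g]]
        repr_Gamma_comp[OF Gamma_hom[OF f] g]] .
qed

lemma Gamma_le_iff:
  assumes f: "f \<in> hom C X Y" and g: "g \<in> hom C X Y"
  shows "\<Gamma>m f \<unlhd> \<Gamma>m g \<longleftrightarrow> f \<preceq> g"
  using repr_le_iff[OF Gamma_hom(1)[OF f] Gamma_hom(1)[OF g] Gamma_hom(2)[OF f] Gamma_hom(2)[OF g]]
    hom_rel(2)[OF hom_Obj(2)[OF f] f g] by simp

text \<open>The congruences are the orders themselves, so the kernel condition says that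
  \<open>y\<close> respects the order kernel of the cover \<open>p\<close>. Hence \<open>y\<close>
  factors through \<open>p\<close>, and \<open>u\<close> is the image of the factor.\<close>

lemma Gamma_full:
  assumes u: "u \<in> hom (ex_reg C) (\<Gamma>o X) (\<Gamma>o Y)"
  obtains f where "f \<in> hom C X Y" "\<Gamma>m f = u"
proof -
  have X: "X \<in> Obj C" "Y \<in> Obj C"
    using u unfolding ex_reg_hom_iff by auto
  obtain A p y where r: "repr A p y u"
    using repr_exists[OF u] .
  note p = repr_hom[OF u r]
  have "\<exists>f \<in> hom C X Y. y = f \<cdot> p"
  proof (rule so_factor[OF p(2,1,3)])
    fix T s t
    assume s: "s \<in> hom C T A" and t: "t \<in> hom C T A" and le: "p \<cdot> s \<preceq> p \<cdot> t"
    then show "y \<cdot> s \<preceq> y \<cdot> t"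
      using repr_kernel[OF u r s t] hom_rel(2)[OF X(1) comp_hom[OF s p(1)] comp_hom[OF t p(1)]]
        hom_rel(2)[OF X(2) comp_hom[OF s p(3)] comp_hom[OF t p(3)]] by simp
  qed
  then obtain f where f: "f \<in> hom C X Y" "y = f \<cdot> p"
    by blast
  have "repr A p y (\<Gamma>m f)"
    using repr_refine[OF Gamma_hom(2)[OF f(1)] p(1,2)] ident_left[OF p(1)] f(2) by simp
  then have "\<Gamma>m f = u"
    by (rule repr_unique[OF Gamma_hom(1)[OF f(1)] u _ r])
  then show ?thesis
    using that f(1) by blast
qed

text \<open>The presentation as an equation between arrows of \<open>ex_reg\<close>, in which only
  quotient maps and images under \<open>Gamma\<close> occur besides \<open>u\<close>. In this form
  it can be transported along \<open>Fbar\<close>.\<close>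

lemma repr_square:
  assumes u: "u \<in> hom (ex_reg C) (X, E) (Y, F)" and r: "repr A p y u"
    and X: "X \<in> Obj C" "Y \<in> Obj C" and E: "congruence C X E" and F: "congruence C Y F"
  shows "u \<star> (quot X E \<star> \<Gamma>m p) = quot Y F \<star> \<Gamma>m y"
proof -
  interpret R: pos_category "ex_reg C"
    by (rule pos_category_ex_reg)
  note p = repr_hom[OF u r]
  have A: "A \<in> Obj C"
    using hom_Obj p by blast
  note h = Gamma_hom(1)[OF p(1)] Gamma_hom(1)[OF p(3)]
  note qp = R.comp_hom[OF h(1) quot_hom(1)[OF X(1) E]]
  have "p = p \<cdot> Ident C A"
    using ident_right[OF p(1)] by simp
  from repr_comp[OF qp u repr_quot_comp[OF h(1) Gamma_hom(2)[OF p(1)] X(1) E] r ident_hom[OF A] this]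
  have "repr A (Ident C A) y (u \<star> (quot X E \<star> \<Gamma>m p))"
    using ident_right[OF p(3)] by simp
  then show ?thesis
    using repr_unique[OF R.comp_hom[OF qp u] R.comp_hom[OF h(2) quot_hom(1)[OF X(2) F]]]
      repr_quot_comp[OF h(2) Gamma_hom(2)[OF p(3)] X(2) F] by blast
qed

lemma quot_le_iff:
  assumes X: "X \<in> Obj C" and E: "congruence C X E" and x: "x \<in> hom C A X" and y: "y \<in> hom C A X"
  shows "quot X E \<star> \<Gamma>m x \<unlhd> quot X E \<star> \<Gamma>m y \<longleftrightarrow> rel_mem C x y E"
proof -
  interpret R: pos_category "ex_reg C"
    by (rule pos_category_ex_reg)
  note g = Gamma_hom[OF x] and h = Gamma_hom[OF y] and q = quot_hom(1)[OF X E]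
  show ?thesis
    by (rule repr_le_iff[OF R.comp_hom[OF g(1) q] R.comp_hom[OF h(1) q] repr_quot_comp[OF g X E]
          repr_quot_comp[OF h X E]])
qed

text \<open>A presentation of \<open>g\<close> on \<open>\<Gamma>o X\<close> also presents a map on
  \<open>(X, E)\<close>, provided that it respects \<open>E\<close>. By the tabulation, this is the
  inequality \<open>g e0 \<unlhd> g e1\<close> restricted along \<open>h\<close>.\<close>

lemma quot_coinserter:
  assumes X: "X \<in> Obj C" and E: "congruence C X E"
    and e: "e0 \<in> hom C T X" "e1 \<in> hom C T X"
    and tab: "\<forall>A x y. x \<in> hom C A X \<longrightarrow> y \<in> hom C A X \<longrightarrow>
      (rel_mem C x y E \<longleftrightarrow> (\<exists>h \<in> hom C A T. e0 \<cdot> h = x \<and> e1 \<cdot> h = y))"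
  shows "coinserter (ex_reg C) (\<Gamma>m e0) (\<Gamma>m e1) (quot X E)"
proof -
  interpret R: pos_category "ex_reg C"
    by (rule pos_category_ex_reg)
  note q = quot_hom[OF X E]
  have T: "T \<in> Obj C"
    using hom_Obj e by blast
  have "rel_mem C e0 e1 E"
    using tab e ident_hom[OF T] ident_right[OF e(1)] ident_right[OF e(2)] by blast
  then have le: "quot X E \<star> \<Gamma>m e0 \<unlhd> quot X E \<star> \<Gamma>m e1"
    using quot_le_iff[OF X E e] by simp
  show ?thesis
  proof (rule R.coinserterI[OF Gamma_hom(1)[OF e(1)] Gamma_hom(1)[OF e(2)] q(1) le])
    fix Q g
    assume g: "g \<in> hom (ex_reg C) (\<Gamma>o X) Q"
      and gle: "g \<star> \<Gamma>m e0 \<unlhd> g \<star> \<Gamma>m e1"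
    obtain Z H where Q: "Q = (Z, H)"
      by (cases Q)
    note g' = g[unfolded Q]
    have Z: "Z \<in> Obj C" "congruence C Z H"
      using g' unfolding ex_reg_hom_iff by auto
    obtain A p y where r: "repr A p y g"
      using repr_exists[OF g'] .
    note p = repr_hom[OF g' r]
    have "rel_mem C (y \<cdot> a) (y \<cdot> b) H"
      if a: "a \<in> hom C B A" and b: "b \<in> hom C B A" and ab: "rel_mem C (p \<cdot> a) (p \<cdot> b) E" for B a b
    proof -
      note pa = comp_hom[OF a p(1)] and pb = comp_hom[OF b p(1)]
      obtain h where h: "h \<in> hom C B T" "e0 \<cdot> h = p \<cdot> a" "e1 \<cdot> h = p \<cdot> b"
        using tab pa pb ab by blast
      note gh = Gamma_hom(1)[OF h(1)]
      note ge = R.comp_hom[OF Gamma_hom(1)[OF e(1)] g'] R.comp_hom[OF Gamma_hom(1)[OF e(2)] g']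
      have *: "g \<star> \<Gamma>m (p \<cdot> a) = (g \<star> \<Gamma>m e0) \<star> \<Gamma>m h"
        "g \<star> \<Gamma>m (p \<cdot> b) = (g \<star> \<Gamma>m e1) \<star> \<Gamma>m h"
        using Gamma_comp[OF h(1) e(1)] Gamma_comp[OF h(1) e(2)] h(2,3)
          R.comp_assoc[OF gh Gamma_hom(1)[OF e(1)] g'] R.comp_assoc[OF gh Gamma_hom(1)[OF e(2)] g']
        by auto
      have "g \<star> \<Gamma>m (p \<cdot> a) \<unlhd> g \<star> \<Gamma>m (p \<cdot> b)"
        unfolding * by (rule R.comp_le(2)[OF gle ge gh])
      then show ?thesis
        using repr_le_iff[OF R.comp_hom[OF Gamma_hom(1)[OF pa] g'] R.comp_hom[OF Gamma_hom(1)[OF pb] g']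
            repr_comp_Gamma[OF g' r a] repr_comp_Gamma[OF g' r b]] by simp
    qed
    then obtain u where u: "u \<in> hom (ex_reg C) (X, E) (Z, H)" "repr A p y u"
      using repr_construct[OF X Z(1) E Z(2) p] by blast
    have "g = u \<star> quot X E"
      by (rule repr_unique[OF g' R.comp_hom[OF q(1) u(1)] r repr_comp_quot[OF u X E]])
    then show "\<exists>u\<in>hom (ex_reg C) (X, E) Q. g = u \<star> quot X E"
      using u(1) Q by blast
  next
    fix Q u v
    assume u: "u \<in> hom (ex_reg C) (X, E) Q" and v: "v \<in> hom (ex_reg C) (X, E) Q"
      and le: "u \<star> quot X E \<unlhd> v \<star> quot X E"
    obtain Z H where Q: "Q = (Z, H)"
      by (cases Q)
    note u' = u[unfolded Q] and v' = v[unfolded Q]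
    obtain A p y z where r: "repr A p y u" "repr A p z v"
      using repr_common[OF u' v'] .
    show "u \<unlhd> v"
      using le repr_le_iff[OF R.comp_hom[OF q(1) u'] R.comp_hom[OF q(1) v']
          repr_comp_quot[OF u' r(1) X E] repr_comp_quot[OF v' r(2) X E]]
        repr_le_iff[OF u' v' r] by simp
  qed
qed

text \<open>Over a common cover \<open>p\<close>, the arrows \<open>x\<close> and \<open>y\<close>
  are given by \<open>x0\<close> and \<open>x1\<close> with \<open>(x0, x1)\<close> in
  \<open>E\<close>, hence by some \<open>h\<close> into the tabulation. The span of \<open>p\<close>
  and \<open>h\<close> presents the lift; it is compatible with the congruence of the source because
  \<open>e0\<close> and \<open>e1\<close> are jointly order-monic.\<close>

lemma quot_comma:
  assumes X: "X \<in> Obj C" and E: "congruence C X E"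
    and e: "e0 \<in> hom C T X" "e1 \<in> hom C T X" and j: "jointly_order_mono C e0 e1"
    and tab: "\<forall>A x y. x \<in> hom C A X \<longrightarrow> y \<in> hom C A X \<longrightarrow>
      (rel_mem C x y E \<longleftrightarrow> (\<exists>h \<in> hom C A T. e0 \<cdot> h = x \<and> e1 \<cdot> h = y))"
  shows "is_comma (ex_reg C) (quot X E) (quot X E) (\<Gamma>m e0) (\<Gamma>m e1)"
proof -
  interpret R: pos_category "ex_reg C"
    by (rule pos_category_ex_reg)
  note q = quot_hom(1)[OF X E] and g = Gamma_hom(1)[OF e(1)] Gamma_hom(1)[OF e(2)]
  have T: "T \<in> Obj C" "Dom C e0 = T"
    using hom_Obj e by (auto simp: hom_def)
  have "rel_mem C e0 e1 E"
    using tab e ident_hom[OF T(1)] ident_right[OF e(1)] ident_right[OF e(2)] by blast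
  then have le: "quot X E \<star> \<Gamma>m e0 \<unlhd> quot X E \<star> \<Gamma>m e1"
    using quot_le_iff[OF X E e] by simp
  have refl: "s \<preceq> t" if s: "s \<in> hom C B T" and t: "t \<in> hom C B T" and st: "e0 \<cdot> s \<preceq> e0 \<cdot> t" "e1 \<cdot> s \<preceq> e1 \<cdot> t"
    for B s t
    using jointly_order_monoD[OF j, of s B t] s t st T by simp
  have jm: "jointly_order_mono (ex_reg C) (\<Gamma>m e0) (\<Gamma>m e1)"
  proof (rule R.jointly_order_monoI[OF g])
    fix P u v
    assume u: "u \<in> hom (ex_reg C) P (\<Gamma>o T)" and v: "v \<in> hom (ex_reg C) P (\<Gamma>o T)"
      and l: "\<Gamma>m e0 \<star> u \<unlhd> \<Gamma>m e0 \<star> v"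
        "\<Gamma>m e1 \<star> u \<unlhd> \<Gamma>m e1 \<star> v"
    obtain Z H where P: "P = (Z, H)"
      by (cases P)
    note u' = u[unfolded P] and v' = v[unfolded P]
    obtain A p s t where r: "repr A p s u" "repr A p t v"
      using repr_common[OF u' v'] .
    note s = repr_hom(3)[OF u' r(1)] and t = repr_hom(3)[OF v' r(2)]
    have "f \<cdot> s \<preceq> f \<cdot> t"
      if f: "f \<in> hom C T X" and lf: "\<Gamma>m f \<star> u \<unlhd> \<Gamma>m f \<star> v" for f
      using lf repr_le_iff[OF R.comp_hom[OF u' Gamma_hom(1)[OF f]] R.comp_hom[OF v' Gamma_hom(1)[OF f]]
          repr_Gamma_comp[OF u' r(1) f] repr_Gamma_comp[OF v' r(2) f]]
        hom_rel(2)[OF X comp_hom[OF s f] comp_hom[OF t f]] by simp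
    then have "s \<preceq> t"
      using refl[OF s t] e l by blast
    then show "u \<unlhd> v"
      using repr_le_iff[OF u' v' r] hom_rel(2)[OF T(1) s t] by simp
  qed
  have lift: "\<exists>u\<in>hom (ex_reg C) P (\<Gamma>o T). \<Gamma>m e0 \<star> u = x \<and> \<Gamma>m e1 \<star> u = y"
    if x: "x \<in> hom (ex_reg C) P (\<Gamma>o X)" and y: "y \<in> hom (ex_reg C) P (\<Gamma>o X)"
      and xy: "quot X E \<star> x \<unlhd> quot X E \<star> y" for P x y
  proof -
    obtain Z H where P: "P = (Z, H)"
      by (cases P)
    note x' = x[unfolded P] and y' = y[unfolded P]
    have Z: "Z \<in> Obj C" "congruence C Z H"
      using x' unfolding ex_reg_hom_iff by auto
    obtain A p x0 x1 where r: "repr A p x0 x" "repr A p x1 y"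
      using repr_common[OF x' y'] .
    note p = repr_hom[OF x' r(1)] and p1 = repr_hom[OF y' r(2)]
    have "rel_mem C x0 x1 E"
      using xy repr_le_iff[OF R.comp_hom[OF x' q] R.comp_hom[OF y' q]
          repr_quot_comp[OF x' r(1) X E] repr_quot_comp[OF y' r(2) X E]] by simp
    then obtain h where h: "h \<in> hom C A T" "e0 \<cdot> h = x0" "e1 \<cdot> h = x1"
      using tab p(3) p1(3) by blast
    have "rel_mem C (h \<cdot> a) (h \<cdot> b) (hom_rel C T)"
      if a: "a \<in> hom C B A" and b: "b \<in> hom C B A" and ab: "rel_mem C (p \<cdot> a) (p \<cdot> b) H" for B a b
    proof -
      note ha = comp_hom[OF a h(1)] and hb = comp_hom[OF b h(1)]
      have "x0 \<cdot> a \<preceq> x0 \<cdot> b" "x1 \<cdot> a \<preceq> x1 \<cdot> b"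
        using repr_kernel[OF x' r(1) a b ab] repr_kernel[OF y' r(2) a b ab]
          hom_rel(2)[OF X comp_hom[OF a p(3)] comp_hom[OF b p(3)]]
          hom_rel(2)[OF X comp_hom[OF a p1(3)] comp_hom[OF b p1(3)]] by auto
      then have "h \<cdot> a \<preceq> h \<cdot> b"
        using refl[OF ha hb] comp_assoc[OF a h(1) e(1)] comp_assoc[OF b h(1) e(1)]
          comp_assoc[OF a h(1) e(2)] comp_assoc[OF b h(1) e(2)] h(2,3) by simp
      then show ?thesis
        using hom_rel(2)[OF T(1) ha hb] by simp
    qed
    then obtain u where u: "u \<in> hom (ex_reg C) (Z, H) (\<Gamma>o T)" "repr A p h u"
      using repr_construct[OF Z(1) T(1) Z(2) hom_rel(3)[OF T(1)] p(1,2) h(1)] by blast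
    have "\<Gamma>m e0 \<star> u = x" "\<Gamma>m e1 \<star> u = y"
      using repr_unique[OF R.comp_hom[OF u(1) g(1)] x' repr_Gamma_comp[OF u e(1)]] r(1)
        repr_unique[OF R.comp_hom[OF u(1) g(2)] y' repr_Gamma_comp[OF u e(2)]] r(2) h(2,3) by auto
    then show ?thesis
      using u(1) P by blast
  qed
  have "Dom (ex_reg C) (quot X E) = \<Gamma>o X" "Dom (ex_reg C) (\<Gamma>m e0) = \<Gamma>o T"
    "Cod (ex_reg C) (\<Gamma>m e0) = \<Gamma>o X" "Cod (ex_reg C) (\<Gamma>m e1) = \<Gamma>o X" "quot X E \<in> Arr (ex_reg C)"
    using q g by (auto simp: hom_def)
  then show ?thesis
    unfolding is_comma_def using jm le lift by simp
qed

end

section \<open>Equivalences\<close>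

lemma iso_inE:
  assumes "iso_in C t" "t \<in> hom C A B"
  obtains s where "s \<in> hom C B A" "s \<cdot>\<^bsub>C\<^esub> t = Ident C A" "t \<cdot>\<^bsub>C\<^esub> s = Ident C B"
  using assms unfolding iso_in_def hom_def by auto

lemma iso_inI:
  assumes "t \<in> hom C A B" "s \<in> hom C B A" "s \<cdot>\<^bsub>C\<^esub> t = Ident C A" "t \<cdot>\<^bsub>C\<^esub> s = Ident C B"
  shows "iso_in C t"
  using assms unfolding iso_in_def hom_def by auto

lemma order_faithful_eq:
  assumes "pos_category C" "pos_category D" "pos_functor C D F" "order_faithful C D F"
    and f: "f \<in> hom C X Y" and g: "g \<in> hom C X Y" and eq: "farr F f = farr F g"
  shows "f = g"
proof -
  interpret C: pos_category C by fact
  interpret D: pos_category D by fact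
  interpret F: pos_functor C D F by fact
  have "farr F f \<preceq>\<^bsub>D\<^esub> farr F g" "farr F g \<preceq>\<^bsub>D\<^esub> farr F f"
    using D.le_refl[OF F.farr_hom[OF f]] eq by simp_all
  then have "f \<preceq>\<^bsub>C\<^esub> g" "g \<preceq>\<^bsub>C\<^esub> f"
    using assms(4) f g C.hom_Obj[OF f] unfolding order_faithful_def by blast+
  then show ?thesis
    using C.le_antisym[OF f g] by blast
qed

lemma nat_isomorphicE:
  assumes "nat_isomorphic C D F G"
  obtains \<tau> \<sigma> where
    "\<forall>X \<in> Obj C. \<tau> X \<in> hom D (fobj F X) (fobj G X) \<and> \<sigma> X \<in> hom D (fobj G X) (fobj F X) \<and>
      \<sigma> X \<cdot>\<^bsub>D\<^esub> \<tau> X = Ident D (fobj F X) \<and> \<tau> X \<cdot>\<^bsub>D\<^esub> \<sigma> X = Ident D (fobj G X)"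
    "\<forall>X \<in> Obj C. \<forall>Y \<in> Obj C. \<forall>f \<in> hom C X Y. \<tau> Y \<cdot>\<^bsub>D\<^esub> farr F f = farr G f \<cdot>\<^bsub>D\<^esub> \<tau> X"
proof -
  obtain \<tau> where t: "\<forall>X \<in> Obj C. \<tau> X \<in> hom D (fobj F X) (fobj G X) \<and> iso_in D (\<tau> X)"
    and nat: "\<forall>X \<in> Obj C. \<forall>Y \<in> Obj C. \<forall>f \<in> hom C X Y. \<tau> Y \<cdot>\<^bsub>D\<^esub> farr F f = farr G f \<cdot>\<^bsub>D\<^esub> \<tau> X"
    using assms unfolding nat_isomorphic_def by blast
  have "\<forall>X \<in> Obj C. \<exists>s. s \<in> hom D (fobj G X) (fobj F X) \<and> s \<cdot>\<^bsub>D\<^esub> \<tau> X = Ident D (fobj F X) \<and>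
      \<tau> X \<cdot>\<^bsub>D\<^esub> s = Ident D (fobj G X)"
    using t iso_inE by metis
  then obtain \<sigma> where "\<forall>X \<in> Obj C. \<sigma> X \<in> hom D (fobj G X) (fobj F X) \<and>
      \<sigma> X \<cdot>\<^bsub>D\<^esub> \<tau> X = Ident D (fobj F X) \<and> \<tau> X \<cdot>\<^bsub>D\<^esub> \<sigma> X = Ident D (fobj G X)"
    by (rule bchoice[THEN exE])
  then show ?thesis
    using that[of \<tau> \<sigma>] t nat by blast
qed

text \<open>\<open>f\<close> is recovered from \<open>G (F f)\<close> by conjugating with
  \<open>\<tau>\<close> and \<open>\<sigma>\<close>, and conjugation is monotone. It takes one of
  the two isomorphisms of an equivalence, so it can be applied to either functor.\<close>

lemma order_faithful_left_inverse:
  assumes "pos_category C" "pos_category D" "pos_functor C D F" "pos_functor D C G"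
    and iso: "nat_isomorphic C C (comp_functor G F) id_functor"
  shows "order_faithful C D F"
  unfolding order_faithful_def
proof (intro ballI impI)
  interpret C: pos_category C by fact
  interpret D: pos_category D by fact
  interpret F: pos_functor C D F by fact
  interpret G: pos_functor D C G by fact
  obtain \<tau> \<sigma> where iso: "\<forall>X \<in> Obj C. \<tau> X \<in> hom C (fobj G (fobj F X)) X \<and>
      \<sigma> X \<in> hom C X (fobj G (fobj F X)) \<and> \<sigma> X \<cdot>\<^bsub>C\<^esub> \<tau> X = Ident C (fobj G (fobj F X)) \<and>
      \<tau> X \<cdot>\<^bsub>C\<^esub> \<sigma> X = Ident C X"
    and sq: "\<forall>X \<in> Obj C. \<forall>Y \<in> Obj C. \<forall>f \<in> hom C X Y.
      \<tau> Y \<cdot>\<^bsub>C\<^esub> farr G (farr F f) = f \<cdot>\<^bsub>C\<^esub> \<tau> X"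
    using nat_isomorphicE[OF iso] unfolding comp_functor_def id_functor_def pfunctor.simps .
  then have t: "\<And>X. X \<in> Obj C \<Longrightarrow> \<tau> X \<in> hom C (fobj G (fobj F X)) X"
    and s: "\<And>X. X \<in> Obj C \<Longrightarrow> \<sigma> X \<in> hom C X (fobj G (fobj F X))"
    and st: "\<And>X. X \<in> Obj C \<Longrightarrow> \<sigma> X \<cdot>\<^bsub>C\<^esub> \<tau> X = Ident C (fobj G (fobj F X))"
    and ts: "\<And>X. X \<in> Obj C \<Longrightarrow> \<tau> X \<cdot>\<^bsub>C\<^esub> \<sigma> X = Ident C X"
    and nat: "\<And>X Y f. \<lbrakk>X \<in> Obj C; Y \<in> Obj C; f \<in> hom C X Y\<rbrakk> \<Longrightarrow>
      \<tau> Y \<cdot>\<^bsub>C\<^esub> farr G (farr F f) = f \<cdot>\<^bsub>C\<^esub> \<tau> X"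
    by simp_all
  fix X Y f g
  assume X: "X \<in> Obj C" "Y \<in> Obj C" and f: "f \<in> hom C X Y" and g: "g \<in> hom C X Y"
    and le: "farr F f \<preceq>\<^bsub>D\<^esub> farr F g"
  have GF: "farr G (farr F h) \<in> hom C (fobj G (fobj F X)) (fobj G (fobj F Y))" if "h \<in> hom C X Y" for h
    using G.farr_hom[OF F.farr_hom[OF that]] .
  have eq: "(\<tau> Y \<cdot>\<^bsub>C\<^esub> farr G (farr F h)) \<cdot>\<^bsub>C\<^esub> \<sigma> X = h" if h: "h \<in> hom C X Y" for h
    unfolding nat[OF X h] C.comp_assoc[OF s[OF X(1)] t[OF X(1)] h] ts[OF X(1)] by (rule C.ident_right[OF h])
  have "farr G (farr F f) \<preceq>\<^bsub>C\<^esub> farr G (farr F g)"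
    by (rule G.farr_mono[OF F.farr_hom[OF f] F.farr_hom[OF g] le])
  then have "\<tau> Y \<cdot>\<^bsub>C\<^esub> farr G (farr F f) \<preceq>\<^bsub>C\<^esub> \<tau> Y \<cdot>\<^bsub>C\<^esub> farr G (farr F g)"
    by (rule C.comp_le(1)[OF _ GF[OF f] GF[OF g] t[OF X(2)]])
  from C.comp_le(2)[OF this C.comp_hom[OF GF[OF f] t[OF X(2)]] C.comp_hom[OF GF[OF g] t[OF X(2)]] s[OF X(1)]]
  show "f \<preceq>\<^bsub>C\<^esub> g"
    unfolding eq[OF f] eq[OF g] .
qed

lemma equivalence_functorD:
  assumes "pos_category C" "pos_category D" and eq: "equivalence_functor C D F"
  shows "order_faithful C D F" "full C D F"
    "\<And>Y. Y \<in> Obj D \<Longrightarrow> \<exists>X \<in> Obj C. \<exists>t \<in> hom D (fobj F X) Y. iso_in D t"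
proof -
  interpret C: pos_category C by fact
  interpret D: pos_category D by fact
  obtain G where "pos_functor C D F" "pos_functor D C G"
    and GF: "nat_isomorphic C C (comp_functor G F) id_functor"
    and FG: "nat_isomorphic D D (comp_functor F G) id_functor"
    using eq unfolding equivalence_functor_def by blast
  interpret F: pos_functor C D F by fact
  interpret G: pos_functor D C G by fact
  show "order_faithful C D F"
    by (rule order_faithful_left_inverse[OF assms(1,2) F.pos_functor_axioms G.pos_functor_axioms GF])
  have G_faithful: "order_faithful D C G"
    by (rule order_faithful_left_inverse[OF assms(2,1) G.pos_functor_axioms F.pos_functor_axioms FG])
  obtain \<tau> \<sigma> where iso: "\<forall>X \<in> Obj C. \<tau> X \<in> hom C (fobj G (fobj F X)) X \<and>
      \<sigma> X \<in> hom C X (fobj G (fobj F X)) \<and> \<sigma> X \<cdot>\<^bsub>C\<^esub> \<tau> X = Ident C (fobj G (fobj F X)) \<and>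
      \<tau> X \<cdot>\<^bsub>C\<^esub> \<sigma> X = Ident C X"
    and sq: "\<forall>X \<in> Obj C. \<forall>Y \<in> Obj C. \<forall>f \<in> hom C X Y.
      \<tau> Y \<cdot>\<^bsub>C\<^esub> farr G (farr F f) = f \<cdot>\<^bsub>C\<^esub> \<tau> X"
    using nat_isomorphicE[OF GF] unfolding comp_functor_def id_functor_def pfunctor.simps .
  then have t: "\<And>X. X \<in> Obj C \<Longrightarrow> \<tau> X \<in> hom C (fobj G (fobj F X)) X"
    and s: "\<And>X. X \<in> Obj C \<Longrightarrow> \<sigma> X \<in> hom C X (fobj G (fobj F X))"
    and st: "\<And>X. X \<in> Obj C \<Longrightarrow> \<sigma> X \<cdot>\<^bsub>C\<^esub> \<tau> X = Ident C (fobj G (fobj F X))"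
    and ts: "\<And>X. X \<in> Obj C \<Longrightarrow> \<tau> X \<cdot>\<^bsub>C\<^esub> \<sigma> X = Ident C X"
    and nat: "\<And>X Y f. \<lbrakk>X \<in> Obj C; Y \<in> Obj C; f \<in> hom C X Y\<rbrakk> \<Longrightarrow>
      \<tau> Y \<cdot>\<^bsub>C\<^esub> farr G (farr F f) = f \<cdot>\<^bsub>C\<^esub> \<tau> X"
    by simp_all
  show "full C D F"
    unfolding full_def
  proof (intro ballI)
    fix X Y h
    assume X: "X \<in> Obj C" "Y \<in> Obj C" and h: "h \<in> hom D (fobj F X) (fobj F Y)"
    note Gh = G.farr_hom[OF h]
    note Gs = C.comp_hom[OF s[OF X(1)] Gh]
    \<comment> \<open>Naturality of \<open>\<tau>\<close> forces any preimage of \<open>h\<close>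
      under \<open>F\<close> to be this conjugate of \<open>farr G h\<close>. That it is one follows
      after applying \<open>G\<close>, which is faithful as well.\<close>
    define u where "u = \<tau> Y \<cdot>\<^bsub>C\<^esub> (farr G h \<cdot>\<^bsub>C\<^esub> \<sigma> X)"
    have u: "u \<in> hom C X Y"
      unfolding u_def by (rule C.comp_hom[OF Gs t[OF X(2)]])
    note GFu = G.farr_hom[OF F.farr_hom[OF u]]
    have "\<tau> Y \<cdot>\<^bsub>C\<^esub> farr G (farr F u) = u \<cdot>\<^bsub>C\<^esub> \<tau> X"
      by (rule nat[OF X u])
    also have "\<dots> = \<tau> Y \<cdot>\<^bsub>C\<^esub> farr G h"
      unfolding u_def C.comp_assoc[OF t[OF X(1)] Gs t[OF X(2)]] C.comp_assoc[OF t[OF X(1)] s[OF X(1)] Gh]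
        st[OF X(1)] C.ident_right[OF Gh] ..
    finally have "\<sigma> Y \<cdot>\<^bsub>C\<^esub> (\<tau> Y \<cdot>\<^bsub>C\<^esub> farr G (farr F u)) = \<sigma> Y \<cdot>\<^bsub>C\<^esub> (\<tau> Y \<cdot>\<^bsub>C\<^esub> farr G h)"
      by simp
    then have "farr G (farr F u) = farr G h"
      unfolding C.comp_assoc[OF GFu t[OF X(2)] s[OF X(2)], symmetric]
        C.comp_assoc[OF Gh t[OF X(2)] s[OF X(2)], symmetric] st[OF X(2)]
        C.ident_left[OF GFu] C.ident_left[OF Gh] .
    then have "farr F u = h"
      by (rule order_faithful_eq[OF assms(2,1) G.pos_functor_axioms G_faithful F.farr_hom[OF u] h])
    then show "\<exists>f\<in>hom C X Y. farr F f = h"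
      using u by blast
  qed
  show "\<exists>X \<in> Obj C. \<exists>t \<in> hom D (fobj F X) Y. iso_in D t" if Y: "Y \<in> Obj D" for Y
    using FG G.fobj_Obj[OF Y] Y unfolding nat_isomorphic_def
    by (auto simp: comp_functor_def id_functor_def)
qed

text \<open>The inverse functor sends \<open>g\<close> to the preimage under \<open>F\<close> of its
  conjugate by chosen isomorphisms \<open>t\<close>. Its laws are verified after applying
  \<open>F\<close>, which is injective on hom-sets and reflects the order.\<close>

lemma equivalence_functorI:
  assumes "pos_category C" "pos_category D" "pos_functor C D F"
    and faithful: "order_faithful C D F" and full: "full C D F"
    and ess: "\<And>Y. Y \<in> Obj D \<Longrightarrow> \<exists>X \<in> Obj C. \<exists>t \<in> hom D (fobj F X) Y. iso_in D t"
  shows "equivalence_functor C D F"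
proof -
  interpret C: pos_category C by fact
  interpret D: pos_category D by fact
  interpret F: pos_functor C D F by fact
  note inj = order_faithful_eq[OF assms(1-4)]
  \<comment> \<open>The triple \<open>z\<close> bundles an object, an isomorphism and its inverse,
    so that a single choice selects all three together.\<close>
  have "\<forall>Y \<in> Obj D. \<exists>z. fst z \<in> Obj C \<and> fst (snd z) \<in> hom D (fobj F (fst z)) Y \<and>
      snd (snd z) \<in> hom D Y (fobj F (fst z)) \<and>
      snd (snd z) \<cdot>\<^bsub>D\<^esub> fst (snd z) = Ident D (fobj F (fst z)) \<and>
      fst (snd z) \<cdot>\<^bsub>D\<^esub> snd (snd z) = Ident D Y"
  proof
    fix Y
    assume "Y \<in> Obj D"
    then obtain X t where X: "X \<in> Obj C" "t \<in> hom D (fobj F X) Y" and iso: "iso_in D t"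
      using ess by blast
    obtain s where "s \<in> hom D Y (fobj F X)" "s \<cdot>\<^bsub>D\<^esub> t = Ident D (fobj F X)" "t \<cdot>\<^bsub>D\<^esub> s = Ident D Y"
      using iso_inE[OF iso X(2)] .
    then show "\<exists>z. fst z \<in> Obj C \<and> fst (snd z) \<in> hom D (fobj F (fst z)) Y \<and>
      snd (snd z) \<in> hom D Y (fobj F (fst z)) \<and>
      snd (snd z) \<cdot>\<^bsub>D\<^esub> fst (snd z) = Ident D (fobj F (fst z)) \<and>
      fst (snd z) \<cdot>\<^bsub>D\<^esub> snd (snd z) = Ident D Y"
      using X by (intro exI[of _ "(X, t, s)"]) simp
  qed
  then obtain z where z: "\<forall>Y \<in> Obj D. fst (z Y) \<in> Obj C \<and> fst (snd (z Y)) \<in> hom D (fobj F (fst (z Y))) Y \<and>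
      snd (snd (z Y)) \<in> hom D Y (fobj F (fst (z Y))) \<and>
      snd (snd (z Y)) \<cdot>\<^bsub>D\<^esub> fst (snd (z Y)) = Ident D (fobj F (fst (z Y))) \<and>
      fst (snd (z Y)) \<cdot>\<^bsub>D\<^esub> snd (snd (z Y)) = Ident D Y"
    by (rule bchoice[THEN exE])
  define G0 t s where "G0 = (\<lambda>Y. fst (z Y))" and "t = (\<lambda>Y. fst (snd (z Y)))" and "s = (\<lambda>Y. snd (snd (z Y)))"
  have G0: "G0 Y \<in> Obj C" and t: "t Y \<in> hom D (fobj F (G0 Y)) Y" and s: "s Y \<in> hom D Y (fobj F (G0 Y))"
    and st: "s Y \<cdot>\<^bsub>D\<^esub> t Y = Ident D (fobj F (G0 Y))" and ts: "t Y \<cdot>\<^bsub>D\<^esub> s Y = Ident D Y"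
    if "Y \<in> Obj D" for Y
    using z that by (auto simp: G0_def t_def s_def)
  define c where "c g = s (Cod D g) \<cdot>\<^bsub>D\<^esub> (g \<cdot>\<^bsub>D\<^esub> t (Dom D g))" for g
  have c: "c g = s Y' \<cdot>\<^bsub>D\<^esub> (g \<cdot>\<^bsub>D\<^esub> t Y)" "c g \<in> hom D (fobj F (G0 Y)) (fobj F (G0 Y'))"
      "t Y' \<cdot>\<^bsub>D\<^esub> c g = g \<cdot>\<^bsub>D\<^esub> t Y" if g: "g \<in> hom D Y Y'" for g Y Y'
  proof -
    have Y: "Y \<in> Obj D" "Y' \<in> Obj D"
      using D.hom_Obj g by auto
    note gt = D.comp_hom[OF t[OF Y(1)] g]
    show eq: "c g = s Y' \<cdot>\<^bsub>D\<^esub> (g \<cdot>\<^bsub>D\<^esub> t Y)"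
      using hom_dom_cod[OF g] by (simp add: c_def)
    show "c g \<in> hom D (fobj F (G0 Y)) (fobj F (G0 Y'))"
      unfolding eq by (rule D.comp_hom[OF gt s[OF Y(2)]])
    show "t Y' \<cdot>\<^bsub>D\<^esub> c g = g \<cdot>\<^bsub>D\<^esub> t Y"
      unfolding eq D.comp_assoc[OF gt s[OF Y(2)] t[OF Y(2)], symmetric] ts[OF Y(2)] by (rule D.ident_left[OF gt])
  qed
  have "\<exists>f. f \<in> hom C (G0 (Dom D g)) (G0 (Cod D g)) \<and> farr F f = c g" if "g \<in> Arr D" for g
    using full c(2)[OF D.arr_hom[OF that]] G0 D.dom_cod[OF that] unfolding full_def by blast
  then obtain G1 where G1: "\<forall>g\<in>Arr D. G1 g \<in> hom C (G0 (Dom D g)) (G0 (Cod D g)) \<and> farr F (G1 g) = c g"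
    by metis
  have G1_hom: "G1 g \<in> hom C (G0 Y) (G0 Y')" and FG1: "farr F (G1 g) = c g" if "g \<in> hom D Y Y'" for g Y Y'
    using G1 hom_dom_cod[OF that] by auto
  have t_mono: "u = v" if "t Y \<cdot>\<^bsub>D\<^esub> u = t Y \<cdot>\<^bsub>D\<^esub> v" "u \<in> hom D Z (fobj F (G0 Y))"
    "v \<in> hom D Z (fobj F (G0 Y))" "Y \<in> Obj D" for u v Z Y
    using that(1) D.comp_assoc[OF that(2) t[OF that(4)] s[OF that(4)]]
      D.comp_assoc[OF that(3) t[OF that(4)] s[OF that(4)]] st[OF that(4)]
      D.ident_left[OF that(2)] D.ident_left[OF that(3)] by simp
  define G where "G = \<lparr>fobj = G0, farr = G1\<rparr>"
  have G_simps: "fobj G = G0" "farr G = G1"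
    by (simp_all add: G_def)
  have Gf: "pos_functor D C G"
  proof (unfold_locales, unfold G_simps)
    show "G0 Y \<in> Obj C" if "Y \<in> Obj D" for Y
      by (rule G0[OF that])
    show "G1 g \<in> hom C (G0 Y) (G0 Y')" if "g \<in> hom D Y Y'" for g Y Y'
      by (rule G1_hom[OF that])
    show "G1 (Ident D Y) = Ident C (G0 Y)" if Y: "Y \<in> Obj D" for Y
    proof (rule inj[OF G1_hom[OF D.ident_hom[OF Y]] C.ident_hom[OF G0[OF Y]]])
      show "farr F (G1 (Ident D Y)) = farr F (Ident C (G0 Y))"
        unfolding FG1[OF D.ident_hom[OF Y]] c(1)[OF D.ident_hom[OF Y]] D.ident_left[OF t[OF Y]] st[OF Y]
          F.farr_ident[OF G0[OF Y]] ..
    qed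
    show "G1 (h \<cdot>\<^bsub>D\<^esub> g) = G1 h \<cdot>\<^bsub>C\<^esub> G1 g" if g: "g \<in> hom D X Y" and h: "h \<in> hom D Y Z" for g h X Y Z
    proof (rule inj[OF G1_hom[OF D.comp_hom[OF g h]] C.comp_hom[OF G1_hom[OF g] G1_hom[OF h]]])
      have O: "X \<in> Obj D" "Y \<in> Obj D" "Z \<in> Obj D"
        using D.hom_Obj g h by auto
      have "t Z \<cdot>\<^bsub>D\<^esub> (c h \<cdot>\<^bsub>D\<^esub> c g) = t Z \<cdot>\<^bsub>D\<^esub> c (h \<cdot>\<^bsub>D\<^esub> g)"
        unfolding D.comp_assoc[OF c(2)[OF g] c(2)[OF h] t[OF O(3)], symmetric] c(3)[OF h]
          D.comp_assoc[OF c(2)[OF g] t[OF O(2)] h] c(3)[OF g] c(3)[OF D.comp_hom[OF g h]]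
          D.comp_assoc[OF t[OF O(1)] g h] ..
      then have "c h \<cdot>\<^bsub>D\<^esub> c g = c (h \<cdot>\<^bsub>D\<^esub> g)"
        by (rule t_mono[OF _ D.comp_hom[OF c(2)[OF g] c(2)[OF h]] c(2)[OF D.comp_hom[OF g h]] O(3)])
      then show "farr F (G1 (h \<cdot>\<^bsub>D\<^esub> g)) = farr F (G1 h \<cdot>\<^bsub>C\<^esub> G1 g)"
        unfolding F.farr_comp[OF G1_hom[OF g] G1_hom[OF h]] FG1[OF g] FG1[OF h] FG1[OF D.comp_hom[OF g h]]
        by simp
    qed
    show "G1 f \<preceq>\<^bsub>C\<^esub> G1 g" if f: "f \<in> hom D X Y" and g: "g \<in> hom D X Y" and le: "f \<preceq>\<^bsub>D\<^esub> g" for f g X Y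
    proof -
      have O: "X \<in> Obj D" "Y \<in> Obj D"
        using D.hom_Obj f by auto
      have "f \<cdot>\<^bsub>D\<^esub> t X \<preceq>\<^bsub>D\<^esub> g \<cdot>\<^bsub>D\<^esub> t X"
        by (rule D.comp_le(2)[OF le f g t[OF O(1)]])
      then have "farr F (G1 f) \<preceq>\<^bsub>D\<^esub> farr F (G1 g)"
        unfolding FG1[OF f] FG1[OF g] c(1)[OF f] c(1)[OF g]
        by (rule D.comp_le(1)[OF _ D.comp_hom[OF t[OF O(1)] f] D.comp_hom[OF t[OF O(1)] g] s[OF O(2)]])
      then show ?thesis
        using faithful G1_hom[OF f] G1_hom[OF g] G0[OF O(1)] G0[OF O(2)]
        unfolding order_faithful_def by blast
    qed
  qed
  have FG: "nat_isomorphic D D (comp_functor F G) id_functor"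
    unfolding nat_isomorphic_def
  proof (intro exI[of _ t] conjI ballI)
    fix Y
    assume Y: "Y \<in> Obj D"
    show "t Y \<in> hom D (fobj (comp_functor F G) Y) (fobj id_functor Y)"
      using t[OF Y] by (simp add: comp_functor_def id_functor_def G_simps)
    show "iso_in D (t Y)"
      by (rule iso_inI[OF t[OF Y] s[OF Y] st[OF Y] ts[OF Y]])
  next
    fix X Y g
    assume "g \<in> hom D X Y"
    then show "t Y \<cdot>\<^bsub>D\<^esub> farr (comp_functor F G) g = farr id_functor g \<cdot>\<^bsub>D\<^esub> t X"
      using FG1 c(3) by (simp add: comp_functor_def id_functor_def G_simps)
  qed
  \<comment> \<open>The second natural isomorphism lives in \<open>C\<close>; its components are the
    preimages of the \<open>t (fobj F X)\<close> under \<open>F\<close>.\<close>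
  have "\<exists>m. m \<in> hom C (G0 (fobj F X)) X \<and> farr F m = t (fobj F X)" if "X \<in> Obj C" for X
    using full t[OF F.fobj_Obj[OF that]] G0[OF F.fobj_Obj[OF that]] that unfolding full_def by blast
  then obtain m where m: "\<forall>X\<in>Obj C. m X \<in> hom C (G0 (fobj F X)) X \<and> farr F (m X) = t (fobj F X)"
    by metis
  have GF: "nat_isomorphic C C (comp_functor G F) id_functor"
    unfolding nat_isomorphic_def
  proof (intro exI[of _ m] conjI ballI)
    fix X
    assume X: "X \<in> Obj C"
    note FX = F.fobj_Obj[OF X]
    have mX: "m X \<in> hom C (G0 (fobj F X)) X" "farr F (m X) = t (fobj F X)"
      using m X by auto
    then show "m X \<in> hom C (fobj (comp_functor G F) X) (fobj id_functor X)"
      by (simp add: comp_functor_def id_functor_def G_simps)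
    obtain n where n: "n \<in> hom C X (G0 (fobj F X))" "farr F n = s (fobj F X)"
      using full s[OF FX] G0[OF FX] X unfolding full_def by blast
    have "n \<cdot>\<^bsub>C\<^esub> m X = Ident C (G0 (fobj F X))"
      by (rule inj[OF C.comp_hom[OF mX(1) n(1)] C.ident_hom[OF G0[OF FX]]])
        (simp add: F.farr_comp[OF mX(1) n(1)] mX n st[OF FX] F.farr_ident[OF G0[OF FX]])
    moreover have "m X \<cdot>\<^bsub>C\<^esub> n = Ident C X"
      by (rule inj[OF C.comp_hom[OF n(1) mX(1)] C.ident_hom[OF X]])
        (simp add: F.farr_comp[OF n(1) mX(1)] mX n ts[OF FX] F.farr_ident[OF X])
    ultimately show "iso_in C (m X)"
      by (rule iso_inI[OF mX(1) n(1)])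
  next
    fix X Y f
    assume X: "X \<in> Obj C" "Y \<in> Obj C" and f: "f \<in> hom C X Y"
    note Ff = F.farr_hom[OF f]
    have mX: "m X \<in> hom C (G0 (fobj F X)) X" "farr F (m X) = t (fobj F X)"
      and mY: "m Y \<in> hom C (G0 (fobj F Y)) Y" "farr F (m Y) = t (fobj F Y)"
      using m X by auto
    have "m Y \<cdot>\<^bsub>C\<^esub> G1 (farr F f) = f \<cdot>\<^bsub>C\<^esub> m X"
      by (rule inj[OF C.comp_hom[OF G1_hom[OF Ff] mY(1)] C.comp_hom[OF mX(1) f]])
        (simp add: F.farr_comp[OF G1_hom[OF Ff] mY(1)] F.farr_comp[OF mX(1) f] mX mY FG1[OF Ff] c(3)[OF Ff])
    then show "m Y \<cdot>\<^bsub>C\<^esub> farr (comp_functor G F) f = farr id_functor f \<cdot>\<^bsub>C\<^esub> m X"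
      by (simp add: comp_functor_def id_functor_def G_simps)
  qed
  show ?thesis
    unfolding equivalence_functor_def using assms(3) Gf GF FG by blast
qed

section \<open>Comparison of \<open>F\<close> and \<open>Fbar\<close>\<close>

text \<open>\<open>\<tau>\<close> and \<open>\<sigma>\<close> are the two directions of the
  isomorphism between \<open>Fbar\<close> after \<open>Gamma\<close> and \<open>F\<close>. They are
  fixed as data, because every passage between the two functors is a composition with them.\<close>

locale extended_functor = E: reg_cat E + D: reg_cat D
  for E :: "('o, 'm) pcat" (structure) and D :: "('p, 'n) pcat" +
  fixes F :: "('o, 'm, 'p, 'n) pfunctor" and Fbar :: "(('o, 'm) qobj, ('o, 'm) qarr, 'p, 'n) pfunctor"
    and \<tau> \<sigma> :: "'o \<Rightarrow> 'n"
  assumes regular: "regular_functor E D F"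
    and regular_bar: "regular_functor (ex_reg E) D Fbar"
    and \<tau>: "X \<in> Obj E \<Longrightarrow> \<tau> X \<in> hom D (fobj Fbar (X, hom_rel E X)) (fobj F X)"
    and \<sigma>: "X \<in> Obj E \<Longrightarrow> \<sigma> X \<in> hom D (fobj F X) (fobj Fbar (X, hom_rel E X))"
    and \<sigma>\<tau>: "X \<in> Obj E \<Longrightarrow> \<sigma> X \<cdot>\<^bsub>D\<^esub> \<tau> X = Ident D (fobj Fbar (X, hom_rel E X))"
    and \<tau>\<sigma>: "X \<in> Obj E \<Longrightarrow> \<tau> X \<cdot>\<^bsub>D\<^esub> \<sigma> X = Ident D (fobj F X)"
    and nat: "f \<in> hom E X Y \<Longrightarrow> \<tau> Y \<cdot>\<^bsub>D\<^esub> farr Fbar (farr (Gamma E) f) = farr F f \<cdot>\<^bsub>D\<^esub> \<tau> X"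
begin

abbreviation comp_D (infixr "\<odot>" 70) where "g \<odot> f \<equiv> g \<cdot>\<^bsub>D\<^esub> f"
abbreviation le_D (infix "\<sqsubseteq>" 50) where "f \<sqsubseteq> g \<equiv> f \<preceq>\<^bsub>D\<^esub> g"

sublocale R: pos_category "ex_reg E"
  by (rule E.pos_category_ex_reg)

sublocale F: pos_functor E D F
  using regular unfolding regular_functor_def by blast

sublocale B: pos_functor "ex_reg E" D Fbar
  using regular_bar unfolding regular_functor_def by blast

lemma F_so: "so_morphism E e \<Longrightarrow> so_morphism D (farr F e)"
  using regular unfolding regular_functor_def by blast

lemma Fbar_so: "so_morphism (ex_reg E) e \<Longrightarrow> so_morphism D (farr Fbar e)"
  using regular_bar unfolding regular_functor_def by blast

lemma \<sigma>_nat: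
  assumes f: "f \<in> hom E X Y"
  shows "\<sigma> Y \<odot> farr F f = farr Fbar (farr (Gamma E) f) \<odot> \<sigma> X"
proof -
  have X: "X \<in> Obj E" "Y \<in> Obj E"
    using E.hom_Obj f by auto
  note Ff = F.farr_hom[OF f] and Bf = B.farr_hom[OF E.Gamma_hom(1)[OF f]]
  note s\<sigma> = D.comp_hom[OF \<sigma>[OF X(1)] Bf]
  have "\<sigma> Y \<odot> farr F f = \<sigma> Y \<odot> ((farr F f \<odot> \<tau> X) \<odot> \<sigma> X)"
    unfolding D.comp_assoc[OF \<sigma>[OF X(1)] \<tau>[OF X(1)] Ff] \<tau>\<sigma>[OF X(1)] D.ident_right[OF Ff] ..
  also have "\<dots> = (\<sigma> Y \<odot> \<tau> Y) \<odot> (farr Fbar (farr (Gamma E) f) \<odot> \<sigma> X)"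
    unfolding nat[OF f, symmetric] D.comp_assoc[OF \<sigma>[OF X(1)] Bf \<tau>[OF X(2)]]
      D.comp_assoc[OF s\<sigma> \<tau>[OF X(2)] \<sigma>[OF X(2)]] ..
  also have "\<dots> = farr Fbar (farr (Gamma E) f) \<odot> \<sigma> X"
    unfolding \<sigma>\<tau>[OF X(2)] by (rule D.ident_left[OF s\<sigma>])
  finally show ?thesis .
qed

text \<open>Precomposition with \<open>\<sigma> X\<close> moves the source of the quotient map to
  \<open>F X\<close>, where fullness of \<open>F\<close> can be used.\<close>

definition cover :: "'o \<Rightarrow> 'm set \<Rightarrow> 'n" where
  "cover X A = farr Fbar (E.quot X A) \<odot> \<sigma> X"

text \<open>The quotient map is a coinserter, hence \<open>so\<close>, and \<open>Fbar\<close>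
  preserves \<open>so\<close>-morphisms; the factor \<open>\<sigma> X\<close> is invertible.\<close>

lemma cover:
  assumes X: "X \<in> Obj E" and A: "congruence E X A"
  shows "cover X A \<in> hom D (fobj F X) (fobj Fbar (X, A))" "so_morphism D (cover X A)"
proof -
  note q = E.quot_hom(1)[OF X A]
  obtain T e0 e1 where e: "e0 \<in> hom E T X" "e1 \<in> hom E T X" "jointly_order_mono E e0 e1"
    and tab: "\<forall>B x y. x \<in> hom E B X \<longrightarrow> y \<in> hom E B X \<longrightarrow>
      (rel_mem E x y A \<longleftrightarrow> (\<exists>h \<in> hom E B T. e0 \<cdot> h = x \<and> e1 \<cdot> h = y))"
    using E.relE[OF E.congruenceD(1)[OF A] X X] .
  have "effective_epi (ex_reg E) (E.quot X A)"
    using E.quot_coinserter[OF X A e(1,2) tab] unfolding effective_epi_def by blast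
  then have "so_morphism D (farr Fbar (E.quot X A))"
    by (intro Fbar_so R.effective_epi_so)
  then show "so_morphism D (cover X A)"
    unfolding cover_def using D.so_comp D.so_split[OF \<sigma>[OF X] \<tau>[OF X] \<sigma>\<tau>[OF X]] \<sigma>[OF X] B.farr_hom[OF q]
    by blast
  show "cover X A \<in> hom D (fobj F X) (fobj Fbar (X, A))"
    unfolding cover_def by (rule D.comp_hom[OF \<sigma>[OF X] B.farr_hom[OF q]])
qed

lemma cover_comp:
  assumes X: "X \<in> Obj E" and A: "congruence E X A" and f: "f \<in> hom E T X"
  shows "cover X A \<odot> farr F f = farr Fbar (E.quot X A \<star> farr (Gamma E) f) \<odot> \<sigma> T"
proof -
  note q = E.quot_hom(1)[OF X A] and g = E.Gamma_hom(1)[OF f]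
  have T: "T \<in> Obj E"
    using E.hom_Obj f by blast
  show ?thesis
    unfolding cover_def D.comp_assoc[OF F.farr_hom[OF f] \<sigma>[OF X] B.farr_hom[OF q]] \<sigma>_nat[OF f]
      B.farr_comp[OF g q] D.comp_assoc[OF \<sigma>[OF T] B.farr_hom[OF g] B.farr_hom[OF q]] ..
qed

text \<open>Image of \<open>repr_square\<close> under \<open>Fbar\<close>. As
  \<open>cover X A\<close> and \<open>farr F p\<close> are covers, this equation determines
  \<open>farr Fbar u\<close>.\<close>

lemma Fbar_repr:
  assumes u: "u \<in> hom (ex_reg E) (X, A) (Y, A')" and r: "E.repr T p y u"
  shows "farr Fbar u \<odot> (cover X A \<odot> farr F p) = cover Y A' \<odot> farr F y"
proof -
  have X: "X \<in> Obj E" "Y \<in> Obj E" "congruence E X A" "congruence E Y A'"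
    using u unfolding E.ex_reg_hom_iff by auto
  note p = E.repr_hom[OF u r]
  have T: "T \<in> Obj E"
    using E.hom_Obj p by blast
  note qp = R.comp_hom[OF E.Gamma_hom(1)[OF p(1)] E.quot_hom(1)[OF X(1,3)]]
  have "farr Fbar u \<odot> (cover X A \<odot> farr F p) =
      farr Fbar (u \<star> (E.quot X A \<star> farr (Gamma E) p)) \<odot> \<sigma> T"
    unfolding cover_comp[OF X(1,3) p(1)] B.farr_comp[OF qp u]
      D.comp_assoc[OF \<sigma>[OF T] B.farr_hom[OF qp] B.farr_hom[OF u]] ..
  also have "\<dots> = cover Y A' \<odot> farr F y"
    unfolding E.repr_square[OF u r X] cover_comp[OF X(2,4) p(3)] ..
  finally show ?thesis .
qed

section \<open>Properties of \<open>F\<close> when \<open>Fbar\<close> is an equivalence\<close>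

lemma F_fully_order_faithful:
  assumes "full (ex_reg E) D Fbar" "order_faithful (ex_reg E) D Fbar"
  shows "fully_order_faithful E D F"
  unfolding fully_order_faithful_def
proof
  have Gobj: "(X, hom_rel E X) \<in> Obj (ex_reg E)" if "X \<in> Obj E" for X
    using that E.hom_rel(3) by simp
  show "order_faithful E D F"
    unfolding order_faithful_def
  proof (intro ballI impI)
    fix X Y f g
    assume X: "X \<in> Obj E" "Y \<in> Obj E" and f: "f \<in> hom E X Y" and g: "g \<in> hom E X Y"
      and le: "farr F f \<sqsubseteq> farr F g"
    \<comment> \<open>Conjugation by the isomorphisms turns the action of \<open>F\<close> into that
      of \<open>Fbar\<close> after \<open>Gamma\<close>, and \<open>Gamma\<close> reflects the
      order.\<close>
    have *: "(\<sigma> Y \<odot> farr F h) \<odot> \<tau> X = farr Fbar (farr (Gamma E) h)" if h: "h \<in> hom E X Y" for h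
      unfolding \<sigma>_nat[OF h] D.comp_assoc[OF \<tau>[OF X(1)] \<sigma>[OF X(1)] B.farr_hom[OF E.Gamma_hom(1)[OF h]]]
        \<sigma>\<tau>[OF X(1)] by (rule D.ident_right[OF B.farr_hom[OF E.Gamma_hom(1)[OF h]]])
    note Ff = F.farr_hom[OF f] and Fg = F.farr_hom[OF g]
    have "\<sigma> Y \<odot> farr F f \<sqsubseteq> \<sigma> Y \<odot> farr F g"
      by (rule D.comp_le(1)[OF le Ff Fg \<sigma>[OF X(2)]])
    from D.comp_le(2)[OF this D.comp_hom[OF Ff \<sigma>[OF X(2)]] D.comp_hom[OF Fg \<sigma>[OF X(2)]] \<tau>[OF X(1)]]
    have "farr Fbar (farr (Gamma E) f) \<sqsubseteq> farr Fbar (farr (Gamma E) g)"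
      unfolding *[OF f] *[OF g] .
    then have "farr (Gamma E) f \<unlhd> farr (Gamma E) g"
      using assms(2) E.Gamma_hom(1)[OF f] E.Gamma_hom(1)[OF g] Gobj X unfolding order_faithful_def by blast
    then show "f \<preceq> g"
      by (simp only: E.Gamma_le_iff[OF f g])
  qed
  show "full E D F"
    unfolding full_def
  proof (intro ballI)
    fix X Y h
    assume X: "X \<in> Obj E" "Y \<in> Obj E" and h: "h \<in> hom D (fobj F X) (fobj F Y)"
    note h\<tau> = D.comp_hom[OF \<tau>[OF X(1)] h]
    note k = D.comp_hom[OF h\<tau> \<sigma>[OF X(2)]]
    \<comment> \<open>The conjugate of \<open>h\<close> runs between images of \<open>Gamma\<close>,
      so it lifts first along \<open>Fbar\<close> and then along \<open>Gamma\<close>.\<close>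
    obtain u where u: "u \<in> hom (ex_reg E) (X, hom_rel E X) (Y, hom_rel E Y)"
      "farr Fbar u = \<sigma> Y \<odot> (h \<odot> \<tau> X)"
      using assms(1) k Gobj X unfolding full_def by blast
    obtain f where f: "f \<in> hom E X Y" "farr (Gamma E) f = u"
      using E.Gamma_full[OF u(1)] .
    note Ff = F.farr_hom[OF f(1)]
    have "farr F f \<odot> \<tau> X = \<tau> Y \<odot> (\<sigma> Y \<odot> (h \<odot> \<tau> X))"
      using nat[OF f(1)] f(2) u(2) by simp
    also have "\<dots> = h \<odot> \<tau> X"
      unfolding D.comp_assoc[OF h\<tau> \<sigma>[OF X(2)] \<tau>[OF X(2)], symmetric] \<tau>\<sigma>[OF X(2)]
      by (rule D.ident_left[OF h\<tau>])
    finally have "(farr F f \<odot> \<tau> X) \<odot> \<sigma> X = (h \<odot> \<tau> X) \<odot> \<sigma> X"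
      by simp
    then have "farr F f = h"
      unfolding D.comp_assoc[OF \<sigma>[OF X(1)] \<tau>[OF X(1)] Ff] D.comp_assoc[OF \<sigma>[OF X(1)] \<tau>[OF X(1)] h]
        \<tau>\<sigma>[OF X(1)] D.ident_right[OF Ff] D.ident_right[OF h] .
    then show "\<exists>f\<in>hom E X Y. farr F f = h"
      using f(1) by blast
  qed
qed

text \<open>Any \<open>Y\<close> is isomorphic to some \<open>Fbar (X, A)\<close>, and
  \<open>cover X A\<close> followed by that isomorphism is an \<open>so\<close>-morphism out of
  \<open>F X\<close>.\<close>

lemma F_covering:
  assumes ess: "\<And>Y. Y \<in> Obj D \<Longrightarrow> \<exists>P \<in> Obj (ex_reg E). \<exists>t \<in> hom D (fobj Fbar P) Y. iso_in D t"
  shows "covering E D F"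
  unfolding covering_def
proof
  fix Y
  assume "Y \<in> Obj D"
  then obtain P t where P: "P \<in> Obj (ex_reg E)" and t: "t \<in> hom D (fobj Fbar P) Y" and iso: "iso_in D t"
    using ess by blast
  obtain X A where PX: "P = (X, A)"
    by (cases P)
  then have X: "X \<in> Obj E" "congruence E X A"
    using P by auto
  obtain s where "s \<in> hom D Y (fobj Fbar P)" "t \<odot> s = Ident D Y"
    using iso_inE[OF iso t] by blast
  then have "so_morphism D t"
    by (rule D.so_split[OF t])
  then have so: "so_morphism D (t \<odot> cover X A)"
    using D.so_comp cover[OF X] t unfolding PX by blast
  have h: "t \<odot> cover X A \<in> hom D (fobj F X) Y"
    using D.comp_hom[OF cover(1)[OF X]] t unfolding PX by blast
  show "\<exists>X\<in>Obj E. \<exists>e\<in>hom D (fobj F X) Y. effective_epi D e"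
    using D.so_effective_epi[OF so h] h X(1) by blast
qed

end

section \<open>\<open>Fbar\<close> when \<open>F\<close> is fully order-faithful and
  covering\<close>

locale covering_functor = extended_functor E D F Fbar \<tau> \<sigma>
  for E (structure) and D F Fbar \<tau> \<sigma> +
  assumes F_full: "full E D F" and F_faithful: "order_faithful E D F" and F_cov: "covering E D F"
begin

lemma F_lift:
  assumes "X \<in> Obj E" "Y \<in> Obj E" "h \<in> hom D (fobj F X) (fobj F Y)"
  obtains f where "f \<in> hom E X Y" "farr F f = h"
  using F_full assms unfolding full_def by blast

lemma F_inj: "\<lbrakk>f \<in> hom E X Y; g \<in> hom E X Y; farr F f = farr F g\<rbrakk> \<Longrightarrow> f = g"
  by (rule order_faithful_eq[OF E.pos_category_axioms D.pos_category_axioms F.pos_functor_axioms F_faithful])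

lemma F_cover:
  assumes "W \<in> Obj D"
  obtains X w where "X \<in> Obj E" "w \<in> hom D (fobj F X) W" "so_morphism D w"
  using F_cov assms D.effective_epi_so unfolding covering_def by blast

text \<open>The \<open>ff\<close>-part \<open>m\<close> of \<open>p\<close> is sent to a morphism
  that is both \<open>so\<close> and \<open>ff\<close>, hence invertible. The inverse lifts by
  fullness, and by faithfulness the lift is a section of \<open>m\<close>, so \<open>m\<close> is
  \<open>so\<close>.\<close>

lemma F_reflects_so:
  assumes p: "p \<in> hom E A X" and so: "so_morphism D (farr F p)"
  shows "so_morphism E p"
proof -
  obtain e m where em: "so_morphism E e" "ff_morphism E m" "Cod E e = Dom E m" "p = m \<cdot> e"
    using E.factorization p unfolding hom_def by blast
  define I where "I = Dom E m"
  have "m \<in> Arr E" "e \<in> Arr E"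
    using em E.ff_arr E.so_arr by auto
  then have m: "m \<in> hom E I X" and e: "e \<in> hom E A I"
    using em(3) p unfolding em(4) I_def by (auto simp: hom_def)
  have O: "I \<in> Obj E" "X \<in> Obj E"
    using E.hom_Obj m by auto
  note Fm = F.farr_hom[OF m]
  have "so_morphism D (farr F m)"
    using D.so_cancel[OF _ F.farr_hom[OF e] Fm] so unfolding em(4) F.farr_comp[OF e m] by blast
  moreover have "ff_morphism D (farr F m)"
    using preserves_ff[OF E.pos_category_axioms D.pos_category_axioms F.pos_functor_axioms _ E.finite_limits em(2)]
      regular unfolding regular_functor_def by blast
  ultimately obtain k where k: "k \<in> hom D (fobj F X) (fobj F I)" "farr F m \<odot> k = Ident D (fobj F X)"
    using D.so_ff_iso Fm by blast
  obtain n where n: "n \<in> hom E X I" "farr F n = k"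
    using F_lift[OF O(2,1) k(1)] .
  have "m \<cdot> n = Ident E X"
    by (rule F_inj[OF E.comp_hom[OF n(1) m] E.ident_hom[OF O(2)]])
      (simp add: F.farr_comp[OF n(1) m] n(2) k(2) F.farr_ident[OF O(2)])
  then have "so_morphism E m"
    by (rule E.so_split[OF m n(1)])
  then show ?thesis
    unfolding em(4) by (rule E.so_comp[OF em(1) _ e m])
qed

text \<open>The pullback in \<open>D\<close> need not lie in the image of \<open>F\<close>. Covering
  it by some \<open>F A\<close> and lifting the two legs moves the span into \<open>E\<close>, and
  since \<open>F\<close> reflects covers, \<open>p\<close> is again one.\<close>

lemma F_joint_cover:
  assumes X: "X \<in> Obj E" "Y \<in> Obj E" and f: "f \<in> hom D (fobj F X) B"
    and g: "g \<in> hom D (fobj F Y) B" "so_morphism D g"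
  obtains A p y where "p \<in> hom E A X" "so_morphism E p" "y \<in> hom E A Y" "f \<odot> farr F p = g \<odot> farr F y"
proof -
  obtain W a b where W: "a \<in> hom D W (fobj F X)" "so_morphism D a" "b \<in> hom D W (fobj F Y)" "f \<odot> a = g \<odot> b"
    using D.lift_along_so[OF g(2,1) f] .
  obtain A w where A: "A \<in> Obj E" and w: "w \<in> hom D (fobj F A) W" "so_morphism D w"
    using F_cover D.hom_Obj(1)[OF W(1)] by blast
  obtain p where p: "p \<in> hom E A X" "farr F p = a \<odot> w"
    using F_lift[OF A X(1) D.comp_hom[OF w(1) W(1)]] .
  obtain y where y: "y \<in> hom E A Y" "farr F y = b \<odot> w"
    using F_lift[OF A X(2) D.comp_hom[OF w(1) W(3)]] .
  have "so_morphism E p"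
    using F_reflects_so[OF p(1)] D.so_comp[OF w(2) W(2) w(1) W(1)] p(2) by simp
  moreover have "f \<odot> farr F p = g \<odot> farr F y"
    unfolding p(2) y(2) D.comp_assoc[OF w(1) W(1) f, symmetric] D.comp_assoc[OF w(1) W(3) g(1), symmetric]
      W(4) ..
  ultimately show ?thesis
    using that p(1) y(1) by blast
qed

text \<open>\<open>Fbar\<close> preserves the comma object of the quotient map with itself, so an
  inequality after \<open>cover X A\<close> gives a factorization \<open>k\<close> through the image
  of the tabulation of \<open>A\<close>. Fullness of \<open>F\<close> brings \<open>k\<close> back
  to \<open>E\<close>, where it witnesses membership.\<close>

lemma cover_le_iff:
  assumes X: "X \<in> Obj E" and A: "congruence E X A" and x: "x \<in> hom E T X" and y: "y \<in> hom E T X"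
  shows "cover X A \<odot> farr F x \<sqsubseteq> cover X A \<odot> farr F y \<longleftrightarrow> rel_mem E x y A"
proof
  have T: "T \<in> Obj E"
    using E.hom_Obj x by blast
  note q = E.quot_hom(1)[OF X A] and gx = E.Gamma_hom(1)[OF x] and gy = E.Gamma_hom(1)[OF y]
  note qx = R.comp_hom[OF gx q] and qy = R.comp_hom[OF gy q]
  {
    assume "rel_mem E x y A"
    then have "E.quot X A \<star> farr (Gamma E) x \<unlhd> E.quot X A \<star> farr (Gamma E) y"
      by (simp only: E.quot_le_iff[OF X A x y])
    then have "farr Fbar (E.quot X A \<star> farr (Gamma E) x) \<sqsubseteq> farr Fbar (E.quot X A \<star> farr (Gamma E) y)"
      by (rule B.farr_mono[OF qx qy])
    then show "cover X A \<odot> farr F x \<sqsubseteq> cover X A \<odot> farr F y"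
      unfolding cover_comp[OF X A x] cover_comp[OF X A y]
      by (rule D.comp_le(2)[OF _ B.farr_hom[OF qx] B.farr_hom[OF qy] \<sigma>[OF T]])
  }
  assume le: "cover X A \<odot> farr F x \<sqsubseteq> cover X A \<odot> farr F y"
  have *: "(cover X A \<odot> farr F f) \<odot> \<tau> T = farr Fbar (E.quot X A) \<odot> farr Fbar (farr (Gamma E) f)"
    if f: "f \<in> hom E T X" for f
    unfolding cover_comp[OF X A f] B.farr_comp[OF E.Gamma_hom(1)[OF f] q, symmetric]
      D.comp_assoc[OF \<tau>[OF T] \<sigma>[OF T] B.farr_hom[OF R.comp_hom[OF E.Gamma_hom(1)[OF f] q]]] \<sigma>\<tau>[OF T]
    by (rule D.ident_right[OF B.farr_hom[OF R.comp_hom[OF E.Gamma_hom(1)[OF f] q]]])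
  have le': "farr Fbar (E.quot X A) \<odot> farr Fbar (farr (Gamma E) x) \<sqsubseteq>
      farr Fbar (E.quot X A) \<odot> farr Fbar (farr (Gamma E) y)"
    using D.comp_le(2)[OF le D.comp_hom[OF F.farr_hom[OF x] cover(1)[OF X A]]
        D.comp_hom[OF F.farr_hom[OF y] cover(1)[OF X A]] \<tau>[OF T]]
    unfolding *[OF x] *[OF y] .
  obtain S e0 e1 where e: "e0 \<in> hom E S X" "e1 \<in> hom E S X" and j: "jointly_order_mono E e0 e1"
    and tab: "\<forall>B x y. x \<in> hom E B X \<longrightarrow> y \<in> hom E B X \<longrightarrow>
      (rel_mem E x y A \<longleftrightarrow> (\<exists>h \<in> hom E B S. e0 \<cdot> h = x \<and> e1 \<cdot> h = y))"
    using E.relE[OF E.congruenceD(1)[OF A] X X] .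
  have S: "S \<in> Obj E"
    using E.hom_Obj e by blast
  have com: "is_comma D (farr Fbar (E.quot X A)) (farr Fbar (E.quot X A))
      (farr Fbar (farr (Gamma E) e0)) (farr Fbar (farr (Gamma E) e1))"
    using preserves_comma[OF R.pos_category_axioms D.pos_category_axioms B.pos_functor_axioms _
        E.quot_comma[OF X A e j tab]] regular_bar unfolding regular_functor_def by blast
  obtain k where k: "k \<in> hom D (fobj Fbar (T, hom_rel E T)) (fobj Fbar (S, hom_rel E S))"
    "farr Fbar (farr (Gamma E) e0) \<odot> k = farr Fbar (farr (Gamma E) x)"
    "farr Fbar (farr (Gamma E) e1) \<odot> k = farr Fbar (farr (Gamma E) y)"
    using D.comma_lift[OF com B.farr_hom[OF E.Gamma_hom(1)[OF e(1)]] B.farr_hom[OF E.Gamma_hom(1)[OF e(2)]]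
        B.farr_hom[OF gx] B.farr_hom[OF gy] le'] .
  note ks = D.comp_hom[OF \<sigma>[OF T] k(1)]
  \<comment> \<open>\<open>k\<close> runs between images under \<open>Fbar\<close> of objects from
    \<open>Gamma\<close>; conjugated by the isomorphisms it runs from \<open>F T\<close> to
    \<open>F S\<close> and can be lifted.\<close>
  obtain h where h: "h \<in> hom E T S" "farr F h = \<tau> S \<odot> (k \<odot> \<sigma> T)"
    using F_lift[OF T S D.comp_hom[OF ks \<tau>[OF S]]] .
  have **: "e \<cdot> h = f"
    if e: "e \<in> hom E S X" and f: "f \<in> hom E T X"
      and ek: "farr Fbar (farr (Gamma E) e) \<odot> k = farr Fbar (farr (Gamma E) f)" for e f
  proof (rule F_inj[OF E.comp_hom[OF h(1) e] f])
    note Be = B.farr_hom[OF E.Gamma_hom(1)[OF e]] and Bf = B.farr_hom[OF E.Gamma_hom(1)[OF f]]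
    note Ff = F.farr_hom[OF f]
    have "farr F (e \<cdot> h) = (farr F e \<odot> \<tau> S) \<odot> (k \<odot> \<sigma> T)"
      unfolding F.farr_comp[OF h(1) e] h(2) D.comp_assoc[OF ks \<tau>[OF S] F.farr_hom[OF e]] ..
    also have "\<dots> = \<tau> X \<odot> ((farr Fbar (farr (Gamma E) e) \<odot> k) \<odot> \<sigma> T)"
      unfolding nat[OF e, symmetric] D.comp_assoc[OF ks Be \<tau>[OF X]] D.comp_assoc[OF \<sigma>[OF T] k(1) Be] ..
    also have "\<dots> = (farr F f \<odot> \<tau> T) \<odot> \<sigma> T"
      unfolding ek D.comp_assoc[OF \<sigma>[OF T] Bf \<tau>[OF X], symmetric] nat[OF f] ..
    also have "\<dots> = farr F f"
      unfolding D.comp_assoc[OF \<sigma>[OF T] \<tau>[OF T] Ff] \<tau>\<sigma>[OF T] by (rule D.ident_right[OF Ff])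
    finally show "farr F (e \<cdot> h) = farr F f" .
  qed
  show "rel_mem E x y A"
    using tab x y h(1) **[OF e(1) x k(2)] **[OF e(2) y k(3)] by blast
qed

lemma Fbar_order_faithful: "order_faithful (ex_reg E) D Fbar"
  unfolding order_faithful_def
proof (intro ballI impI)
  fix P Q u v
  assume u: "u \<in> hom (ex_reg E) P Q" and v: "v \<in> hom (ex_reg E) P Q" and le: "farr Fbar u \<sqsubseteq> farr Fbar v"
  obtain X A Y A' where PQ: "P = (X, A)" "Q = (Y, A')"
    by (metis surj_pair)
  note u' = u[unfolded PQ] and v' = v[unfolded PQ]
  have X: "X \<in> Obj E" "Y \<in> Obj E" "congruence E X A" "congruence E Y A'"
    using u' unfolding E.ex_reg_hom_iff by auto
  obtain T p y z where r: "E.repr T p y u" "E.repr T p z v"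
    using E.repr_common[OF u' v'] .
  note p = E.repr_hom[OF u' r(1)] and z = E.repr_hom(3)[OF v' r(2)]
  have "cover Y A' \<odot> farr F y \<sqsubseteq> cover Y A' \<odot> farr F z"
    unfolding Fbar_repr[OF u' r(1), symmetric] Fbar_repr[OF v' r(2), symmetric]
    by (rule D.comp_le(2)[OF le B.farr_hom[OF u'] B.farr_hom[OF v']
          D.comp_hom[OF F.farr_hom[OF p(1)] cover(1)[OF X(1,3)]]])
  then show "u \<unlhd> v"
    unfolding E.repr_le_iff[OF u' v' r] cover_le_iff[OF X(2,4) p(3) z] .
qed

text \<open>The arrow \<open>h\<close> is followed on covers: \<open>h\<close> after
  \<open>cover X A\<close> and the cover of the target are matched by a span in \<open>E\<close>,
  which presents the preimage \<open>u\<close>. Then \<open>farr Fbar u\<close> and \<open>h\<close>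
  agree after precomposition with two covers.\<close>

lemma Fbar_full: "full (ex_reg E) D Fbar"
  unfolding full_def
proof (intro ballI)
  fix P Q h
  assume P: "P \<in> Obj (ex_reg E)" and Q: "Q \<in> Obj (ex_reg E)" and h: "h \<in> hom D (fobj Fbar P) (fobj Fbar Q)"
  obtain X A Y A' where PQ: "P = (X, A)" "Q = (Y, A')"
    by (metis surj_pair)
  have X: "X \<in> Obj E" "Y \<in> Obj E" "congruence E X A" "congruence E Y A'"
    using P Q unfolding PQ by auto
  note h' = h[unfolded PQ]
  note cX = cover[OF X(1,3)] and cY = cover[OF X(2,4)]
  note hc = D.comp_hom[OF cX(1) h']
  obtain T p y where p: "p \<in> hom E T X" "so_morphism E p" "y \<in> hom E T Y"
    and eq: "(h \<odot> cover X A) \<odot> farr F p = cover Y A' \<odot> farr F y"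
    using F_joint_cover[OF X(1,2) hc cY] .
  \<comment> \<open>Compatibility of the span with the congruences is read off in \<open>D\<close>,
    where \<open>A\<close> and \<open>A'\<close> are the kernels of the covers and \<open>h\<close>
    is monotone under composition.\<close>
  have ker: "rel_mem E (y \<cdot> a) (y \<cdot> b) A'"
    if a: "a \<in> hom E B T" and b: "b \<in> hom E B T" and ab: "rel_mem E (p \<cdot> a) (p \<cdot> b) A" for B a b
  proof -
    note pa = E.comp_hom[OF a p(1)] and pb = E.comp_hom[OF b p(1)]
    have *: "cover Y A' \<odot> farr F (y \<cdot> c) = h \<odot> (cover X A \<odot> farr F (p \<cdot> c))" if c: "c \<in> hom E B T" for c
    proof -
      note Fc = F.farr_hom[OF c] and Fp = F.farr_hom[OF p(1)] and Fy = F.farr_hom[OF p(3)]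
      have "cover Y A' \<odot> farr F (y \<cdot> c) = ((h \<odot> cover X A) \<odot> farr F p) \<odot> farr F c"
        unfolding F.farr_comp[OF c p(3)] eq D.comp_assoc[OF Fc Fy cY(1)] ..
      also have "\<dots> = h \<odot> (cover X A \<odot> farr F (p \<cdot> c))"
        unfolding F.farr_comp[OF c p(1)] D.comp_assoc[OF Fc Fp hc]
          D.comp_assoc[OF D.comp_hom[OF Fc Fp] cX(1) h'] ..
      finally show ?thesis .
    qed
    have "cover X A \<odot> farr F (p \<cdot> a) \<sqsubseteq> cover X A \<odot> farr F (p \<cdot> b)"
      unfolding cover_le_iff[OF X(1,3) pa pb] by (rule ab)
    then have "cover Y A' \<odot> farr F (y \<cdot> a) \<sqsubseteq> cover Y A' \<odot> farr F (y \<cdot> b)"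
      unfolding *[OF a] *[OF b]
      by (rule D.comp_le(1)[OF _ D.comp_hom[OF F.farr_hom[OF pa] cX(1)] D.comp_hom[OF F.farr_hom[OF pb] cX(1)] h'])
    then show ?thesis
      unfolding cover_le_iff[OF X(2,4) E.comp_hom[OF a p(3)] E.comp_hom[OF b p(3)]] .
  qed
  obtain u where u: "u \<in> hom (ex_reg E) (X, A) (Y, A')" and r: "E.repr T p y u"
    by (rule E.repr_construct[OF X p]) (rule ker)
  note Bu = B.farr_hom[OF u]
  have "(farr Fbar u \<odot> cover X A) \<odot> farr F p = (h \<odot> cover X A) \<odot> farr F p"
    unfolding eq D.comp_assoc[OF F.farr_hom[OF p(1)] cX(1) Bu] by (rule Fbar_repr[OF u r])
  then have "farr Fbar u \<odot> cover X A = h \<odot> cover X A"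
    by (rule D.so_epi[OF F_so[OF p(2)] F.farr_hom[OF p(1)] D.comp_hom[OF cX(1) Bu] hc])
  then have "farr Fbar u = h"
    by (rule D.so_epi[OF cX(2,1) Bu h'])
  then show "\<exists>u\<in>hom (ex_reg E) P Q. farr Fbar u = h"
    using u unfolding PQ by blast
qed

section \<open>Essential surjectivity of \<open>Fbar\<close>\<close>

lemma kernel_congruence:
  assumes X: "X \<in> Obj E" and e: "e \<in> hom D (fobj F X) Y"
  obtains A where "congruence E X A"
    "\<And>T x y. \<lbrakk>x \<in> hom E T X; y \<in> hom E T X\<rbrakk> \<Longrightarrow> rel_mem E x y A \<longleftrightarrow> e \<odot> farr F x \<sqsubseteq> e \<odot> farr F y"
proof -
  obtain K c0 c1 where com: "is_comma D e e c0 c1"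
    and c: "c0 \<in> hom D K (fobj F X)" "c1 \<in> hom D K (fobj F X)" "e \<odot> c0 \<sqsubseteq> e \<odot> c1"
    using D.commaE[OF e e] .
  obtain Z w where Z: "Z \<in> Obj E" and w: "w \<in> hom D (fobj F Z) K" "so_morphism D w"
    using F_cover D.hom_Obj(1)[OF c(1)] by blast
  obtain z0 where z0: "z0 \<in> hom E Z X" "farr F z0 = c0 \<odot> w"
    using F_lift[OF Z X D.comp_hom[OF w(1) c(1)]] .
  obtain z1 where z1: "z1 \<in> hom E Z X" "farr F z1 = c1 \<odot> w"
    using F_lift[OF Z X D.comp_hom[OF w(1) c(2)]] .
  note pz = E.pairing[OF z0(1) z1(1)]
  obtain s m where sm: "so_morphism E s" "ff_morphism E m" "Cod E s = Dom E m" "pairing E z0 z1 = m \<cdot> s"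
    using E.factorization pz(1) unfolding hom_def by blast
  define I where "I = Dom E m"
  have "m \<in> Arr E" "s \<in> Arr E"
    using sm E.ff_arr E.so_arr by auto
  then have m: "m \<in> hom E I (prod_obj E X X)" and s: "s \<in> hom E Z I"
    using sm(3) pz(1) unfolding sm(4) I_def by (auto simp: hom_def)
  define r0 r1 where "r0 = prj0 E X X \<cdot> m" and "r1 = prj1 E X X \<cdot> m"
  have r: "r0 \<in> hom E I X" "r1 \<in> hom E I X" and j: "jointly_order_mono E r0 r1"
    unfolding r0_def r1_def using E.prj_comp_hom[OF X X m] E.jointly_order_mono_prj[OF X X m sm(2)] by auto
  have rs: "r0 \<cdot> s = z0" "r1 \<cdot> s = z1"
    unfolding r0_def r1_def using E.comp_assoc[OF s m] E.prj_hom[OF X X] pz(2,3) sm(4) by auto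
  obtain A where A: "A \<in> relations E X X"
    and mem: "\<And>T x y. \<lbrakk>x \<in> hom E T X; y \<in> hom E T X\<rbrakk> \<Longrightarrow>
      rel_mem E x y A \<longleftrightarrow> (\<exists>h \<in> hom E T I. r0 \<cdot> h = x \<and> r1 \<cdot> h = y)"
    by (rule E.relations_span[OF r j]) blast
  note Fr = F.farr_hom[OF r(1)] F.farr_hom[OF r(2)] and Fs = F.farr_hom[OF s]
  have F_rs: "farr F r0 \<odot> farr F s = c0 \<odot> w" "farr F r1 \<odot> farr F s = c1 \<odot> w"
    using F.farr_comp[OF s r(1)] F.farr_comp[OF s r(2)] rs z0(2) z1(2) by auto
  \<comment> \<open>The inequality is known for \<open>c0\<close> and \<open>c1\<close>, to which
    \<open>r0\<close> and \<open>r1\<close> are linked only after the cover \<open>farr F s\<close>;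
    so it is proved there and the cover is cancelled.\<close>
  have er: "e \<odot> farr F r0 \<sqsubseteq> e \<odot> farr F r1"
  proof (rule D.so_order_epi[OF F_so[OF sm(1)] Fs D.comp_hom[OF Fr(1) e] D.comp_hom[OF Fr(2) e]])
    show "(e \<odot> farr F r0) \<odot> farr F s \<sqsubseteq> (e \<odot> farr F r1) \<odot> farr F s"
      unfolding D.comp_assoc[OF Fs Fr(1) e] D.comp_assoc[OF Fs Fr(2) e] F_rs
        D.comp_assoc[OF w(1) c(1) e, symmetric] D.comp_assoc[OF w(1) c(2) e, symmetric]
      by (rule D.comp_le(2)[OF c(3) D.comp_hom[OF c(1) e] D.comp_hom[OF c(2) e] w(1)])
  qed
  have iff: "rel_mem E x y A \<longleftrightarrow> e \<odot> farr F x \<sqsubseteq> e \<odot> farr F y"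
    if x: "x \<in> hom E T X" and y: "y \<in> hom E T X" for T x y
  proof
    assume "rel_mem E x y A"
    then obtain h where h: "h \<in> hom E T I" "r0 \<cdot> h = x" "r1 \<cdot> h = y"
      using mem[OF x y] by blast
    note Fh = F.farr_hom[OF h(1)]
    have "farr F x = farr F r0 \<odot> farr F h" "farr F y = farr F r1 \<odot> farr F h"
      using F.farr_comp[OF h(1) r(1)] F.farr_comp[OF h(1) r(2)] h(2,3) by auto
    then show "e \<odot> farr F x \<sqsubseteq> e \<odot> farr F y"
      using D.comp_le(2)[OF er D.comp_hom[OF Fr(1) e] D.comp_hom[OF Fr(2) e] Fh]
        D.comp_assoc[OF Fh Fr(1) e] D.comp_assoc[OF Fh Fr(2) e] by simp
  next
    assume le: "e \<odot> farr F x \<sqsubseteq> e \<odot> farr F y"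
    have T: "T \<in> Obj E"
      using E.hom_Obj x by blast
    obtain k where k: "k \<in> hom D (fobj F T) K" "c0 \<odot> k = farr F x" "c1 \<odot> k = farr F y"
      using D.comma_lift[OF com c(1,2) F.farr_hom[OF x] F.farr_hom[OF y] le] .
    \<comment> \<open>\<open>k\<close> lands in \<open>K\<close> and lifts to \<open>Z\<close> only
      locally. The cover \<open>b\<close> is found in \<open>E\<close>, so that membership descends
      along it there.\<close>
    obtain B b l where b: "b \<in> hom E B T" "so_morphism E b" and l: "l \<in> hom E B Z"
      and kb: "k \<odot> farr F b = w \<odot> farr F l"
      using F_joint_cover[OF T Z k(1) w] .
    note Fb = F.farr_hom[OF b(1)] and Fl = F.farr_hom[OF l]
    have *: "v \<cdot> b = z \<cdot> l"
      if v: "v \<in> hom E T X" and z: "z \<in> hom E Z X" and d: "d \<in> hom D K (fobj F X)"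
        and dv: "d \<odot> k = farr F v" and dz: "farr F z = d \<odot> w" for v z d
    proof (rule F_inj[OF E.comp_hom[OF b(1) v] E.comp_hom[OF l z]])
      show "farr F (v \<cdot> b) = farr F (z \<cdot> l)"
        unfolding F.farr_comp[OF b(1) v] F.farr_comp[OF l z] dv[symmetric] dz
          D.comp_assoc[OF Fb k(1) d] D.comp_assoc[OF Fl w(1) d] kb ..
    qed
    have "r0 \<cdot> (s \<cdot> l) = x \<cdot> b" "r1 \<cdot> (s \<cdot> l) = y \<cdot> b"
      using E.comp_assoc[OF l s r(1)] E.comp_assoc[OF l s r(2)] rs
        *[OF x z0(1) c(1) k(2) z0(2)] *[OF y z1(1) c(2) k(3) z1(2)] by auto
    then have "rel_mem E (x \<cdot> b) (y \<cdot> b) A"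
      using mem[OF E.comp_hom[OF b(1) x] E.comp_hom[OF b(1) y]] E.comp_hom[OF l s] by blast
    then show "rel_mem E x y A"
      by (rule E.rel_mem_descent[OF A x y b])
  qed
  have eF: "e \<odot> farr F x \<in> hom D (fobj F T) Y" if "x \<in> hom E T X" for x T
    by (rule D.comp_hom[OF F.farr_hom[OF that] e])
  have eF_le: "e \<odot> farr F x \<sqsubseteq> e \<odot> farr F y" if "x \<in> hom E T X" "y \<in> hom E T X" "x \<preceq> y" for x y T
    by (rule D.comp_le(1)[OF F.farr_mono[OF that] F.farr_hom[OF that(1)] F.farr_hom[OF that(2)] e])
  \<comment> \<open>By \<open>iff\<close>, membership is an order on a hom-set of \<open>D\<close>
    pulled back along the monotone map sending \<open>x\<close> to
    \<open>e \<odot> farr F x\<close>, so the congruence laws are laws of that order.\<close>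
  have "congruence E X A"
    unfolding congruence_def weakening_closed_def reflexive_rel_def transitive_rel_def
  proof (intro conjI A ballI impI)
    fix T x x' y y'
    assume x: "x \<in> hom E T X" "x' \<in> hom E T X" and y: "y \<in> hom E T X" "y' \<in> hom E T X"
      and h: "x' \<preceq> x \<and> rel_mem E x y A \<and> y \<preceq> y'"
    then have l: "e \<odot> farr F x' \<sqsubseteq> e \<odot> farr F x" "e \<odot> farr F x \<sqsubseteq> e \<odot> farr F y"
      "e \<odot> farr F y \<sqsubseteq> e \<odot> farr F y'"
      using eF_le[OF x(2,1)] eF_le[OF y] iff[OF x(1) y(1)] by auto
    have "e \<odot> farr F x' \<sqsubseteq> e \<odot> farr F y'"
      by (rule D.le_trans[OF eF[OF x(2)] eF[OF y(1)] eF[OF y(2)]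
            D.le_trans[OF eF[OF x(2)] eF[OF x(1)] eF[OF y(1)] l(1,2)] l(3)])
    then show "rel_mem E x' y' A"
      unfolding iff[OF x(2) y(2)] .
  next
    fix T x
    assume x: "x \<in> hom E T X"
    show "rel_mem E x x A"
      unfolding iff[OF x x] by (rule D.le_refl[OF eF[OF x]])
  next
    fix T x y z
    assume x: "x \<in> hom E T X" and y: "y \<in> hom E T X" and z: "z \<in> hom E T X"
      and h: "rel_mem E x y A \<and> rel_mem E y z A"
    show "rel_mem E x z A"
      using h D.le_trans[OF eF[OF x] eF[OF y] eF[OF z]] unfolding iff[OF x y] iff[OF y z] iff[OF x z] by blast
  qed
  then show ?thesis
    using that iff by blast
qed

text \<open>The congruence describes the kernel only on elements coming from \<open>E\<close>, while
  \<open>so_factor\<close> asks for arbitrary stages \<open>T\<close> of \<open>D\<close>. A cover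
  of \<open>T\<close> by some \<open>F A\<close> turns \<open>s\<close> and \<open>t\<close> into
  images of \<open>F\<close>, and the resulting inequality is cancelled along the cover.\<close>

lemma kernel_le_tested:
  assumes X: "X \<in> Obj E" and f: "f \<in> hom D (fobj F X) Y" and g: "g \<in> hom D (fobj F X) Z"
    and le: "\<And>A x y. \<lbrakk>x \<in> hom E A X; y \<in> hom E A X; f \<odot> farr F x \<sqsubseteq> f \<odot> farr F y\<rbrakk> \<Longrightarrow>
      g \<odot> farr F x \<sqsubseteq> g \<odot> farr F y"
    and s: "s \<in> hom D T (fobj F X)" and t: "t \<in> hom D T (fobj F X)" and st: "f \<odot> s \<sqsubseteq> f \<odot> t"
  shows "g \<odot> s \<sqsubseteq> g \<odot> t"
proof -
  obtain A w where A: "A \<in> Obj E" and w: "w \<in> hom D (fobj F A) T" "so_morphism D w"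
    using F_cover D.hom_Obj(1)[OF s] by blast
  obtain x where x: "x \<in> hom E A X" "farr F x = s \<odot> w"
    using F_lift[OF A X D.comp_hom[OF w(1) s]] .
  obtain y where y: "y \<in> hom E A X" "farr F y = t \<odot> w"
    using F_lift[OF A X D.comp_hom[OF w(1) t]] .
  have "f \<odot> farr F x \<sqsubseteq> f \<odot> farr F y"
    unfolding x(2) y(2) D.comp_assoc[OF w(1) s f, symmetric] D.comp_assoc[OF w(1) t f, symmetric]
    by (rule D.comp_le(2)[OF st D.comp_hom[OF s f] D.comp_hom[OF t f] w(1)])
  then have "g \<odot> farr F x \<sqsubseteq> g \<odot> farr F y"
    by (rule le[OF x(1) y(1)])
  then have "(g \<odot> s) \<odot> w \<sqsubseteq> (g \<odot> t) \<odot> w"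
    unfolding x(2) y(2) D.comp_assoc[OF w(1) s g] D.comp_assoc[OF w(1) t g] .
  then show ?thesis
    by (rule D.so_order_epi[OF w(2,1) D.comp_hom[OF s g] D.comp_hom[OF t g]])
qed

text \<open>\<open>e\<close> and \<open>cover X A\<close> are \<open>so\<close>-morphisms out of
  \<open>F X\<close> with the same kernel, so each factors through the other; the factors are
  mutually inverse because \<open>so\<close>-morphisms are epic.\<close>

lemma Fbar_essentially_surjective:
  assumes Y: "Y \<in> Obj D"
  shows "\<exists>P \<in> Obj (ex_reg E). \<exists>t \<in> hom D (fobj Fbar P) Y. iso_in D t"
proof -
  obtain X e where X: "X \<in> Obj E" and e: "e \<in> hom D (fobj F X) Y" "so_morphism D e"
    using F_cover[OF Y] .
  obtain A where A: "congruence E X A"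
    and mem: "\<And>T x y. \<lbrakk>x \<in> hom E T X; y \<in> hom E T X\<rbrakk> \<Longrightarrow>
      rel_mem E x y A \<longleftrightarrow> e \<odot> farr F x \<sqsubseteq> e \<odot> farr F y"
    by (rule kernel_congruence[OF X e(1)]) blast
  note c = cover[OF X A]
  have P: "(X, A) \<in> Obj (ex_reg E)"
    using X A by simp
  note Pobj = B.fobj_Obj[OF P]
  have "\<exists>t \<in> hom D (fobj Fbar (X, A)) Y. e = t \<odot> cover X A"
  proof (rule D.so_factor[OF c(2,1) e(1)])
    fix T s t
    assume st: "s \<in> hom D T (fobj F X)" "t \<in> hom D T (fobj F X)" "cover X A \<odot> s \<sqsubseteq> cover X A \<odot> t"
    show "e \<odot> s \<sqsubseteq> e \<odot> t"
      by (rule kernel_le_tested[OF X c(1) e(1) _ st]) (simp only: cover_le_iff[OF X A] mem)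
  qed
  then obtain t where t: "t \<in> hom D (fobj Fbar (X, A)) Y" "e = t \<odot> cover X A"
    by blast
  have "\<exists>s \<in> hom D Y (fobj Fbar (X, A)). cover X A = s \<odot> e"
  proof (rule D.so_factor[OF e(2,1) c(1)])
    fix T s t
    assume st: "s \<in> hom D T (fobj F X)" "t \<in> hom D T (fobj F X)" "e \<odot> s \<sqsubseteq> e \<odot> t"
    show "cover X A \<odot> s \<sqsubseteq> cover X A \<odot> t"
      by (rule kernel_le_tested[OF X e(1) c(1) _ st]) (simp only: cover_le_iff[OF X A] mem)
  qed
  then obtain s where s: "s \<in> hom D Y (fobj Fbar (X, A))" "cover X A = s \<odot> e"
    by blast
  have "(s \<odot> t) \<odot> cover X A = Ident D (fobj Fbar (X, A)) \<odot> cover X A"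
    unfolding D.comp_assoc[OF c(1) t(1) s(1)] t(2)[symmetric] s(2)[symmetric] D.ident_left[OF c(1)] ..
  then have "s \<odot> t = Ident D (fobj Fbar (X, A))"
    by (rule D.so_epi[OF c(2,1) D.comp_hom[OF t(1) s(1)] D.ident_hom[OF Pobj]])
  moreover have "(t \<odot> s) \<odot> e = Ident D Y \<odot> e"
    unfolding D.comp_assoc[OF e(1) s(1) t(1)] s(2)[symmetric] t(2)[symmetric] D.ident_left[OF e(1)] ..
  then have "t \<odot> s = Ident D Y"
    by (rule D.so_epi[OF e(2,1) D.comp_hom[OF s(1) t(1)] D.ident_hom[OF Y]])
  ultimately have "iso_in D t"
    by (rule iso_inI[OF t(1) s(1)])
  then show ?thesis
    using P t(1) by blast
qed

end

theorem theorem5p6: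
  fixes E :: "('o, 'm) pcat"
    and D :: "('p, 'n) pcat"
    and F :: "('o, 'm, 'p, 'n) pfunctor"
    and Fbar :: "(('o, 'm) qobj, ('o, 'm) qarr, 'p, 'n) pfunctor"
  assumes "regular_category E"
    and "exact_category D"
    and "regular_functor E D F"
    and "regular_functor (ex_reg E) D Fbar"
    and "nat_isomorphic E D (comp_functor Fbar (Gamma E)) F"
  shows "equivalence_functor (ex_reg E) D Fbar \<longleftrightarrow>
    fully_order_faithful E D F \<and> covering E D F"
proof -
  have E: "reg_cat E" and D: "reg_cat D"
    using assms(1,2) by (simp_all add: reg_cat_def exact_category_def)
  interpret E: reg_cat E by fact
  obtain \<tau> \<sigma> where iso: "\<forall>X \<in> Obj E. \<tau> X \<in> hom D (fobj Fbar (X, hom_rel E X)) (fobj F X) \<and>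
      \<sigma> X \<in> hom D (fobj F X) (fobj Fbar (X, hom_rel E X)) \<and>
      \<sigma> X \<cdot>\<^bsub>D\<^esub> \<tau> X = Ident D (fobj Fbar (X, hom_rel E X)) \<and> \<tau> X \<cdot>\<^bsub>D\<^esub> \<sigma> X = Ident D (fobj F X)"
    and nat: "\<forall>X \<in> Obj E. \<forall>Y \<in> Obj E. \<forall>f \<in> hom E X Y.
      \<tau> Y \<cdot>\<^bsub>D\<^esub> farr Fbar (farr (Gamma E) f) = farr F f \<cdot>\<^bsub>D\<^esub> \<tau> X"
    by (rule nat_isomorphicE[OF assms(5)]) (simp add: comp_functor_def Gamma_def)
  interpret ext: extended_functor E D F Fbar \<tau> \<sigma>
    using iso nat E.hom_Obj
    by (intro extended_functor.intro extended_functor_axioms.intro E D assms(3,4)) blast+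
  show ?thesis
  proof
    assume "equivalence_functor (ex_reg E) D Fbar"
    note eq = equivalence_functorD[OF ext.R.pos_category_axioms ext.D.pos_category_axioms this]
    show "fully_order_faithful E D F \<and> covering E D F"
      using ext.F_fully_order_faithful[OF eq(2,1)] ext.F_covering[OF eq(3)] by blast
  next
    assume "fully_order_faithful E D F \<and> covering E D F"
    then interpret cov: covering_functor E D F Fbar \<tau> \<sigma>
      by unfold_locales (auto simp: fully_order_faithful_def)
    show "equivalence_functor (ex_reg E) D Fbar"
      by (rule equivalence_functorI[OF ext.R.pos_category_axioms ext.D.pos_category_axioms
            ext.B.pos_functor_axioms cov.Fbar_order_faithful cov.Fbar_full
            cov.Fbar_essentially_surjective])
  qed
qed

end
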